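(* Let $d\ge2$, let $\Omega\subset\mathbb{R}^d$ be a bounded $C^1$ domain, and let $\{T_k\}_{k\in\mathbb{Z}^d}$ be an admissible family of holes (see context) which are the closures of bounded subdomains of $Y$ with uniform $C^1$ boundaries. For $\varepsilon,\eta\in(0,1]$ let $\Omega_{\varepsilon,\eta}=\Omega\setminus\bigcup_k\varepsilon(k+\eta T_k)$, the union being over those $k\in\mathbb{Z}^d$ with $\varepsilon(k+Y)\subset\Omega$. Let $$C_p(\varepsilon,\eta)=\sup\|u\|_{L^p(\Omega_{\varepsilon,\eta})}$$ over all weak solutions $u\in W^{1,2}_0(\Omega_{\varepsilon,\eta})$ of $-\Delta u=\mathrm{div}(f)$ in $\Omega_{\varepsilon,\eta}$ with $f\in L^p(\Omega_{\varepsilon,\eta};\mathbb{R}^d)\cap L^2(\Omega_{\varepsilon,\eta};\mathbb{R}^d)$, $\|f\|_{L^p(\Omega_{\varepsilon,\eta})}=1$, and $$D_p(\varepsilon,\eta)=\sup\|u\|_{L^p(\Omega_{\varepsilon,\eta})}$$ over all weak solutions $u\in W^{1,2}_0(\Omega_{\varepsilon,\eta})$ of $-\Delta u=F$ in $\Omega_{\varepsilon,\eta}$ with $F\in L^p(\Omega_{\varepsilon,\eta})\cap L^2(\Omega_{\varepsilon,\eta})$, $\|F\|_{L^p(\Omega_{\varepsilon,\eta})}=1$. Then: 1. For $2\le p<\infty$, $$C_p(\varepsilon,\eta)\le\begin{cases}C\min(1,\varepsilon\eta^{\frac{2-d}2})&\text{if }d\ge3,\\ C\min(1,\varepsilon|\ln(\eta/2)|^{1/2})&\text{if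 }d=2.\end{cases}$$ 2. For $1<p<\infty$, $$D_p(\varepsilon,\eta)\le\begin{cases}C\min(1,\varepsilon^2\eta^{2-d})&\text{if }d\ge3,\\ C\min(1,\varepsilon^2|\ln(\eta/2)|)&\text{if }d=2.\end{cases}$$ The constants $C$ depend only on $d$, $p$, $c_0$ and $\Omega$.
   Context: $Y=[-1/2,1/2]^d$. An admissible family of holes is a family $\{T_k\}_{k\in\mathbb Z^d}$ of closed subsets of $Y$ such that each $T_k$ is the closure of a bounded Lipschitz domain, $Y\setminus T_k$ is connected, and for some $c_0>0$ independent of $k$, $B(0,c_0)\subset T_k$ and $\mathrm{dist}(\partial T_k,\partial Y)\ge c_0$ for all $k$. Uniform $C^1$ boundaries: a family of bounded domains $\{\Omega_k\}$ has uniform $C^1$ boundaries if there are $N\in\mathbb{N}$, $M>0$ and a continuous increasing function $\xi$ on $[0,\infty)$ with $\xi(0)=0$ such that for each $k$, $\partial\Omega_k$ can be covered by $N$ balls $B(x_i,r_0)$, $x_i\in\partial\Omega_k$, $r_0>0$, so that after a translation and rotation of coordinates (depending on $i$) $B(x_i,10r_0)\cap\Omega_k=B(x_i,10r_0)\cap\{(x',x_d): x_d>\psi_i(x')\}$ and $B(x_i,10r_0)\cap\partial\Omega_k=B(x_i,10r_0)\cap\{x_d=\psi_i(x')\}$, where $\psi_i:\mathbb{R}^{d-1}\to\mathbb{R}$ is $C^1$ with $\|\nabla\psi_i\|_\infty\le M$ and the modulus of continuity of $\nabla\psi_i$ is bounded by $\xi$. $W^{1,2}_0(\Omega)$ is the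 completion of $C_0^\infty(\Omega)$ with respect to the norm $\|\nabla\psi\|_{L^2(\Omega)}$. A weak solution of $-\Delta u=F+\mathrm{div}(f)$ satisfies $\int\nabla u\cdot\nabla\phi=\int F\phi-\int f\cdot\nabla\phi$ for all $\phi\in C_0^\infty$. *)

theory Defs
  imports "HOL-Analysis.Analysis"
begin

definition bounded_domain :: "'a::euclidean_space set \<Rightarrow> bool" where
  "bounded_domain S \<longleftrightarrow> open S \<and> connected S \<and> S \<noteq> {} \<and> bounded S"

text \<open>
  A function on $R^{d-1}$ is encoded as a function \<open>\<psi>\<close> on $R^d$ that does not depend on the
  coordinate \<open>j\<close>, which plays the role of $x_d$; the gradient of such a \<open>\<psi>\<close> on $R^d$ is the
  $(d-1)$-dimensional gradient with a zero in position \<open>j\<close>. The new coordinates of a point \<open>z\<close>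
  are \<open>Q (z - a)\<close>, with \<open>Q\<close> a rotation.
\<close>

definition local_graph ::
  "(real^'n) set \<Rightarrow> real^'n \<Rightarrow> real \<Rightarrow> (real^'n \<Rightarrow> real) \<Rightarrow> bool" where
  "local_graph S x r \<psi> \<longleftrightarrow>
     (\<exists>Q a j. orthogonal_transformation Q \<and> det (matrix Q) = 1 \<and>
        (\<forall>y t. \<psi> (y + t *\<^sub>R axis j 1) = \<psi> y) \<and>
        ball x r \<inter> S = ball x r \<inter> {z. Q (z - a) $ j > \<psi> (Q (z - a))} \<and>
        ball x r \<inter> frontier S = ball x r \<inter> {z. Q (z - a) $ j = \<psi> (Q (z - a))})"

definition bounded_Lipschitz_domain :: "(real^'n) set \<Rightarrow> bool" where
  "bounded_Lipschitz_domain S \<longleftrightarrow> bounded_domain S \<and>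
     (\<forall>x\<in>frontier S. \<exists>r>0. \<exists>\<psi> L. local_graph S x r \<psi> \<and> L-lipschitz_on UNIV \<psi>)"

definition uniform_C1_boundaries :: "('k \<Rightarrow> (real^'n) set) \<Rightarrow> bool" where
  "uniform_C1_boundaries D \<longleftrightarrow>
     (\<forall>k. bounded_domain (D k)) \<and>
     (\<exists>(N::nat) (M::real) (\<xi> :: real \<Rightarrow> real).
        M > 0 \<and> continuous_on {0..} \<xi> \<and> mono_on {0..} \<xi> \<and> \<xi> 0 = 0 \<and>
        (\<forall>k. \<exists>r0>0. \<exists>x.
           (\<forall>i<N. x i \<in> frontier (D k)) \<and>
           frontier (D k) \<subseteq> (\<Union>i<N. ball (x i) r0) \<and>
           (\<forall>i<N. \<exists>\<psi> G. local_graph (D k) (x i) (10 * r0) \<psi> \<and>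
              (\<forall>y. GDERIV \<psi> y :> G y) \<and> continuous_on UNIV G \<and>
              (\<forall>y. norm (G y) \<le> M) \<and>
              (\<forall>y z. norm (G y - G z) \<le> \<xi> (dist y z)))))"

text \<open>
  For one bounded domain, a uniformly C1 boundary is the same as a C1 boundary, because the
  boundary is compact.
\<close>

definition bounded_C1_domain :: "(real^'n) set \<Rightarrow> bool" where
  "bounded_C1_domain S \<longleftrightarrow> uniform_C1_boundaries (\<lambda>_::unit. S)"

definition unit_cell :: "(real^'n) set" where
  "unit_cell = {x. \<forall>i. \<bar>x $ i\<bar> \<le> 1 / 2}"

definition lattice_point :: "int^'n \<Rightarrow> real^'n" where
  "lattice_point k = (\<chi> i. of_int (k $ i))"

definition admissible_holes :: "real \<Rightarrow> (int^'n \<Rightarrow> (real^'n) set) \<Rightarrow> bool" where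
  "admissible_holes c0 T \<longleftrightarrow> c0 > 0 \<and>
     (\<forall>k. closed (T k) \<and> T k \<subseteq> unit_cell \<and>
        (\<exists>S. bounded_Lipschitz_domain S \<and> T k = closure S) \<and>
        connected (unit_cell - T k) \<and>
        ball 0 c0 \<subseteq> T k \<and>
        setdist (frontier (T k)) (frontier unit_cell) \<ge> c0)"

definition perforated ::
  "(real^'n) set \<Rightarrow> (int^'n \<Rightarrow> (real^'n) set) \<Rightarrow> real \<Rightarrow> real \<Rightarrow> (real^'n) set" where
  "perforated \<Omega> T \<epsilon> \<eta> =
     \<Omega> - (\<Union>k\<in>{k. (\<lambda>y. \<epsilon> *\<^sub>R (lattice_point k + y)) ` unit_cell \<subseteq> \<Omega>}.
            (\<lambda>y. \<epsilon> *\<^sub>R (lattice_point k + \<eta> *\<^sub>R y)) ` T k)"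

text \<open>
  The \<open>L\<^sup>p\<close> norm takes values in \<^typ>\<open>ennreal\<close>, so that it equals \<open>\<infinity>\<close> off \<open>L\<^sup>p\<close>.
\<close>

definition Lp_norm ::
  "real \<Rightarrow> 'a::euclidean_space set \<Rightarrow> ('a \<Rightarrow> 'b::real_normed_vector) \<Rightarrow> ennreal" where
  "Lp_norm p U f =
     (let I = (\<integral>\<^sup>+x. ennreal (norm (f x) powr p) \<partial>lebesgue_on U)
      in if I = \<infinity> then \<infinity> else ennreal (enn2real I powr (1 / p)))"

definition Lp_space ::
  "real \<Rightarrow> 'a::euclidean_space set \<Rightarrow> ('a \<Rightarrow> 'b::real_normed_vector) set" where
  "Lp_space p U = {f. f \<in> borel_measurable (lebesgue_on U) \<and> Lp_norm p U f < \<infinity>}"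

definition grad :: "(real^'n \<Rightarrow> real) \<Rightarrow> real^'n \<Rightarrow> real^'n" where
  "grad \<phi> x = (\<chi> i. frechet_derivative \<phi> (at x) (axis i 1))"

primrec C_k :: "nat \<Rightarrow> (real^'n \<Rightarrow> real) \<Rightarrow> bool" where
  "C_k 0 \<phi> \<longleftrightarrow> continuous_on UNIV \<phi>"
| "C_k (Suc m) \<phi> \<longleftrightarrow>
     (\<forall>x. \<phi> differentiable (at x)) \<and> (\<forall>i. C_k m (\<lambda>x. grad \<phi> x $ i))"

definition test_functions :: "(real^'n) set \<Rightarrow> (real^'n \<Rightarrow> real) set" where
  "test_functions U =
     {\<phi>. (\<forall>m. C_k m \<phi>) \<and> compact (closure {x. \<phi> x \<noteq> 0}) \<and> closure {x. \<phi> x \<noteq> 0} \<subseteq> U}"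

text \<open>
  The completion of the test functions in the norm \<open>\<parallel>\<nabla>\<psi>\<parallel>\<close> of \<open>L\<^sup>2(U)\<close>, realised as a space of
  functions: by the Poincare inequality on a bounded open set \<open>U\<close>, a Cauchy sequence in this
  norm converges in \<open>L\<^sup>2(U)\<close>, and the element of the completion that it represents is identified
  with the limit. The definition is meant for bounded open \<open>U\<close> only.
\<close>

definition W012 :: "(real^'n) set \<Rightarrow> (real^'n \<Rightarrow> real) set" where
  "W012 U = {u. u \<in> Lp_space 2 U \<and>
     (\<exists>\<phi>. (\<forall>n. \<phi> n \<in> test_functions U) \<and>
        (\<forall>e>0. \<exists>N. \<forall>m\<ge>N. \<forall>n\<ge>N. Lp_norm 2 U (grad (\<lambda>x. \<phi> m x - \<phi> n x)) < ennreal e) \<and>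
        (\<lambda>n. Lp_norm 2 U (\<lambda>x. \<phi> n x - u x)) \<longlonglongrightarrow> 0)}"

definition L2_weak_gradient ::
  "(real^'n) set \<Rightarrow> (real^'n \<Rightarrow> real) \<Rightarrow> (real^'n \<Rightarrow> real^'n) \<Rightarrow> bool" where
  "L2_weak_gradient U u g \<longleftrightarrow> u \<in> Lp_space 2 U \<and> g \<in> Lp_space 2 U \<and>
     (\<forall>\<phi>\<in>test_functions U.
        (\<integral>x. u x *\<^sub>R grad \<phi> x \<partial>lebesgue_on U) = - (\<integral>x. \<phi> x *\<^sub>R g x \<partial>lebesgue_on U))"

text \<open>The equation is $-\Delta u = F + div f$; the weak gradient of \<open>u\<close> is unique a.e.\<close>

definition weak_solution ::
  "(real^'n) set \<Rightarrow> (real^'n \<Rightarrow> real) \<Rightarrow> (real^'n \<Rightarrow> real^'n) \<Rightarrow> (real^'n \<Rightarrow> real) \<Rightarrow> bool" where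
  "weak_solution U F f u \<longleftrightarrow> u \<in> W012 U \<and>
     (\<exists>g. L2_weak_gradient U u g \<and>
        (\<forall>\<phi>\<in>test_functions U.
           (\<integral>x. g x \<bullet> grad \<phi> x \<partial>lebesgue_on U) =
           (\<integral>x. F x * \<phi> x \<partial>lebesgue_on U) - (\<integral>x. f x \<bullet> grad \<phi> x \<partial>lebesgue_on U)))"

definition C_const :: "real \<Rightarrow> (real^'n) set \<Rightarrow> ennreal" where
  "C_const p U = Sup {Lp_norm p U u | u f.
     f \<in> Lp_space p U \<and> f \<in> Lp_space 2 U \<and> Lp_norm p U f = 1 \<and>
     weak_solution U (\<lambda>_. 0) f u}"

definition D_const :: "real \<Rightarrow> (real^'n) set \<Rightarrow> ennreal" where
  "D_const p U = Sup {Lp_norm p U u | u F.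
     F \<in> Lp_space p U \<and> F \<in> Lp_space 2 U \<and> Lp_norm p U F = 1 \<and>
     weak_solution U F (\<lambda>_. 0) u}"

end

theory Submission
  imports Defs
begin

text \<open>
  Everything follows from a Poincare inequality
  $\int \phi^2 \le S \int |\nabla\phi|^2$ on the perforated domain with
  $S = C \min(1, \varepsilon^2 \eta^{2-d})$ (a logarithm replaces the power for $d = 2$).
  Formally, test the equation with $|u|^{p-2}u$ and apply the Poincare inequality to
  $|u|^{p/2}$, whose squared gradient is $p^2/4$ times $|u|^{p-2}|\nabla u|^2$; Young's inequality
  then gives $\|u\|_p \le C S^{1/2}\|f\|_p$ and $\|u\|_p \le C S\|F\|_p$. To make this rigorous
  the powers are replaced by smooth bounded functions that vanish at zero and are applied
  to the test functions that approximate \<open>u\<close>.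

  The Poincare inequality is proved cell by cell. In a cell contained in $\Omega$ one integrates
  along rays from the hole with a weight adapted to the dimension. A point in a cell
  that is not contained in $\Omega$ leaves $\Omega$ after a translation of length
  $O(\varepsilon)$ in one of finitely many fixed directions, because the boundary is locally a
  Lipschitz graph.
\<close>

section \<open>Gradients and test functions\<close>

text \<open>The weak formulation admits only smooth test functions, and \<open>u\<close> is known
  only as an L2 limit of test functions with Cauchy gradients. The derivative of |s|^(p-2) s is
  unbounded for p > 2 and singular at zero for p < 2; its replacement has a bounded derivative, so
  that composed test functions keep gradients bounded in L2 and the equation survives the limit. For
  p < 2 the coercivity of the power degrades to p - 1, whence the factor min(1, p - 1) in the
  constants. The size of S comes from the integral of t^(1-d) over [tau, 1] with tau comparable to
  eta: up to constants it is at most eta^(2-d), or |ln(eta/2)| if d = 2, the inverse capacity of a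
  ball of radius eta in a unit cell. A hole enters through the ball of radius c0 inside it, which
  makes the estimate uniform over all families. Cells not contained in Omega cost only a multiple of
  eps^2, which is absorbed because the factor multiplying eps^2 in S is at least ln 2. The 1 in the
  minimum is the Poincare inequality of Omega itself.\<close>

lemma grad_has_derivative:
  assumes "\<phi> differentiable (at x)"
  shows "(\<phi> has_derivative (\<lambda>h. grad \<phi> x \<bullet> h)) (at x)"
proof -
  have d: "(\<phi> has_derivative frechet_derivative \<phi> (at x)) (at x)"
    using assms frechet_derivative_works by blast
  then have lin: "linear (frechet_derivative \<phi> (at x))"
    using has_derivative_linear by blast
  have "frechet_derivative \<phi> (at x) h = grad \<phi> x \<bullet> h" for h
  proof -
    have "frechet_derivative \<phi> (at x) h = frechet_derivative \<phi> (at x) (\<Sum>i\<in>UNIV. h $ i *\<^sub>R axis i 1)"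
      by (simp add: basis_expansion flip: scalar_mult_eq_scaleR)
    also have "\<dots> = (\<Sum>i\<in>UNIV. h $ i * frechet_derivative \<phi> (at x) (axis i 1))"
      using lin by (simp add: linear_sum linear_cmul)
    also have "\<dots> = grad \<phi> x \<bullet> h"
      by (simp add: grad_def inner_vec_def mult.commute)
    finally show ?thesis .
  qed
  then show ?thesis using d by (metis (no_types, lifting) ext)
qed

lemma grad_eqI:
  assumes "(\<phi> has_derivative (\<lambda>h. v \<bullet> h)) (at x)"
  shows "grad \<phi> x = v"
proof -
  have "frechet_derivative \<phi> (at x) = (\<lambda>h. v \<bullet> h)"
    using assms frechet_derivative_at by metis
  then show ?thesis by (simp add: grad_def vec_eq_iff inner_axis)
qed

lemma grad_const: "grad (\<lambda>_. c) x = 0"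
  by (rule grad_eqI) auto

lemma grad_add:
  assumes "f differentiable (at x)" "g differentiable (at x)"
  shows "grad (\<lambda>x. f x + g x) x = grad f x + grad g x"
  using assms
  by (intro grad_eqI) (auto intro!: derivative_eq_intros grad_has_derivative simp: inner_add_left)

lemma grad_diff:
  assumes "f differentiable (at x)" "g differentiable (at x)"
  shows "grad (\<lambda>x. f x - g x) x = grad f x - grad g x"
  using assms
  by (intro grad_eqI) (auto intro!: derivative_eq_intros grad_has_derivative simp: inner_diff_left)

lemma grad_mult:
  assumes "f differentiable (at x)" "g differentiable (at x)"
  shows "grad (\<lambda>x. f x * g x) x = f x *\<^sub>R grad g x + g x *\<^sub>R grad f x"
  using assms
  by (intro grad_eqI)
     (auto intro!: derivative_eq_intros grad_has_derivative simp: inner_add_left algebra_simps)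

lemma grad_compose:
  assumes "f differentiable (at x)" "(g has_real_derivative g') (at (f x))"
  shows "grad (\<lambda>x. g (f x)) x = g' *\<^sub>R grad f x"
proof (rule grad_eqI)
  have "((\<lambda>x. g (f x)) has_derivative (\<lambda>h. g' * (grad f x \<bullet> h))) (at x)"
    using has_derivative_compose[OF grad_has_derivative[OF assms(1)]] assms(2)
    by (simp add: has_field_derivative_def)
  then show "((\<lambda>x. g (f x)) has_derivative (\<lambda>h. g' *\<^sub>R grad f x \<bullet> h)) (at x)"
    by simp
qed

lemma C_k_Suc_imp: "C_k (Suc m) \<phi> \<Longrightarrow> C_k m \<phi>"
proof (induction m arbitrary: \<phi>)
  case 0
  then show ?case
    by (auto intro!: differentiable_imp_continuous_on simp: differentiable_on_def
        intro: differentiable_at_withinI)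
next
  case (Suc m)
  then show ?case by (auto)
qed

lemma C_k_const: "C_k m (\<lambda>_. c)"
  by (induction m arbitrary: c) (auto simp: grad_const)

lemma C_k_add: "C_k m f \<Longrightarrow> C_k m g \<Longrightarrow> C_k m (\<lambda>x. f x + g x)"
proof (induction m arbitrary: f g)
  case 0 then show ?case by (auto intro: continuous_intros)
next
  case (Suc m)
  then show ?case by (auto simp: grad_add)
qed

lemma C_k_mult: "C_k m f \<Longrightarrow> C_k m g \<Longrightarrow> C_k m (\<lambda>x. f x * g x)"
proof (induction m arbitrary: f g)
  case 0 then show ?case by (auto intro: continuous_intros)
next
  case (Suc m)
  then have "C_k m f" "C_k m g" using C_k_Suc_imp by blast+
  then show ?case using Suc by (auto simp: grad_mult intro!: C_k_add)
qed

text \<open>The partial derivatives of \<open>f powr a\<close> are \<open>a * f powr (a - 1)\<close>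
  times those of \<open>f\<close>, so the induction must leave the exponent free. Positivity of
  \<open>f\<close> keeps every exponent harmless.\<close>

lemma C_k_powr:
  assumes "\<And>x. f x > 0"
  shows "C_k m f \<Longrightarrow> C_k m (\<lambda>x. f x powr a)"
proof (induction m arbitrary: a)
  case 0
  have "f x \<noteq> 0" for x using assms[of x] by simp
  with 0 show ?case by (auto intro!: continuous_intros)
next
  case (Suc m)
  have diff: "f differentiable (at x)" for x using Suc.prems by simp
  have der: "((\<lambda>s. s powr a) has_real_derivative a * f x powr (a - 1)) (at (f x))" for x
    using has_real_derivative_powr[OF assms] .
  have gr: "grad (\<lambda>x. f x powr a) x $ i = a * f x powr (a - 1) * grad f x $ i" for x i
    using grad_compose[OF diff der] by simp
  have "(\<lambda>x. f x powr a) differentiable (at x)" for x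
    using has_derivative_compose[OF grad_has_derivative[OF diff] der[of x, unfolded has_field_derivative_def]]
    unfolding differentiable_def by blast
  moreover have "C_k m (\<lambda>x. a * f x powr (a - 1) * grad f x $ i)" for i
    using Suc.prems C_k_Suc_imp Suc.IH by (intro C_k_mult C_k_const) auto
  ultimately show ?case by (simp add: gr)
qed

definition smooth :: "(real^'n \<Rightarrow> real) \<Rightarrow> bool" where
  "smooth \<phi> \<longleftrightarrow> (\<forall>m. C_k m \<phi>)"

lemma smooth_const [intro]: "smooth (\<lambda>_. c)"
  by (simp add: smooth_def C_k_const)

lemma smooth_add [intro]: "smooth f \<Longrightarrow> smooth g \<Longrightarrow> smooth (\<lambda>x. f x + g x)"
  by (simp add: smooth_def C_k_add)

lemma smooth_mult [intro]: "smooth f \<Longrightarrow> smooth g \<Longrightarrow> smooth (\<lambda>x. f x * g x)"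
  by (simp add: smooth_def C_k_mult)

lemma smooth_diff [intro]:
  assumes "smooth f" "smooth g" shows "smooth (\<lambda>x. f x - g x)"
proof -
  have "smooth (\<lambda>x. f x + (-1) * g x)"
    by (intro smooth_add smooth_mult smooth_const assms)
  then show ?thesis by simp
qed

lemma smooth_power2 [intro]: "smooth f \<Longrightarrow> smooth (\<lambda>x. (f x)\<^sup>2)"
  by (simp add: power2_eq_square smooth_mult)

lemma smooth_powr [intro]: "(\<And>x. f x > 0) \<Longrightarrow> smooth f \<Longrightarrow> smooth (\<lambda>x. f x powr a)"
  by (simp add: smooth_def C_k_powr)

lemma smooth_grad: "smooth f \<Longrightarrow> smooth (\<lambda>x. grad f x $ i)"
  unfolding smooth_def by (metis C_k.simps(2))

lemma smooth_differentiable: "smooth f \<Longrightarrow> f differentiable (at x)"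
  unfolding smooth_def by (metis C_k.simps(2))

lemma smooth_has_derivative: "smooth f \<Longrightarrow> (f has_derivative (\<lambda>h. grad f x \<bullet> h)) (at x)"
  by (simp add: grad_has_derivative smooth_differentiable)

lemma smooth_continuous: "smooth f \<Longrightarrow> continuous_on S f"
  unfolding smooth_def by (metis C_k.simps(1) continuous_on_subset subset_UNIV)

lemma smooth_continuous_grad: "smooth f \<Longrightarrow> continuous_on S (grad f)"
proof -
  assume "smooth f"
  then have "continuous_on S (\<lambda>x. \<chi> i. grad f x $ i)"
    by (intro continuous_on_vec_lambda smooth_continuous smooth_grad)
  then show ?thesis by simp
qed

lemma test_functions_iff:
  "\<phi> \<in> test_functions U \<longleftrightarrow>
     smooth \<phi> \<and> compact (closure {x. \<phi> x \<noteq> 0}) \<and> closure {x. \<phi> x \<noteq> 0} \<subseteq> U"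
  by (simp add: test_functions_def smooth_def)

lemma test_functions_smooth: "\<phi> \<in> test_functions U \<Longrightarrow> smooth \<phi>"
  by (simp add: test_functions_iff)

text \<open>The support can only shrink. This serves products with a test function and compositions
  with a function that vanishes at zero.\<close>

lemma test_functionsI:
  assumes "\<phi> \<in> test_functions U" "smooth \<psi>" "\<And>x. \<phi> x = 0 \<Longrightarrow> \<psi> x = 0"
  shows "\<psi> \<in> test_functions U"
proof -
  have c: "closure {x. \<psi> x \<noteq> 0} \<subseteq> closure {x. \<phi> x \<noteq> 0}"
    using assms(3) by (intro closure_mono) auto
  then have "compact (closure {x. \<psi> x \<noteq> 0})"
    using assms(1) unfolding test_functions_iff
    by (metis closed_closure compact_Int_closed inf.absorb_iff2)
  then show ?thesis
    using c assms(1,2) by (auto simp: test_functions_iff)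
qed

lemma grad_zero_outside_support:
  assumes "x \<notin> closure {x. \<phi> x \<noteq> 0}" shows "grad \<phi> x = 0"
proof (rule grad_eqI)
  have "((\<lambda>_. 0::real) has_derivative (\<lambda>h. 0 \<bullet> h)) (at x)" by simp
  then show "(\<phi> has_derivative (\<lambda>h. 0 \<bullet> h)) (at x)"
  proof (rule has_derivative_transform_within_open)
    show "open (- closure {x. \<phi> x \<noteq> 0})" by (simp add: open_Compl)
    show "x \<in> - closure {x. \<phi> x \<noteq> 0}" using assms by simp
    show "\<And>y. y \<in> - closure {x. \<phi> x \<noteq> 0} \<Longrightarrow> 0 = \<phi> y"
      using closure_subset[of "{x. \<phi> x \<noteq> 0}"] by (metis (mono_tags, lifting) ComplD mem_Collect_eq subsetD)
  qed
qed

lemma test_functions_grad: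
  assumes "\<phi> \<in> test_functions U"
  shows "(\<lambda>x. grad \<phi> x $ i) \<in> test_functions U"
proof -
  have "{x. grad \<phi> x $ i \<noteq> 0} \<subseteq> closure {x. \<phi> x \<noteq> 0}"
    using grad_zero_outside_support[of _ \<phi>] by force
  then have c: "closure {x. grad \<phi> x $ i \<noteq> 0} \<subseteq> closure {x. \<phi> x \<noteq> 0}"
    by (simp add: closure_minimal)
  moreover have "compact (closure {x. grad \<phi> x $ i \<noteq> 0})"
    using c assms unfolding test_functions_iff
    by (metis closed_closure compact_Int_closed inf.absorb_iff2)
  ultimately show ?thesis
    using assms by (auto simp: test_functions_iff smooth_grad)
qed

lemma test_functions_outside:
  assumes "\<phi> \<in> test_functions U" "x \<notin> U" shows "\<phi> x = 0" "grad \<phi> x = 0"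
proof -
  have "x \<notin> closure {x. \<phi> x \<noteq> 0}" using assms by (auto simp: test_functions_iff)
  then show "grad \<phi> x = 0" "\<phi> x = 0"
    using closure_subset[of "{x. \<phi> x \<noteq> 0}"] grad_zero_outside_support by blast+
qed

lemma test_functions_bounded:
  assumes "\<phi> \<in> test_functions U"
  obtains B where "B > 0" "\<And>x. \<bar>\<phi> x\<bar> \<le> B"
proof -
  have "compact (\<phi> ` closure {x. \<phi> x \<noteq> 0})"
    using assms by (intro compact_continuous_image smooth_continuous) (auto simp: test_functions_iff)
  then obtain B where B: "B > 0" "\<And>y. y \<in> \<phi> ` closure {x. \<phi> x \<noteq> 0} \<Longrightarrow> norm y \<le> B"
    using bounded_pos compact_imp_bounded by metis
  have "\<bar>\<phi> x\<bar> \<le> B" for x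
  proof (cases "\<phi> x = 0")
    case False
    then have "x \<in> closure {x. \<phi> x \<noteq> 0}" using closure_subset[of "{x. \<phi> x \<noteq> 0}"] by blast
    then show ?thesis using B(2) by fastforce
  qed (use B in auto)
  then show ?thesis using that B by blast
qed

lemma test_functions_grad_bounded:
  fixes \<phi> :: "real^'n \<Rightarrow> real"
  assumes "\<phi> \<in> test_functions U"
  obtains B where "B > 0" "\<And>x. norm (grad \<phi> x) \<le> B"
proof -
  have "\<exists>B. \<forall>x. \<bar>grad \<phi> x $ i\<bar> \<le> B" for i
    using test_functions_bounded[OF test_functions_grad[OF assms, of i]] by metis
  then obtain B where B: "\<And>i x. \<bar>grad \<phi> x $ i\<bar> \<le> B i" by metis
  have "norm (grad \<phi> x) \<le> (\<Sum>i\<in>UNIV. B i)" for x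
    using norm_le_l1_cart[of "grad \<phi> x"] sum_mono[of UNIV "\<lambda>i. \<bar>grad \<phi> x $ i\<bar>" B] B by force
  then have "norm (grad \<phi> x) \<le> 1 + \<bar>\<Sum>i\<in>UNIV. B i\<bar>" for x
    by (rule order_trans) simp
  then show ?thesis using that[of "1 + \<bar>\<Sum>i\<in>UNIV. B i\<bar>"] by simp
qed

section \<open>Square integrable functions\<close>

text \<open>The optimal parameter is t = sqrt (B / A); if \<open>A\<close> or \<open>B\<close> is
  zero, an extreme choice of t forces x = 0. With this, a Cauchy-Schwarz inequality for any kind of
  integral follows by integrating a pointwise Young inequality.\<close>

lemma square_le_of_Young:
  fixes x A B :: real
  assumes "A \<ge> 0" "B \<ge> 0" "\<And>t. t > 0 \<Longrightarrow> 2 * \<bar>x\<bar> \<le> t * A + B / t"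
  shows "x\<^sup>2 \<le> A * B"
proof (cases "A > 0 \<and> B > 0")
  case True
  define t where "t = sqrt (B / A)"
  have t: "t > 0" using True by (simp add: t_def)
  have t2: "t\<^sup>2 = B / A" using True by (simp add: t_def)
  have "2 * \<bar>x\<bar> \<le> t * A + B / t" using assms(3) t by blast
  also have "B / t = t * A"
    using t t2 True by (simp add: field_simps power2_eq_square)
  finally have "\<bar>x\<bar> \<le> t * A" by linarith
  then have "\<bar>x\<bar>\<^sup>2 \<le> (t * A)\<^sup>2" by (intro power_mono) auto
  also have "(t * A)\<^sup>2 = A * B"
    unfolding power_mult_distrib t2 using True by (simp add: power2_eq_square)
  finally show ?thesis by simp
next
  case False
  have "x = 0"
  proof (rule ccontr)
    assume x: "x \<noteq> 0"
    show False
    proof (cases "A = 0")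
      case True
      have "2 * \<bar>x\<bar> \<le> B / ((B + 1) / \<bar>x\<bar>)"
        using assms(3)[of "(B + 1) / \<bar>x\<bar>"] x assms(2) True by simp
      also have "\<dots> = \<bar>x\<bar> * (B / (B + 1))" by simp
      also have "\<dots> \<le> \<bar>x\<bar> * 1" using assms(2) by (intro mult_left_mono) auto
      finally show False using x by simp
    next
      case False
      with \<open>\<not> (A > 0 \<and> B > 0)\<close> assms have "B = 0" "A > 0" by auto
      then have "2 * \<bar>x\<bar> \<le> \<bar>x\<bar>" using assms(3)[of "\<bar>x\<bar> / A"] x by simp
      then show False using x by simp
    qed
  qed
  then show ?thesis using assms by simp
qed

text \<open>Passing to p-th powers removes the case distinction in \<open>Lp_norm\<close>: an
  infinite integral makes both sides false.\<close>

lemma Lp_norm_le_iff: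
  assumes "p > 0" "c \<ge> 0"
  shows "Lp_norm p U f \<le> ennreal c \<longleftrightarrow>
    (\<integral>\<^sup>+x. ennreal (norm (f x) powr p) \<partial>lebesgue_on U) \<le> ennreal (c powr p)"
proof (cases "\<integral>\<^sup>+x. ennreal (norm (f x) powr p) \<partial>lebesgue_on U")
  case (real r)
  have "r powr (1 / p) \<le> c \<longleftrightarrow> r \<le> c powr p"
  proof
    assume "r powr (1 / p) \<le> c"
    then have "(r powr (1 / p)) powr p \<le> c powr p"
      using assms by (intro powr_mono2) auto
    then show "r \<le> c powr p" using real assms by (simp add: powr_powr)
  next
    assume "r \<le> c powr p"
    then have "r powr (1 / p) \<le> (c powr p) powr (1 / p)"
      using assms real by (intro powr_mono2) auto
    then show "r powr (1 / p) \<le> c" using real assms by (simp add: powr_powr)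
  qed
  then show ?thesis using real assms by (simp add: Lp_norm_def Let_def)
next
  case top
  then show ?thesis by (simp add: Lp_norm_def Let_def top_unique)
qed

text \<open>L2 membership with a natural square and a Bochner integral in place of
  \<open>powr\<close> and an extended norm, so that squares can be expanded and inner products
  integrated.\<close>

definition square_integrable :: "'a measure \<Rightarrow> ('a \<Rightarrow> 'b::euclidean_space) \<Rightarrow> bool" where
  "square_integrable M f \<longleftrightarrow> f \<in> borel_measurable M \<and> integrable M (\<lambda>x. (norm (f x))\<^sup>2)"

lemma square_integrable_inner:
  assumes "square_integrable M f" "square_integrable M g"
  shows "integrable M (\<lambda>x. f x \<bullet> g x)"
proof (rule Bochner_Integration.integrable_bound)
  show "integrable M (\<lambda>x. (norm (f x))\<^sup>2 + (norm (g x))\<^sup>2)"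
    using assms by (simp add: square_integrable_def)
  show "(\<lambda>x. f x \<bullet> g x) \<in> borel_measurable M"
    using assms by (auto simp: square_integrable_def)
  have "\<bar>f x \<bullet> g x\<bar> \<le> (norm (f x))\<^sup>2 + (norm (g x))\<^sup>2" for x
    using Cauchy_Schwarz_ineq2[of "f x" "g x"] sum_squares_bound[of "norm (f x)" "norm (g x)"]
      mult_nonneg_nonneg[OF norm_ge_zero[of "f x"] norm_ge_zero[of "g x"]]
    by linarith
  then show "AE x in M. norm (f x \<bullet> g x) \<le> norm ((norm (f x))\<^sup>2 + (norm (g x))\<^sup>2)"
    by (intro AE_I2) simp
qed

lemma square_integrable_diff:
  assumes "square_integrable M f" "square_integrable M g"
  shows "square_integrable M (\<lambda>x. f x - g x)"
proof -
  have "(\<lambda>x. (norm (f x - g x))\<^sup>2) = (\<lambda>x. (norm (f x))\<^sup>2 + (norm (g x))\<^sup>2 - 2 * (f x \<bullet> g x))"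
    by (auto simp: power2_norm_eq_inner inner_diff_left inner_diff_right inner_commute)
  moreover have "integrable M (\<lambda>x. (norm (f x))\<^sup>2 + (norm (g x))\<^sup>2 - 2 * (f x \<bullet> g x))"
    using assms square_integrable_inner[OF assms]
    by (intro Bochner_Integration.integrable_diff Bochner_Integration.integrable_add
        integrable_mult_right) (auto simp: square_integrable_def)
  ultimately show ?thesis using assms by (auto simp: square_integrable_def)
qed

lemma square_integrable_Cauchy_Schwarz:
  assumes "square_integrable M f" "square_integrable M g"
  shows "(\<integral>x. f x \<bullet> g x \<partial>M)\<^sup>2 \<le> (\<integral>x. (norm (f x))\<^sup>2 \<partial>M) * (\<integral>x. (norm (g x))\<^sup>2 \<partial>M)"
proof (rule square_le_of_Young)
  fix t :: real assume t: "t > 0"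
  have pw: "2 * \<bar>f x \<bullet> g x\<bar> \<le> t * (norm (f x))\<^sup>2 + (norm (g x))\<^sup>2 / t" for x
  proof -
    have "0 \<le> (t * norm (f x) - norm (g x))\<^sup>2 / t" using t by simp
    also have "\<dots> = t * (norm (f x))\<^sup>2 + (norm (g x))\<^sup>2 / t - 2 * (norm (f x) * norm (g x))"
      using t by (simp add: field_simps power2_eq_square)
    finally show ?thesis using Cauchy_Schwarz_ineq2[of "f x" "g x"] by linarith
  qed
  have "2 * \<bar>\<integral>x. f x \<bullet> g x \<partial>M\<bar> \<le> 2 * (\<integral>x. \<bar>f x \<bullet> g x\<bar> \<partial>M)" by simp
  also have "\<dots> = (\<integral>x. 2 * \<bar>f x \<bullet> g x\<bar> \<partial>M)" by simp
  also have "\<dots> \<le> (\<integral>x. t * (norm (f x))\<^sup>2 + (norm (g x))\<^sup>2 / t \<partial>M)"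
    using assms square_integrable_inner[OF assms] pw
    by (intro integral_mono) (auto simp: square_integrable_def)
  also have "\<dots> = t * (\<integral>x. (norm (f x))\<^sup>2 \<partial>M) + (\<integral>x. (norm (g x))\<^sup>2 \<partial>M) / t"
    using assms by (simp add: square_integrable_def)
  finally show "2 * \<bar>\<integral>x. f x \<bullet> g x \<partial>M\<bar> \<le> \<dots>" .
qed auto

lemma square_integrable_inner_tendsto:
  assumes "\<And>n. square_integrable M (f n)" "square_integrable M g" "square_integrable M w"
    and "(\<lambda>n. \<integral>x. (norm (f n x - g x))\<^sup>2 \<partial>M) \<longlonglongrightarrow> 0"
  shows "(\<lambda>n. \<integral>x. f n x \<bullet> w x \<partial>M) \<longlonglongrightarrow> (\<integral>x. g x \<bullet> w x \<partial>M)"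
proof (rule Lim_null[THEN iffD2])
  have le: "((\<integral>x. f n x \<bullet> w x \<partial>M) - (\<integral>x. g x \<bullet> w x \<partial>M))\<^sup>2
      \<le> (\<integral>x. (norm (f n x - g x))\<^sup>2 \<partial>M) * (\<integral>x. (norm (w x))\<^sup>2 \<partial>M)" for n
    using square_integrable_Cauchy_Schwarz[OF square_integrable_diff[OF assms(1)[of n] assms(2)] assms(3)]
      square_integrable_inner[OF assms(1)[of n] assms(3)] square_integrable_inner[OF assms(2,3)]
    by (simp add: inner_diff_left)
  have "(\<lambda>n. ((\<integral>x. f n x \<bullet> w x \<partial>M) - (\<integral>x. g x \<bullet> w x \<partial>M))\<^sup>2) \<longlonglongrightarrow> 0"
    by (rule tendsto_sandwich[OF _ _ tendsto_const
          tendsto_mult_left_zero[OF assms(4), of "\<integral>x. (norm (w x))\<^sup>2 \<partial>M"]])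
       (use le in auto)
  then have "(\<lambda>n. \<bar>(\<integral>x. f n x \<bullet> w x \<partial>M) - (\<integral>x. g x \<bullet> w x \<partial>M)\<bar>) \<longlonglongrightarrow> 0"
    using tendsto_real_sqrt by fastforce
  then show "(\<lambda>n. (\<integral>x. f n x \<bullet> w x \<partial>M) - (\<integral>x. g x \<bullet> w x \<partial>M)) \<longlonglongrightarrow> 0"
    by (rule tendsto_rabs_zero_cancel)
qed

text \<open>Fatou's lemma with convergent upper bounds. It is used twice: to pass from approximating
  test functions to \<open>u\<close>, and to let the regularisation parameter tend to zero.\<close>

lemma nn_integral_le_limit:
  fixes f :: "nat \<Rightarrow> 'a \<Rightarrow> real"
  assumes "\<And>n. f n \<in> borel_measurable M"
    and "AE x in M. (\<lambda>n. f n x) \<longlonglongrightarrow> g x"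
    and "R \<longlonglongrightarrow> r"
    and "\<And>n. (\<integral>\<^sup>+x. ennreal (f n x) \<partial>M) \<le> ennreal (R n)"
  shows "(\<integral>\<^sup>+x. ennreal (g x) \<partial>M) \<le> ennreal r"
proof -
  have "(\<integral>\<^sup>+x. ennreal (g x) \<partial>M) = (\<integral>\<^sup>+x. liminf (\<lambda>n. ennreal (f n x)) \<partial>M)"
    using assms(2)
    by (intro nn_integral_cong_AE) (auto elim!: eventually_mono
        intro!: lim_imp_Liminf[symmetric])
  also have "\<dots> \<le> liminf (\<lambda>n. \<integral>\<^sup>+x. ennreal (f n x) \<partial>M)"
    using assms(1) by (intro nn_integral_liminf) auto
  also have "\<dots> \<le> liminf (\<lambda>n. ennreal (R n))"
    using assms(4) by (intro Liminf_mono) auto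
  also have "\<dots> = ennreal r"
    using assms(3) by (intro lim_imp_Liminf) auto
  finally show ?thesis .
qed

section \<open>The integral of a partial derivative of a test function vanishes\<close>

lemma test_functions_lipschitz:
  assumes "\<phi> \<in> test_functions U"
  obtains B where "B > 0" "\<And>x y. \<bar>\<phi> x - \<phi> y\<bar> \<le> B * norm (x - y)"
proof -
  obtain B where B: "B > 0" "\<And>x. norm (grad \<phi> x) \<le> B"
    using test_functions_grad_bounded[OF assms] by blast
  have "norm (\<phi> x - \<phi> y) \<le> B * norm (x - y)" for x y
  proof (rule differentiable_bound[of UNIV])
    fix z
    show "(\<phi> has_derivative (\<lambda>h. grad \<phi> z \<bullet> h)) (at z within UNIV)"
      using smooth_has_derivative[OF test_functions_smooth[OF assms]] by simp
    show "onorm (\<lambda>h. grad \<phi> z \<bullet> h) \<le> B"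
    proof (rule onorm_bound)
      show "norm (grad \<phi> z \<bullet> h) \<le> B * norm h" for h
        using Cauchy_Schwarz_ineq2[of "grad \<phi> z" h] mult_right_mono[OF B(2)[of z] norm_ge_zero[of h]]
        by simp
    qed (use B in simp)
  qed auto
  then show ?thesis using that B by auto
qed

lemma integral_lebesgue_on_eq_lborel:
  fixes f :: "'a::euclidean_space \<Rightarrow> real"
  assumes "U \<in> sets lebesgue" "f \<in> borel_measurable borel" "\<And>x. x \<notin> U \<Longrightarrow> f x = 0"
  shows "(\<integral>x. f x \<partial>lebesgue_on U) = (\<integral>x. f x \<partial>lborel)"
proof -
  have "(\<integral>x. f x \<partial>lebesgue_on U) = (\<integral>x. indicator U x *\<^sub>R f x \<partial>lebesgue)"
    using assms by (intro integral_restrict_space) auto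
  also have "(\<lambda>x. indicator U x *\<^sub>R f x) = f"
    using assms(3) by (intro ext) (auto simp: indicator_def)
  also have "(\<integral>x. f x \<partial>lebesgue) = (\<integral>x. f x \<partial>lborel)"
    using assms(2) by (intro integral_completion) auto
  finally show ?thesis .
qed

lemma integrable_indicator_cball:
  "integrable lborel (\<lambda>x. indicator (cball (a::'a::euclidean_space) r) x * B :: real)"
  using emeasure_bounded_finite[OF bounded_cball, of a r]
  by (intro integrable_mult_left integrable_real_indicator) auto

text \<open>Every difference quotient integrates to zero by translation invariance of Lebesgue
  measure. The Lipschitz bound dominates the quotients, so the limit can be taken under the
  integral; no iterated one-dimensional integration is involved.\<close>

lemma integral_grad_test_function:
  fixes h :: "real^'n \<Rightarrow> real"
  assumes h: "h \<in> test_functions U" and U: "open U" "bounded U"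
  shows "(\<integral>x. grad h x $ i \<partial>lebesgue_on U) = 0"
proof -
  have sm: "smooth h" using h test_functions_smooth by blast
  obtain B where B: "B > 0" "\<And>x y. \<bar>h x - h y\<bar> \<le> B * norm (x - y)"
    using test_functions_lipschitz[OF h] by blast
  obtain R where R: "\<And>x. x \<in> U \<Longrightarrow> norm x \<le> R"
    using U(2) unfolding bounded_iff by blast
  have hm: "h \<in> borel_measurable borel"
    using smooth_continuous[OF sm] by (rule borel_measurable_continuous_onI)
  define e where "e n = (1 / real (Suc n)) *\<^sub>R (axis i 1 :: real^'n)" for n
  have ne: "norm (e n) = 1 / real (Suc n)" for n by (simp add: e_def norm_axis_1)
  define D where "D n x = (h (e n + x) - h x) * real (Suc n)" for n x
  have "((\<lambda>n. \<integral>x. D n x \<partial>lborel) \<longlongrightarrow> (\<integral>x. grad h x $ i \<partial>lborel)) sequentially"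
  proof (rule integral_dominated_convergence)
    show "(\<lambda>x. grad h x $ i) \<in> borel_measurable lborel"
      using smooth_continuous[OF smooth_grad[OF sm]]
      by (simp add: borel_measurable_continuous_onI)
    show "D n \<in> borel_measurable lborel" for n
      unfolding D_def using hm by measurable
    \<comment> \<open>The increments \<open>e n\<close> have length at most 1, so outside the ball
      of radius R + 1 both points of the difference quotient lie off \<open>U\<close>.\<close>
    show "integrable lborel (\<lambda>x. indicator (cball 0 (R + 1)) x * B :: real)"
      by (rule integrable_indicator_cball)
    show "AE x in lborel. (\<lambda>n. D n x) \<longlonglongrightarrow> grad h x $ i"
    proof (rule AE_I2)
      fix x
      have "((\<lambda>t. h (x + t *\<^sub>R axis i 1)) has_real_derivative grad h x $ i) (at 0)"
      proof -
        have "((\<lambda>t::real. x + t *\<^sub>R axis i 1) has_derivative (\<lambda>t. t *\<^sub>R axis i 1)) (at 0)"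
          by (auto intro!: derivative_eq_intros)
        moreover have "(h has_derivative (\<lambda>v. grad h x \<bullet> v)) (at (x + 0 *\<^sub>R axis i 1))"
          using smooth_has_derivative[OF sm] by simp
        ultimately have "((\<lambda>t. h (x + t *\<^sub>R axis i 1)) has_derivative
            (\<lambda>t. grad h x \<bullet> (t *\<^sub>R axis i 1))) (at 0)"
          by (rule has_derivative_compose)
        then show ?thesis
          by (simp add: has_field_derivative_def inner_axis mult.commute[of _ "grad h x $ i"])
      qed
      then have "((\<lambda>t. (h (x + t *\<^sub>R axis i 1) - h x) / t) \<longlongrightarrow> grad h x $ i) (at 0)"
        by (simp add: has_field_derivative_iff)
      moreover have "filterlim (\<lambda>n. 1 / real (Suc n)) (at 0) sequentially"
        unfolding filterlim_at using LIMSEQ_inverse_real_of_nat by (auto simp: inverse_eq_divide)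
      ultimately have "(\<lambda>n. (h (x + (1 / real (Suc n)) *\<^sub>R axis i 1) - h x) / (1 / real (Suc n)))
          \<longlonglongrightarrow> grad h x $ i"
        by (rule filterlim_compose)
      then show "(\<lambda>n. D n x) \<longlonglongrightarrow> grad h x $ i"
        by (simp add: D_def e_def add.commute)
    qed
    show "AE x in lborel. norm (D n x) \<le> indicator (cball 0 (R + 1)) x * B" for n
    proof (rule AE_I2)
      fix x
      show "norm (D n x) \<le> indicator (cball 0 (R + 1)) x * B"
      proof (cases "x \<in> cball 0 (R + 1)")
        case True
        have "\<bar>h (e n + x) - h x\<bar> \<le> B / real (Suc n)" using B(2)[of "e n + x" x] by (simp add: ne)
        then have "\<bar>h (e n + x) - h x\<bar> * real (Suc n) \<le> B" by (simp add: field_simps)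
        then show ?thesis using True by (simp add: D_def abs_mult)
      next
        case False
        then have n: "norm x > R + 1" by simp
        have "norm (e n) \<le> 1" by (simp add: ne)
        then have "norm (e n + x) > R" using n norm_triangle_ineq2[of x "- e n"] by (simp add: add.commute)
        then have "x \<notin> U" "e n + x \<notin> U" using R n by fastforce+
        then show ?thesis using False test_functions_outside(1)[OF h] by (simp add: D_def)
      qed
    qed
  qed
  moreover have "(\<integral>x. D n x \<partial>lborel) = 0" for n
  proof -
    obtain C where C: "\<And>x. \<bar>h x\<bar> \<le> C" using test_functions_bounded[OF h] by blast
    have ih: "integrable lborel h"
    proof (rule Bochner_Integration.integrable_bound)
      show "integrable lborel (\<lambda>x. indicator (cball 0 R) x * C :: real)"
        by (rule integrable_indicator_cball)
      show "h \<in> borel_measurable lborel" using hm by simp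
      have "norm (h x) \<le> norm (indicator (cball 0 R) x * C)" for x
        using C[of x] R[of x] test_functions_outside(1)[OF h, of x] by (cases "x \<in> U") auto
      then show "AE x in lborel. norm (h x) \<le> norm (indicator (cball 0 R) x * C)" by simp
    qed
    have sh: "has_bochner_integral lborel (\<lambda>x. h (e n + x)) (\<integral>x. h x \<partial>lborel)"
    proof -
      have "has_bochner_integral (distr lborel borel ((+) (e n))) h (\<integral>x. h x \<partial>lborel)"
        using has_bochner_integral_integrable[OF ih] by (simp only: lborel_distr_plus)
      then show ?thesis
        using hm by (simp add: has_bochner_integral_iff integrable_distr_eq integral_distr)
    qed
    have "(\<integral>x. D n x \<partial>lborel) = (\<integral>x. h (e n + x) - h x \<partial>lborel) * real (Suc n)"
      by (simp add: D_def)
    also have "\<dots> = 0"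
      using sh ih by (subst Bochner_Integration.integral_diff) (auto simp: has_bochner_integral_iff)
    finally show ?thesis .
  qed
  ultimately have "(\<integral>x. grad h x $ i \<partial>lborel) = 0"
    by (simp add: LIMSEQ_const_iff)
  moreover have "(\<integral>x. grad h x $ i \<partial>lebesgue_on U) = (\<integral>x. grad h x $ i \<partial>lborel)"
    using U(1) smooth_continuous[OF smooth_grad[OF sm]] test_functions_outside(2)[OF h]
    by (intro integral_lebesgue_on_eq_lborel) (auto intro: borel_measurable_continuous_onI)
  ultimately show ?thesis by simp
qed

section \<open>Approximation of weak solutions\<close>

locale bounded_open_set =
  fixes U :: "(real^'n) set"
  assumes open_U: "open U" and bounded_U: "bounded U"
begin

abbreviation M :: "(real^'n) measure" where "M \<equiv> lebesgue_on U"

lemma sets_U: "U \<in> sets lebesgue"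
  using open_U by simp

lemma finite_measure_M: "finite_measure M"
  using open_U bounded_U by (intro finite_measure_lebesgue_on lmeasurable_open)

lemma measurable_continuous: "continuous_on UNIV f \<Longrightarrow> f \<in> borel_measurable M"
  using sets_U continuous_on_subset
  by (blast intro: continuous_imp_measurable_on_sets_lebesgue)

lemma integrable_bounded_continuous:
  fixes f :: "real^'n \<Rightarrow> real"
  assumes "continuous_on UNIV f" "\<And>x. \<bar>f x\<bar> \<le> B"
  shows "integrable M f"
  using assms measurable_continuous
  by (intro finite_measure.integrable_const_bound[OF finite_measure_M, of _ B]) auto

lemma square_integrable_bounded_continuous:
  fixes f :: "real^'n \<Rightarrow> 'b::euclidean_space"
  assumes "continuous_on UNIV f" "\<And>x. norm (f x) \<le> B"
  shows "square_integrable M f"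
proof -
  have "\<bar>(norm (f x))\<^sup>2\<bar> \<le> B\<^sup>2" for x
    using power_mono[OF assms(2)[of x] norm_ge_zero, of 2] by simp
  then have "integrable M (\<lambda>x. (norm (f x))\<^sup>2)"
    using assms(1) by (intro integrable_bounded_continuous continuous_intros)
  then show ?thesis
    using measurable_continuous[OF assms(1)] by (simp add: square_integrable_def)
qed

lemma square_integrable_test:
  assumes "\<phi> \<in> test_functions U"
  shows "square_integrable M \<phi>"
proof -
  obtain B where "\<And>x. \<bar>\<phi> x\<bar> \<le> B" using test_functions_bounded[OF assms] by blast
  then show ?thesis
    using smooth_continuous[OF test_functions_smooth[OF assms]]
    by (intro square_integrable_bounded_continuous[of _ B]) auto
qed

lemma square_integrable_grad_test:
  assumes "\<phi> \<in> test_functions U"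
  shows "square_integrable M (grad \<phi>)"
proof -
  obtain B where "\<And>x. norm (grad \<phi> x) \<le> B" using test_functions_grad_bounded[OF assms] by blast
  then show ?thesis
    using smooth_continuous_grad[OF test_functions_smooth[OF assms]]
    by (intro square_integrable_bounded_continuous[of _ B]) auto
qed

lemma Lp_space_integrable:
  assumes "f \<in> Lp_space p U"
  shows "integrable M (\<lambda>x. norm (f x) powr p)"
proof -
  have "(\<integral>\<^sup>+x. ennreal (norm (f x) powr p) \<partial>M) < \<infinity>"
    using assms by (auto simp: Lp_space_def Lp_norm_def Let_def top.not_eq_extremum split: if_splits)
  then show ?thesis using assms
    by (intro integrableI_bounded) (auto simp: Lp_space_def)
qed

lemma Lp_space_2:
  fixes f :: "real^'n \<Rightarrow> 'b::euclidean_space"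
  assumes "f \<in> Lp_space 2 U"
  shows "square_integrable M f"
  using Lp_space_integrable[OF assms] assms
  by (simp add: square_integrable_def Lp_space_def)

lemma Lp_norm_le_integral:
  assumes "Lp_norm p U f \<le> ennreal c" "f \<in> Lp_space p U" "p > 0" "c \<ge> 0"
  shows "(\<integral>x. norm (f x) powr p \<partial>M) \<le> c powr p"
  using assms(1) nn_integral_eq_integral[OF Lp_space_integrable[OF assms(2)]] assms(3,4)
  by (subst (asm) Lp_norm_le_iff) auto

lemma square_integrable_norm_less:
  fixes f :: "real^'n \<Rightarrow> 'b::euclidean_space"
  assumes "Lp_norm 2 U f < ennreal (sqrt e)" "square_integrable M f" "e > 0"
  shows "(\<integral>x. (norm (f x))\<^sup>2 \<partial>M) \<le> e"
proof -
  have "(\<integral>\<^sup>+x. ennreal (norm (f x) powr 2) \<partial>M) \<le> ennreal (sqrt e powr 2)"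
    using assms(1,3) Lp_norm_le_iff[of 2 "sqrt e" U f] by (simp add: less_imp_le)
  then have "(\<integral>\<^sup>+x. ennreal ((norm (f x))\<^sup>2) \<partial>M) \<le> ennreal e"
    using assms(3) by simp
  then show ?thesis
    using assms(2,3) by (subst (asm) nn_integral_eq_integral) (auto simp: square_integrable_def)
qed

lemma integration_by_parts:
  assumes "\<phi> \<in> test_functions U" "\<psi> \<in> test_functions U"
  shows "(\<integral>x. \<phi> x * grad \<psi> x $ i \<partial>M) = - (\<integral>x. grad \<phi> x $ i * \<psi> x \<partial>M)"
proof -
  have sm: "smooth \<phi>" "smooth \<psi>" using assms test_functions_smooth by auto
  have "(\<lambda>x. \<phi> x * \<psi> x) \<in> test_functions U"
    using sm by (intro test_functionsI[OF assms(1)]) auto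
  then have "(\<integral>x. grad (\<lambda>x. \<phi> x * \<psi> x) x $ i \<partial>M) = 0"
    using open_U bounded_U by (rule integral_grad_test_function)
  moreover have "grad (\<lambda>x. \<phi> x * \<psi> x) x $ i = \<phi> x * grad \<psi> x $ i + grad \<phi> x $ i * \<psi> x" for x
    using sm by (subst grad_mult) (auto simp: smooth_differentiable)
  moreover have "integrable M (\<lambda>x. \<phi> x * grad \<psi> x $ i)" "integrable M (\<lambda>x. grad \<phi> x $ i * \<psi> x)"
    using square_integrable_inner[OF square_integrable_test square_integrable_test]
      assms test_functions_grad by fastforce+
  ultimately show ?thesis by simp
qed

text \<open>The sequence behind membership in \<open>W012\<close>, with extended norms turned into
  Bochner integrals of squares. The gradients are only required to be Cauchy; their limit is never
  named.\<close>

definition approximates :: "(nat \<Rightarrow> real^'n \<Rightarrow> real) \<Rightarrow> (real^'n \<Rightarrow> real) \<Rightarrow> bool" where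
  "approximates \<phi> u \<longleftrightarrow> (\<forall>n. \<phi> n \<in> test_functions U) \<and> square_integrable M u \<and>
     (\<lambda>n. \<integral>x. (norm (\<phi> n x - u x))\<^sup>2 \<partial>M) \<longlonglongrightarrow> 0 \<and>
     (\<forall>e>0. \<exists>N. \<forall>m\<ge>N. \<forall>n\<ge>N. (\<integral>x. (norm (grad (\<phi> m) x - grad (\<phi> n) x))\<^sup>2 \<partial>M) \<le> e)"

lemma approximates_Cauchy:
  assumes "approximates \<phi> u" "e > 0"
  shows "\<exists>N. \<forall>m\<ge>N. \<forall>n\<ge>N. (\<integral>x. (norm (grad (\<phi> m) x - grad (\<phi> n) x))\<^sup>2 \<partial>M) \<le> e"
  using assms by (simp add: approximates_def)

lemma W012_approximates:
  assumes "u \<in> W012 U"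
  obtains \<phi> where "approximates \<phi> u"
proof -
  from assms obtain \<phi> where u: "u \<in> Lp_space 2 U" and \<phi>: "\<And>n. \<phi> n \<in> test_functions U"
    and cau: "\<And>e. e > 0 \<Longrightarrow>
      \<exists>N. \<forall>m\<ge>N. \<forall>n\<ge>N. Lp_norm 2 U (grad (\<lambda>x. \<phi> m x - \<phi> n x)) < ennreal e"
    and lim: "(\<lambda>n. Lp_norm 2 U (\<lambda>x. \<phi> n x - u x)) \<longlonglongrightarrow> 0"
    unfolding W012_def by auto
  have u2: "square_integrable M u" using u by (rule Lp_space_2)
  have gd: "grad (\<lambda>x. \<phi> m x - \<phi> n x) = (\<lambda>x. grad (\<phi> m) x - grad (\<phi> n) x)" for m n
    using \<phi> by (intro ext grad_diff smooth_differentiable test_functions_smooth)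
  have "\<exists>N. \<forall>m\<ge>N. \<forall>n\<ge>N. (\<integral>x. (norm (grad (\<phi> m) x - grad (\<phi> n) x))\<^sup>2 \<partial>M) \<le> e"
    if e: "e > 0" for e
  proof -
    obtain N where "\<forall>m\<ge>N. \<forall>n\<ge>N. Lp_norm 2 U (grad (\<lambda>x. \<phi> m x - \<phi> n x)) < ennreal (sqrt e)"
      using cau[of "sqrt e"] e by auto
    then show ?thesis
      unfolding gd using e \<phi>
      by (intro exI[of _ N] allI impI square_integrable_norm_less square_integrable_diff
          square_integrable_grad_test) auto
  qed
  moreover have "(\<lambda>n. \<integral>x. (norm (\<phi> n x - u x))\<^sup>2 \<partial>M) \<longlonglongrightarrow> 0"
  proof (rule order_tendstoI)
    fix a :: real assume "0 < a"
    then have "\<forall>\<^sub>F n in sequentially. Lp_norm 2 U (\<lambda>x. \<phi> n x - u x) < ennreal (sqrt (a / 2))"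
      by (intro order_tendstoD(2)[OF lim]) simp
    then show "\<forall>\<^sub>F n in sequentially. (\<integral>x. (norm (\<phi> n x - u x))\<^sup>2 \<partial>M) < a"
    proof eventually_elim
      case (elim n)
      have "(\<integral>x. (norm (\<phi> n x - u x))\<^sup>2 \<partial>M) \<le> a / 2"
        using elim \<open>0 < a\<close>
        by (intro square_integrable_norm_less square_integrable_diff square_integrable_test \<phi> u2) auto
      then show ?case using \<open>0 < a\<close> by simp
    qed
  next
    fix a :: real assume "a < 0"
    then have "a < (\<integral>x. (norm (\<phi> n x - u x))\<^sup>2 \<partial>M)" for n
      by (rule less_le_trans) simp
    then show "\<forall>\<^sub>F n in sequentially. a < (\<integral>x. (norm (\<phi> n x - u x))\<^sup>2 \<partial>M)" by simp
  qed
  ultimately show ?thesis using that[of \<phi>] \<phi> u2 by (simp add: approximates_def)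
qed

text \<open>No convergence of \<open>grad (\<phi> n)\<close> to the weak gradient \<open>g\<close> is needed: both pairings with
  \<open>grad \<psi>\<close> equal minus the pairing of the function itself with the Laplacian of \<open>\<psi>\<close>.\<close>

lemma weak_gradient_limit:
  assumes ap: "approximates \<phi> u" and wg: "L2_weak_gradient U u g" and \<psi>: "\<psi> \<in> test_functions U"
  shows "(\<lambda>n. \<integral>x. grad (\<phi> n) x \<bullet> grad \<psi> x \<partial>M) \<longlonglongrightarrow> (\<integral>x. g x \<bullet> grad \<psi> x \<partial>M)"
proof -
  define L where "L i x = grad (\<lambda>x. grad \<psi> x $ i) x $ i" for i x
  have t1: "(\<lambda>x. grad \<psi> x $ i) \<in> test_functions U" for i using \<psi> by (rule test_functions_grad)
  have t2: "L i \<in> test_functions U" for i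
    using test_functions_grad[OF t1[of i], of i] by (simp add: L_def[abs_def])
  have \<phi>: "\<phi> n \<in> test_functions U" for n using ap by (simp add: approximates_def)
  have u2: "square_integrable M u" using ap by (simp add: approximates_def)
  have g2: "square_integrable M g"
    using wg by (intro Lp_space_2) (simp add: L2_weak_gradient_def)
  have 1: "(\<integral>x. grad (\<phi> n) x \<bullet> grad \<psi> x \<partial>M) = - (\<Sum>i\<in>UNIV. \<integral>x. \<phi> n x \<bullet> L i x \<partial>M)" for n
  proof -
    have "(\<integral>x. grad (\<phi> n) x \<bullet> grad \<psi> x \<partial>M) = (\<integral>x. (\<Sum>i\<in>UNIV. grad (\<phi> n) x $ i * grad \<psi> x $ i) \<partial>M)"
      by (simp add: inner_vec_def)
    also have "\<dots> = (\<Sum>i\<in>UNIV. \<integral>x. grad (\<phi> n) x $ i * grad \<psi> x $ i \<partial>M)"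
      using square_integrable_inner[OF square_integrable_test[OF test_functions_grad[OF \<phi>]]
          square_integrable_test[OF t1]]
      by (intro Bochner_Integration.integral_sum) simp
    also have "\<dots> = (\<Sum>i\<in>UNIV. - (\<integral>x. \<phi> n x * L i x \<partial>M))"
      using integration_by_parts[OF \<phi> t1] by (simp add: L_def)
    finally show ?thesis by (simp add: sum_negf)
  qed
  have gi: "square_integrable M (\<lambda>x. g x $ i)" for i
  proof -
    have "(\<lambda>x. g x \<bullet> axis i 1) \<in> borel_measurable M"
      using g2 by (auto simp: square_integrable_def)
    then have gm: "(\<lambda>x. g x $ i) \<in> borel_measurable M"
      by (simp add: inner_axis)
    moreover have "integrable M (\<lambda>x. (norm (g x $ i))\<^sup>2)"
    proof (rule Bochner_Integration.integrable_bound)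
      show "integrable M (\<lambda>x. (norm (g x))\<^sup>2)" using g2 by (simp add: square_integrable_def)
      have "norm ((norm (g x $ i))\<^sup>2) \<le> norm ((norm (g x))\<^sup>2)" for x
        using power_mono[OF component_le_norm_cart[of "g x" i], of 2] by simp
      then show "AE x in M. norm ((norm (g x $ i))\<^sup>2) \<le> norm ((norm (g x))\<^sup>2)" by simp
    qed (use gm in measurable)
    ultimately show ?thesis by (simp add: square_integrable_def)
  qed
  have 2: "(\<integral>x. g x \<bullet> grad \<psi> x \<partial>M) = - (\<Sum>i\<in>UNIV. \<integral>x. u x \<bullet> L i x \<partial>M)"
  proof -
    have "(\<integral>x. g x \<bullet> grad \<psi> x \<partial>M) = (\<integral>x. (\<Sum>i\<in>UNIV. g x $ i * grad \<psi> x $ i) \<partial>M)"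
      by (simp add: inner_vec_def)
    also have "\<dots> = (\<Sum>i\<in>UNIV. \<integral>x. g x $ i * grad \<psi> x $ i \<partial>M)"
      using square_integrable_inner[OF gi square_integrable_test[OF t1]]
      by (intro Bochner_Integration.integral_sum) auto
    also have "\<dots> = (\<Sum>i\<in>UNIV. - (\<integral>x. u x * L i x \<partial>M))"
    proof (rule sum.cong[OF refl])
      fix i
      have i1: "integrable M (\<lambda>x. u x *\<^sub>R grad (\<lambda>x. grad \<psi> x $ i) x)"
      proof (rule Bochner_Integration.integrable_bound)
        show "integrable M (\<lambda>x. norm (u x) \<bullet> norm (grad (\<lambda>x. grad \<psi> x $ i) x))"
          using u2 square_integrable_grad_test[OF t1[of i]]
          by (intro square_integrable_inner) (auto simp: square_integrable_def)
        show "(\<lambda>x. u x *\<^sub>R grad (\<lambda>x. grad \<psi> x $ i) x) \<in> borel_measurable M"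
          using u2 square_integrable_grad_test[OF t1[of i]] by (auto simp: square_integrable_def)
      qed simp
      have i2: "integrable M (\<lambda>x. grad \<psi> x $ i *\<^sub>R g x)"
      proof (rule Bochner_Integration.integrable_bound)
        show "integrable M (\<lambda>x. norm (grad \<psi> x $ i) \<bullet> norm (g x))"
          using g2 square_integrable_test[OF t1[of i]]
          by (intro square_integrable_inner) (auto simp: square_integrable_def)
        show "(\<lambda>x. grad \<psi> x $ i *\<^sub>R g x) \<in> borel_measurable M"
          using g2 square_integrable_test[OF t1[of i]] by (auto simp: square_integrable_def)
      qed simp
      have "(\<integral>x. u x *\<^sub>R grad (\<lambda>x. grad \<psi> x $ i) x \<partial>M) = - (\<integral>x. grad \<psi> x $ i *\<^sub>R g x \<partial>M)"
        using wg t1 by (simp add: L2_weak_gradient_def)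
      \<comment> \<open>The weak gradient is given by a vector identity. Testing it with the i-th
        partial derivative of \<open>\<psi>\<close> and reading off the i-th component gives the
        i-th term of the pairing with the Laplacian.\<close>
      then have "(\<integral>x. u x *\<^sub>R grad (\<lambda>x. grad \<psi> x $ i) x \<partial>M) $ i = - ((\<integral>x. grad \<psi> x $ i *\<^sub>R g x \<partial>M) $ i)"
        by simp
      then show "(\<integral>x. g x $ i * grad \<psi> x $ i \<partial>M) = - (\<integral>x. u x * L i x \<partial>M)"
        using integral_bounded_linear[OF bounded_linear_vec_nth[of i] i1]
          integral_bounded_linear[OF bounded_linear_vec_nth[of i] i2]
        by (simp add: L_def mult.commute)
    qed
    finally show ?thesis by (simp add: sum_negf)
  qed
  have "(\<lambda>n. \<integral>x. \<phi> n x \<bullet> L i x \<partial>M) \<longlonglongrightarrow> (\<integral>x. u x \<bullet> L i x \<partial>M)" for i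
    using ap square_integrable_test \<phi> t2
    by (intro square_integrable_inner_tendsto) (auto simp: approximates_def)
  then show ?thesis unfolding 1 2 by (intro tendsto_intros)
qed

text \<open>From some index on, all gradients are within distance 1 of that of a single
  \<open>\<phi> N\<close>. A bound on the tail suffices, as only limits are taken.\<close>

lemma approximates_energy_bound:
  assumes "approximates \<phi> u"
  obtains N B where "B > 0" "\<And>n. n \<ge> N \<Longrightarrow> (\<integral>x. (norm (grad (\<phi> n) x))\<^sup>2 \<partial>M) \<le> B"
proof -
  have \<phi>: "\<phi> n \<in> test_functions U" for n using assms by (simp add: approximates_def)
  obtain N where "\<forall>m\<ge>N. \<forall>n\<ge>N. (\<integral>x. (norm (grad (\<phi> m) x - grad (\<phi> n) x))\<^sup>2 \<partial>M) \<le> 1"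
    using approximates_Cauchy[OF assms zero_less_one] ..
  then have N: "(\<integral>x. (norm (grad (\<phi> m) x - grad (\<phi> n) x))\<^sup>2 \<partial>M) \<le> 1"
    if "m \<ge> N" "n \<ge> N" for m n using that by blast
  let ?B = "2 + 2 * (\<integral>x. (norm (grad (\<phi> N) x))\<^sup>2 \<partial>M)"
  have "(\<integral>x. (norm (grad (\<phi> n) x))\<^sup>2 \<partial>M) \<le> ?B" if "n \<ge> N" for n
  proof -
    have pw: "(norm (grad (\<phi> n) x))\<^sup>2
        \<le> 2 * (norm (grad (\<phi> n) x - grad (\<phi> N) x))\<^sup>2 + 2 * (norm (grad (\<phi> N) x))\<^sup>2" for x
    proof -
      have "norm (grad (\<phi> n) x) \<le> norm (grad (\<phi> n) x - grad (\<phi> N) x) + norm (grad (\<phi> N) x)"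
        using norm_triangle_ineq[of "grad (\<phi> n) x - grad (\<phi> N) x" "grad (\<phi> N) x"] by simp
      then have "(norm (grad (\<phi> n) x))\<^sup>2 \<le> (norm (grad (\<phi> n) x - grad (\<phi> N) x) + norm (grad (\<phi> N) x))\<^sup>2"
        by (rule power_mono) simp
      also have "\<dots> \<le> 2 * (norm (grad (\<phi> n) x - grad (\<phi> N) x))\<^sup>2 + 2 * (norm (grad (\<phi> N) x))\<^sup>2"
        using sum_squares_bound[of "norm (grad (\<phi> n) x - grad (\<phi> N) x)" "norm (grad (\<phi> N) x)"]
        by (simp add: power2_sum)
      finally show ?thesis .
    qed
    have "(\<integral>x. (norm (grad (\<phi> n) x))\<^sup>2 \<partial>M)
        \<le> (\<integral>x. 2 * (norm (grad (\<phi> n) x - grad (\<phi> N) x))\<^sup>2 + 2 * (norm (grad (\<phi> N) x))\<^sup>2 \<partial>M)"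
      using square_integrable_grad_test[OF \<phi>[of n]] square_integrable_grad_test[OF \<phi>[of N]]
        square_integrable_diff[OF square_integrable_grad_test[OF \<phi>[of n]] square_integrable_grad_test[OF \<phi>[of N]]] pw
      by (intro integral_mono) (auto simp: square_integrable_def)
    also have "\<dots> = 2 * (\<integral>x. (norm (grad (\<phi> n) x - grad (\<phi> N) x))\<^sup>2 \<partial>M) + 2 * (\<integral>x. (norm (grad (\<phi> N) x))\<^sup>2 \<partial>M)"
      using square_integrable_grad_test[OF \<phi>[of N]]
        square_integrable_diff[OF square_integrable_grad_test[OF \<phi>[of n]] square_integrable_grad_test[OF \<phi>[of N]]]
      by (subst Bochner_Integration.integral_add) (auto simp: square_integrable_def)
    also have "\<dots> \<le> ?B" using N[OF that order_refl] by simp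
    finally show ?thesis .
  qed
  moreover have "?B > 0" by (intro add_pos_nonneg) auto
  ultimately show ?thesis using that by blast
qed

text \<open>In the energy argument the test function is built from \<open>\<phi> m\<close> itself,
  so it moves with m and convergence against a fixed test function is not enough. The Cauchy
  property together with the uniform bound on the gradients of \<open>\<psi> m\<close> makes the
  convergence uniform over these test functions.\<close>

lemma varying_test_function_limit:
  assumes ap: "approximates \<phi> u" and wg: "L2_weak_gradient U u g"
    and \<psi>: "\<And>m. \<psi> m \<in> test_functions U"
    and bd: "\<And>m. m \<ge> N \<Longrightarrow> (\<integral>x. (norm (grad (\<psi> m) x))\<^sup>2 \<partial>M) \<le> B" and B: "B > 0"
  shows "(\<lambda>m. (\<integral>x. grad (\<phi> m) x \<bullet> grad (\<psi> m) x \<partial>M) - (\<integral>x. g x \<bullet> grad (\<psi> m) x \<partial>M)) \<longlonglongrightarrow> 0"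
proof (rule LIMSEQ_I)
  fix e :: real assume e: "e > 0"
  have \<phi>: "\<phi> n \<in> test_functions U" for n using ap by (simp add: approximates_def)
  have "(e / 2)\<^sup>2 / B > 0" using e B by simp
  then obtain N' where "\<forall>m\<ge>N'. \<forall>n\<ge>N'.
      (\<integral>x. (norm (grad (\<phi> m) x - grad (\<phi> n) x))\<^sup>2 \<partial>M) \<le> (e / 2)\<^sup>2 / B"
    using approximates_Cauchy[OF ap] by blast
  then have N': "(\<integral>x. (norm (grad (\<phi> m) x - grad (\<phi> n) x))\<^sup>2 \<partial>M) \<le> (e / 2)\<^sup>2 / B"
    if "m \<ge> N'" "n \<ge> N'" for m n using that by blast
  show "\<exists>no. \<forall>m\<ge>no. norm ((\<integral>x. grad (\<phi> m) x \<bullet> grad (\<psi> m) x \<partial>M) - (\<integral>x. g x \<bullet> grad (\<psi> m) x \<partial>M) - 0) < e"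
  proof (intro exI allI impI)
    fix m assume m: "m \<ge> max N N'"
    have le: "\<bar>(\<integral>x. grad (\<phi> m) x \<bullet> grad (\<psi> m) x \<partial>M) - (\<integral>x. grad (\<phi> n) x \<bullet> grad (\<psi> m) x \<partial>M)\<bar> \<le> e / 2"
      if n: "n \<ge> N'" for n
    proof -
      let ?I = "(\<integral>x. grad (\<phi> m) x \<bullet> grad (\<psi> m) x \<partial>M) - (\<integral>x. grad (\<phi> n) x \<bullet> grad (\<psi> m) x \<partial>M)"
      have "?I\<^sup>2 \<le> (\<integral>x. (norm (grad (\<phi> m) x - grad (\<phi> n) x))\<^sup>2 \<partial>M) * (\<integral>x. (norm (grad (\<psi> m) x))\<^sup>2 \<partial>M)"
        using square_integrable_Cauchy_Schwarz[OF square_integrable_diff[OF square_integrable_grad_test[OF \<phi>[of m]]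
              square_integrable_grad_test[OF \<phi>[of n]]] square_integrable_grad_test[OF \<psi>[of m]]]
          square_integrable_inner[OF square_integrable_grad_test[OF \<phi>[of m]] square_integrable_grad_test[OF \<psi>[of m]]]
          square_integrable_inner[OF square_integrable_grad_test[OF \<phi>[of n]] square_integrable_grad_test[OF \<psi>[of m]]]
        by (simp add: inner_diff_left)
      also have "\<dots> \<le> (e / 2)\<^sup>2 / B * B"
        using N'[of m n] m n bd[of m] B by (intro mult_mono) auto
      also have "\<dots> = (e / 2)\<^sup>2" using B by simp
      finally show ?thesis using e abs_le_square_iff[of ?I "e / 2"] by simp
    qed
    \<comment> \<open>With m fixed and n tending to infinity the test function no longer moves, so
      \<open>weak_gradient_limit\<close> identifies the limit while the bound e / 2
      persists.\<close>
    have "(\<lambda>n. \<bar>(\<integral>x. grad (\<phi> m) x \<bullet> grad (\<psi> m) x \<partial>M) - (\<integral>x. grad (\<phi> n) x \<bullet> grad (\<psi> m) x \<partial>M)\<bar>)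
        \<longlonglongrightarrow> \<bar>(\<integral>x. grad (\<phi> m) x \<bullet> grad (\<psi> m) x \<partial>M) - (\<integral>x. g x \<bullet> grad (\<psi> m) x \<partial>M)\<bar>"
      using weak_gradient_limit[OF ap wg \<psi>[of m]] by (intro tendsto_intros)
    then have "\<bar>(\<integral>x. grad (\<phi> m) x \<bullet> grad (\<psi> m) x \<partial>M) - (\<integral>x. g x \<bullet> grad (\<psi> m) x \<partial>M)\<bar> \<le> e / 2"
      by (rule LIMSEQ_le_const2) (use le in blast)
    then show "norm ((\<integral>x. grad (\<phi> m) x \<bullet> grad (\<psi> m) x \<partial>M) - (\<integral>x. g x \<bullet> grad (\<psi> m) x \<partial>M) - 0) < e"
      using e by simp
  qed
qed

end

section \<open>Regularised powers\<close>

text \<open>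
  \<open>reg \<delta> s\<close> is a smooth function with values in $[\delta, \delta + 1/\delta]$ that tends to
  $s^2$ as $\delta \to 0$. Accordingly \<open>reg_power\<close> replaces $|s|^{p-2}s$ and \<open>reg_half\<close>
  replaces $|s|^{p/2}$; both vanish at zero, so that they map test functions to test functions.
\<close>

definition trunc :: "real \<Rightarrow> real \<Rightarrow> real" where
  "trunc \<delta> s = s * (1 + \<delta> * s\<^sup>2) powr (- 1 / 2)"

definition trunc_deriv :: "real \<Rightarrow> real \<Rightarrow> real" where
  "trunc_deriv \<delta> s = (1 + \<delta> * s\<^sup>2) powr (- 3 / 2)"

definition reg :: "real \<Rightarrow> real \<Rightarrow> real" where
  "reg \<delta> s = (trunc \<delta> s)\<^sup>2 + \<delta>"

definition reg_power :: "real \<Rightarrow> real \<Rightarrow> real \<Rightarrow> real" where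
  "reg_power p \<delta> s = trunc \<delta> s * reg \<delta> s powr (p / 2 - 1)"

text \<open>The product rule with the common power of \<open>reg\<close> factored out. The remaining
  bracket lies between \<open>min 1 (p - 1)\<close> and \<open>max 1 (p - 1)\<close> times
  \<open>reg \<delta> s\<close>, which is where all p-dependent bounds come from.\<close>

definition reg_power_deriv :: "real \<Rightarrow> real \<Rightarrow> real \<Rightarrow> real" where
  "reg_power_deriv p \<delta> s =
     trunc_deriv \<delta> s * (reg \<delta> s powr (p / 2 - 2) * (reg \<delta> s + (p - 2) * (trunc \<delta> s)\<^sup>2))"

definition reg_half :: "real \<Rightarrow> real \<Rightarrow> real \<Rightarrow> real" where
  "reg_half p \<delta> s = reg \<delta> s powr (p / 4) - \<delta> powr (p / 4)"

definition reg_half_deriv :: "real \<Rightarrow> real \<Rightarrow> real \<Rightarrow> real" where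
  "reg_half_deriv p \<delta> s = p / 2 * reg \<delta> s powr (p / 4 - 1) * trunc \<delta> s * trunc_deriv \<delta> s"

context
  fixes \<delta> :: real
  assumes \<delta>: "\<delta> > 0"
begin

lemma one_plus_pos: "1 + \<delta> * s\<^sup>2 > 0" for s :: real
  using \<delta> by (simp add: add_pos_nonneg)

lemma trunc_square: "(trunc \<delta> s)\<^sup>2 = s\<^sup>2 / (1 + \<delta> * s\<^sup>2)"
proof -
  have "((1 + \<delta> * s\<^sup>2) powr (- 1 / 2))\<^sup>2 = (1 + \<delta> * s\<^sup>2) powr (- 1)"
    using one_plus_pos[of s] by (simp add: power2_eq_square flip: powr_add)
  also have "\<dots> = 1 / (1 + \<delta> * s\<^sup>2)"
    using one_plus_pos[of s] by (simp add: powr_minus_divide)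
  finally show ?thesis by (simp add: trunc_def power_mult_distrib)
qed

lemma reg_pos: "reg \<delta> s > 0"
  using \<delta> by (simp add: reg_def add_nonneg_pos)

lemma reg_ge: "reg \<delta> s \<ge> \<delta>"
  by (simp add: reg_def)

lemma reg_le: "reg \<delta> s \<le> 1 / \<delta> + \<delta>"
proof -
  have "s\<^sup>2 / (1 + \<delta> * s\<^sup>2) \<le> 1 / \<delta>"
    using \<delta> one_plus_pos[of s] by (simp add: divide_simps)
  then show ?thesis by (simp add: reg_def trunc_square)
qed

lemma trunc_deriv_bounds: "trunc_deriv \<delta> s > 0" "trunc_deriv \<delta> s \<le> 1"
proof -
  show "trunc_deriv \<delta> s > 0" using one_plus_pos[of s] by (simp add: trunc_deriv_def)
  have "(1 + \<delta> * s\<^sup>2) powr (- 3 / 2) \<le> (1 + \<delta> * s\<^sup>2) powr 0"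
    using \<delta> by (intro powr_mono) auto
  then show "trunc_deriv \<delta> s \<le> 1" using one_plus_pos[of s] by (simp add: trunc_deriv_def)
qed

lemma trunc_has_derivative: "(trunc \<delta> has_real_derivative trunc_deriv \<delta> s) (at s)"
proof -
  let ?w = "1 + \<delta> * s\<^sup>2"
  have w: "?w powr (- 1 / 2) = ?w powr (- 3 / 2) * ?w"
    using one_plus_pos[of s] powr_add[of ?w "- 3 / 2" 1] by simp
  have "((\<lambda>s. s * (1 + \<delta> * s\<^sup>2) powr (- 1 / 2)) has_real_derivative
      1 * ?w powr (- 1 / 2) + s * ((- 1 / 2) * ?w powr (- 1 / 2 - 1) * (\<delta> * (2 * s)))) (at s)"
    using one_plus_pos[of s] by (auto intro!: derivative_eq_intros simp: divide_simps)
  moreover have "1 * ?w powr (- 1 / 2) + s * ((- 1 / 2) * ?w powr (- 1 / 2 - 1) * (\<delta> * (2 * s)))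
      = ?w powr (- 3 / 2)"
    unfolding w by (simp add: algebra_simps power2_eq_square)
  ultimately show ?thesis
    by (simp add: trunc_deriv_def trunc_def[abs_def])
qed

lemma reg_powr_has_derivative:
  "((\<lambda>s. reg \<delta> s powr a) has_real_derivative
    a * reg \<delta> s powr (a - 1) * (2 * trunc \<delta> s * trunc_deriv \<delta> s)) (at s)"
proof -
  have "(reg \<delta> has_real_derivative 2 * trunc \<delta> s * trunc_deriv \<delta> s) (at s)"
    unfolding reg_def[abs_def]
    by (auto intro!: derivative_eq_intros trunc_has_derivative)
  from DERIV_chain2[OF has_real_derivative_powr[OF reg_pos, of a] this]
  show ?thesis .
qed

lemma reg_half_has_derivative:
  "(reg_half p \<delta> has_real_derivative reg_half_deriv p \<delta> s) (at s)"
  unfolding reg_half_def[abs_def] reg_half_deriv_def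
  by (rule derivative_eq_intros reg_powr_has_derivative refl)+ simp

lemma reg_power_has_derivative:
  "(reg_power p \<delta> has_real_derivative reg_power_deriv p \<delta> s) (at s)"
proof -
  let ?r = "reg \<delta> s" and ?t = "trunc \<delta> s" and ?t' = "trunc_deriv \<delta> s"
  have r: "?r powr (p / 2 - 1) = ?r powr (p / 2 - 2) * ?r"
    using reg_pos[of s] powr_add[of ?r "p / 2 - 2" 1] by simp
  have "(reg_power p \<delta> has_real_derivative
      ?t' * ?r powr (p / 2 - 1) + (p / 2 - 1) * ?r powr (p / 2 - 1 - 1) * (2 * ?t * ?t') * ?t) (at s)"
    unfolding reg_power_def[abs_def]
    by (rule DERIV_mult trunc_has_derivative reg_powr_has_derivative)+
  also have "?t' * ?r powr (p / 2 - 1) + (p / 2 - 1) * ?r powr (p / 2 - 1 - 1) * (2 * ?t * ?t') * ?t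
      = reg_power_deriv p \<delta> s"
    unfolding r reg_power_deriv_def by (simp add: algebra_simps power2_eq_square)
  finally show ?thesis .
qed

text \<open>For p >= 2 the term with the factor p - 2 only helps. For p < 2 it is negative, and
  \<open>(trunc \<delta> s)\<^sup>2\<close> being at most \<open>reg \<delta> s\<close> leaves the
  fraction p - 1.\<close>

lemma reg_power_deriv_lower:
  assumes "p > 1"
  shows "min 1 (p - 1) * (trunc_deriv \<delta> s * (reg \<delta> s powr (p / 2 - 2) * reg \<delta> s)) \<le> reg_power_deriv p \<delta> s"
proof -
  have "min 1 (p - 1) * reg \<delta> s \<le> reg \<delta> s + (p - 2) * (trunc \<delta> s)\<^sup>2"
  proof (cases "p \<ge> 2")
    case True then show ?thesis by (simp add: min_def)
  next
    case False
    then have "(2 - p) * (trunc \<delta> s)\<^sup>2 \<le> (2 - p) * reg \<delta> s"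
      using \<delta> by (intro mult_left_mono) (auto simp: reg_def)
    then show ?thesis using False by (simp add: min_def algebra_simps)
  qed
  then have "trunc_deriv \<delta> s * (reg \<delta> s powr (p / 2 - 2) * (min 1 (p - 1) * reg \<delta> s)) \<le> reg_power_deriv p \<delta> s"
    unfolding reg_power_deriv_def
    using trunc_deriv_bounds[of s] by (intro mult_left_mono) auto
  then show ?thesis by (simp add: mult.left_commute)
qed

lemma reg_power_deriv_nonneg:
  assumes "p > 1" shows "reg_power_deriv p \<delta> s \<ge> 0"
proof -
  have "0 \<le> min 1 (p - 1) * (trunc_deriv \<delta> s * (reg \<delta> s powr (p / 2 - 2) * reg \<delta> s))"
    using assms reg_pos[of s] trunc_deriv_bounds[of s] by (intro mult_nonneg_nonneg) auto
  then show ?thesis using reg_power_deriv_lower[OF assms, of s] by linarith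
qed

lemma reg_power_deriv_upper:
  assumes "p > 1"
  shows "reg_power_deriv p \<delta> s \<le> max 1 (p - 1) * reg \<delta> s powr (p / 2 - 1)"
proof -
  have r: "reg \<delta> s powr (p / 2 - 1) = reg \<delta> s powr (p / 2 - 2) * reg \<delta> s"
    using reg_pos[of s] powr_add[of "reg \<delta> s" "p / 2 - 2" 1] by simp
  have "reg \<delta> s + (p - 2) * (trunc \<delta> s)\<^sup>2 \<le> max 1 (p - 1) * reg \<delta> s"
  proof (cases "p \<ge> 2")
    case False
    then have "(p - 2) * (trunc \<delta> s)\<^sup>2 \<le> 0" by (simp add: mult_nonpos_nonneg)
    then show ?thesis using False by (simp add: max_def)
  next
    case True
    then have "(p - 2) * (trunc \<delta> s)\<^sup>2 \<le> (p - 2) * reg \<delta> s"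
      using \<delta> by (intro mult_left_mono) (auto simp: reg_def)
    then show ?thesis using True by (auto simp: max_def algebra_simps)
  qed
  then have "reg \<delta> s powr (p / 2 - 2) * (reg \<delta> s + (p - 2) * (trunc \<delta> s)\<^sup>2)
      \<le> reg \<delta> s powr (p / 2 - 2) * (max 1 (p - 1) * reg \<delta> s)"
    by (intro mult_left_mono) auto
  also have "\<dots> = max 1 (p - 1) * reg \<delta> s powr (p / 2 - 1)" by (simp add: r mult.left_commute)
  finally have le: "reg \<delta> s powr (p / 2 - 2) * (reg \<delta> s + (p - 2) * (trunc \<delta> s)\<^sup>2)
      \<le> max 1 (p - 1) * reg \<delta> s powr (p / 2 - 1)" .
  have "reg_power_deriv p \<delta> s \<le> trunc_deriv \<delta> s * (max 1 (p - 1) * reg \<delta> s powr (p / 2 - 1))"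
    unfolding reg_power_deriv_def using le trunc_deriv_bounds[of s] by (intro mult_left_mono) auto
  also have "\<dots> \<le> 1 * (max 1 (p - 1) * reg \<delta> s powr (p / 2 - 1))"
    using trunc_deriv_bounds[of s] by (intro mult_right_mono) auto
  finally show ?thesis by simp
qed

text \<open>The power of \<open>reg\<close> is extremal at one end of its range, at which end
  depends on the sign of the exponent; the sum of both end values avoids the distinction.\<close>

lemma reg_powr_le: "reg \<delta> s powr a \<le> (1 / \<delta> + \<delta>) powr a + \<delta> powr a"
proof (cases "a \<ge> 0")
  case True
  then have "reg \<delta> s powr a \<le> (1 / \<delta> + \<delta>) powr a"
    using reg_pos[of s] reg_le[of s] by (intro powr_mono2) auto
  then show ?thesis using powr_ge_zero[of \<delta> a] by linarith
next
  case False
  then have "reg \<delta> s powr a \<le> \<delta> powr a"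
    using \<delta> reg_ge[of s] by (intro powr_mono2') auto
  then show ?thesis using powr_ge_zero[of "1 / \<delta> + \<delta>" a] by linarith
qed

lemma reg_power_deriv_bounded:
  assumes "p > 1" obtains B where "B > 0" "\<And>s. \<bar>reg_power_deriv p \<delta> s\<bar> \<le> B"
proof
  let ?B = "max 1 (p - 1) * ((1 / \<delta> + \<delta>) powr (p / 2 - 1) + \<delta> powr (p / 2 - 1))"
  show "?B > 0" using \<delta> by (intro mult_pos_pos add_nonneg_pos) auto
  have "reg_power_deriv p \<delta> s \<le> ?B" for s
    using reg_power_deriv_upper[OF assms, of s] reg_powr_le[of s "p / 2 - 1"]
      mult_left_mono[OF reg_powr_le[of s "p / 2 - 1"], of "max 1 (p - 1)"] by linarith
  then show "\<bar>reg_power_deriv p \<delta> s\<bar> \<le> ?B" for s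
    using reg_power_deriv_nonneg[OF assms, of s] by simp
qed

text \<open>The regularised form of the identity between the squared gradient of |u|^(p/2) and p^2/4
  |u|^(p-2) |grad u|^2. The inequality replaces the square of \<open>trunc\<close> by
  \<open>reg\<close>, uses that \<open>trunc_deriv\<close> is at most 1, and pays the coercivity
  factor; the resulting constant is the \<open>K\<close> of the energy estimates.\<close>

lemma reg_half_deriv_square:
  assumes "p > 1"
  shows "(reg_half_deriv p \<delta> s)\<^sup>2 \<le> p\<^sup>2 / 4 / min 1 (p - 1) * reg_power_deriv p \<delta> s"
proof -
  let ?r = "reg \<delta> s" and ?t = "trunc \<delta> s" and ?t' = "trunc_deriv \<delta> s"
  have m: "min 1 (p - 1) > 0" using assms by simp
  have "(?r powr (p / 4 - 1))\<^sup>2 = ?r powr (p / 2 - 2)"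
    using reg_pos[of s] by (simp add: power2_eq_square flip: powr_add)
  then have "(reg_half_deriv p \<delta> s)\<^sup>2 = p\<^sup>2 / 4 * (?r powr (p / 2 - 2) * ?t\<^sup>2 * ?t'\<^sup>2)"
    by (simp add: reg_half_deriv_def power_mult_distrib power_divide)
  also have "\<dots> \<le> p\<^sup>2 / 4 * (?r powr (p / 2 - 2) * ?r * ?t')"
  proof (intro mult_left_mono mult_mono)
    show "?t\<^sup>2 \<le> ?r" using \<delta> by (simp add: reg_def)
    show "?t'\<^sup>2 \<le> ?t'"
      using trunc_deriv_bounds[of s] by (simp add: power2_eq_square mult_left_le)
  qed (use reg_pos[of s] in auto)
  also have "\<dots> = p\<^sup>2 / 4 / min 1 (p - 1) * (min 1 (p - 1) * (?t' * (?r powr (p / 2 - 2) * ?r)))"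
    using m by (simp add: field_simps)
  also have "\<dots> \<le> p\<^sup>2 / 4 / min 1 (p - 1) * reg_power_deriv p \<delta> s"
    using m by (intro mult_left_mono reg_power_deriv_lower assms) auto
  finally show ?thesis .
qed

lemma trunc_abs_le: "\<bar>trunc \<delta> s\<bar> \<le> reg \<delta> s powr (1 / 2)"
proof -
  have "\<bar>trunc \<delta> s\<bar> = sqrt ((trunc \<delta> s)\<^sup>2)" by simp
  also have "\<dots> \<le> sqrt (reg \<delta> s)" using \<delta> by (intro real_sqrt_le_mono) (simp add: reg_def)
  also have "\<dots> = reg \<delta> s powr (1 / 2)" using reg_pos[of s] by (simp add: powr_half_sqrt)
  finally show ?thesis .
qed

lemma reg_power_abs_le: "\<bar>reg_power p \<delta> s\<bar> \<le> reg \<delta> s powr ((p - 1) / 2)"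
proof -
  have "\<bar>reg_power p \<delta> s\<bar> \<le> reg \<delta> s powr (1 / 2) * reg \<delta> s powr (p / 2 - 1)"
    unfolding reg_power_def abs_mult using trunc_abs_le[of s] by (simp add: mult_right_mono)
  also have "\<dots> = reg \<delta> s powr ((p - 1) / 2)"
    by (simp add: field_simps flip: powr_add)
  finally show ?thesis .
qed

text \<open>Undoes the subtraction that makes \<open>reg_half\<close> vanish at zero. The price is a
  constant that tends to zero with \<delta> and is integrated over a set of finite measure.\<close>

lemma reg_powr_le_reg_half: "reg \<delta> s powr (p / 2) \<le> 2 * (reg_half p \<delta> s)\<^sup>2 + 2 * \<delta> powr (p / 2)"
proof -
  have 1: "reg \<delta> s powr (p / 2) = (reg_half p \<delta> s + \<delta> powr (p / 4))\<^sup>2"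
    by (simp add: reg_half_def power2_eq_square flip: powr_add)
  have 2: "\<delta> powr (p / 2) = (\<delta> powr (p / 4))\<^sup>2"
    by (simp add: power2_eq_square flip: powr_add)
  show ?thesis unfolding 1 2
    using sum_squares_bound[of "reg_half p \<delta> s" "\<delta> powr (p / 4)"] by (simp add: power2_sum)
qed

lemma reg_power_test:
  assumes "\<phi> \<in> test_functions U"
  shows "(\<lambda>x. reg_power p \<delta> (\<phi> x)) \<in> test_functions U" "(\<lambda>x. reg_half p \<delta> (\<phi> x)) \<in> test_functions U"
proof -
  have sm: "smooth \<phi>" using assms test_functions_smooth by blast
  have t: "smooth (\<lambda>x. trunc \<delta> (\<phi> x))"
    unfolding trunc_def
    by (intro smooth_mult smooth_powr smooth_add smooth_power2 smooth_const sm one_plus_pos)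
  then have r: "smooth (\<lambda>x. reg \<delta> (\<phi> x))"
    unfolding reg_def by (intro smooth_add smooth_power2 smooth_const)
  show "(\<lambda>x. reg_power p \<delta> (\<phi> x)) \<in> test_functions U"
    using assms
  proof (rule test_functionsI)
    show "smooth (\<lambda>x. reg_power p \<delta> (\<phi> x))"
      unfolding reg_power_def by (intro smooth_mult smooth_powr t r reg_pos)
  qed (simp add: reg_power_def trunc_def)
  show "(\<lambda>x. reg_half p \<delta> (\<phi> x)) \<in> test_functions U"
    using assms
  proof (rule test_functionsI)
    show "smooth (\<lambda>x. reg_half p \<delta> (\<phi> x))"
      unfolding reg_half_def by (intro smooth_diff smooth_powr smooth_const r reg_pos)
  qed (simp add: reg_half_def reg_def trunc_def)
qed

end

lemma continuous_on_reg: "\<delta> > 0 \<Longrightarrow> continuous_on UNIV (\<lambda>s. reg \<delta> s powr a)"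
  using reg_powr_has_derivative DERIV_isCont by (blast intro: continuous_at_imp_continuous_on)

lemma reg_tendsto:
  assumes "p > 0"
  shows "(\<lambda>n. reg (1 / real (Suc n)) s powr (p / 2)) \<longlonglongrightarrow> \<bar>s\<bar> powr p"
proof -
  have z: "(\<lambda>n. 1 / real (Suc n)) \<longlonglongrightarrow> 0"
    using LIMSEQ_inverse_real_of_nat by (simp add: inverse_eq_divide)
  have "(\<lambda>n. s\<^sup>2 / (1 + 1 / real (Suc n) * s\<^sup>2) + 1 / real (Suc n)) \<longlonglongrightarrow> s\<^sup>2 / (1 + 0 * s\<^sup>2) + 0"
    by (intro tendsto_intros z) simp
  moreover have "reg (1 / real (Suc n)) s = s\<^sup>2 / (1 + 1 / real (Suc n) * s\<^sup>2) + 1 / real (Suc n)" for n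
    by (simp add: reg_def trunc_square)
  ultimately have l: "(\<lambda>n. reg (1 / real (Suc n)) s) \<longlonglongrightarrow> s\<^sup>2" by simp
  have "(\<lambda>n. reg (1 / real (Suc n)) s powr (p / 2)) \<longlonglongrightarrow> s\<^sup>2 powr (p / 2)"
    using assms reg_pos by (intro tendsto_powr' l tendsto_const) (auto intro!: always_eventually less_imp_le)
  also have "s\<^sup>2 powr (p / 2) = \<bar>s\<bar> powr p"
  proof (cases "s = 0")
    case False
    then have "s\<^sup>2 = \<bar>s\<bar> powr 2" by simp
    then show ?thesis using False by (simp only: powr_powr) simp
  qed simp
  finally show ?thesis .
qed

section \<open>Estimates from a Poincare inequality\<close>

text \<open>Here \<open>a\<close> stands for \<open>reg \<delta> s\<close>, so \<open>sqrt a\<close>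
  is comparable to |s|. Depending on whether b is below or above \<open>l * sqrt a\<close>, one of
  the two summands alone dominates; no conjugate exponents are needed. The case r = 2 handles div f,
  the case r = 1 handles F.\<close>

lemma powr_Young:
  fixes a b p r l :: real
  assumes "a > 0" "b \<ge> 0" "l > 0" "0 < r" "r \<le> p"
  shows "a powr ((p - r) / 2) * b powr r \<le> l powr r * a powr (p / 2) + l powr (r - p) * b powr p"
proof (cases "b \<le> l * sqrt a")
  case True
  then have "b powr r \<le> (l * sqrt a) powr r" using assms by (intro powr_mono2) auto
  also have "\<dots> = l powr r * a powr (r / 2)"
    using assms by (simp add: powr_mult powr_powr flip: powr_half_sqrt)
  finally have "a powr ((p - r) / 2) * b powr r \<le> a powr ((p - r) / 2) * (l powr r * a powr (r / 2))"
    by (intro mult_left_mono) auto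
  also have "\<dots> = l powr r * a powr (p / 2)"
    by (simp add: mult.left_commute diff_divide_distrib flip: powr_add)
  finally show ?thesis using powr_ge_zero[of l "r - p"] powr_ge_zero[of b p]
    by (smt (verit) mult_nonneg_nonneg)
next
  case False
  then have s: "sqrt a < b / l" using assms by (simp add: field_simps)
  then have b: "b > 0" using assms by (smt (verit) divide_nonneg_pos real_sqrt_gt_zero divide_eq_0_iff)
  have "a powr ((p - r) / 2) = sqrt a powr (p - r)"
    using assms by (simp add: powr_powr flip: powr_half_sqrt)
  also have "\<dots> \<le> (b / l) powr (p - r)"
    using s assms by (intro powr_mono2) auto
  also have "\<dots> = l powr (r - p) * b powr (p - r)"
    using assms b by (simp add: powr_divide powr_diff)
  finally have "a powr ((p - r) / 2) * b powr r \<le> l powr (r - p) * b powr (p - r) * b powr r"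
    by (intro mult_right_mono) auto
  also have "\<dots> = l powr (r - p) * b powr p"
    by (simp add: mult.assoc flip: powr_add)
  finally show ?thesis using powr_ge_zero[of l r] powr_ge_zero[of a "p / 2"]
    by (smt (verit) mult_nonneg_nonneg)
qed

context bounded_open_set
begin

text \<open>The hypothesis \<open>data\<close> is the common form of the right-hand sides div f and
  F after testing with \<open>reg_power\<close>: half of the energy, a small multiple
  \<open>l\<close> of the regularised p-th power, and an integrable remainder \<open>W\<close>.
  Energy and p-th power then bound each other, and the condition on \<open>l\<close> closes the
  loop.\<close>

lemma regularised_energy_estimate:
  assumes p: "p > 1" and S: "S > 0" and \<delta>: "\<delta> > 0"
    and poincare: "\<And>\<psi>. \<psi> \<in> test_functions U \<Longrightarrow>
      (\<integral>x. (\<psi> x)\<^sup>2 \<partial>M) \<le> S * (\<integral>x. (norm (grad \<psi> x))\<^sup>2 \<partial>M)"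
    and sol: "weak_solution U F f u"
    and F: "square_integrable M F" and f: "square_integrable M f"
    and W: "integrable M W"
    and K: "K = p\<^sup>2 / 4 / min 1 (p - 1)"
    and l: "4 * (S * K) * l \<le> 1 / 2"
    and data: "\<And>x s v. F x * reg_power p \<delta> s - (f x \<bullet> v) * reg_power_deriv p \<delta> s
      \<le> reg_power_deriv p \<delta> s * (norm v)\<^sup>2 / 2 + l * reg \<delta> s powr (p / 2) + W x"
  shows "(\<integral>\<^sup>+x. ennreal (reg \<delta> (u x) powr (p / 2)) \<partial>M)
    \<le> ennreal (8 * (S * K) * (\<integral>x. W x \<partial>M) + 4 * \<delta> powr (p / 2) * measure M (space M))"
proof -
  obtain g where wg: "L2_weak_gradient U u g"
    and eq: "\<And>\<psi>. \<psi> \<in> test_functions U \<Longrightarrow> (\<integral>x. g x \<bullet> grad \<psi> x \<partial>M) =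
      (\<integral>x. F x * \<psi> x \<partial>M) - (\<integral>x. f x \<bullet> grad \<psi> x \<partial>M)"
    using sol unfolding weak_solution_def by blast
  obtain \<phi> where ap: "approximates \<phi> u"
    using sol W012_approximates unfolding weak_solution_def by blast
  have \<phi>: "\<phi> n \<in> test_functions U" for n using ap by (simp add: approximates_def)
  have d\<phi>: "\<phi> n differentiable (at x)" for n x
    using smooth_differentiable[OF test_functions_smooth[OF \<phi>]] .
  have c\<phi>: "continuous_on UNIV (\<phi> n)" for n
    using smooth_continuous[OF test_functions_smooth[OF \<phi>]] .
  define \<psi> where "\<psi> m x = reg_power p \<delta> (\<phi> m x)" for m x
  define \<eta> where "\<eta> m x = reg_half p \<delta> (\<phi> m x)" for m x
  have \<psi>: "\<psi> m \<in> test_functions U" and \<eta>: "\<eta> m \<in> test_functions U" for m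
    using reg_power_test[OF \<delta> \<phi>[of m], of p] by (simp_all add: \<psi>_def[abs_def] \<eta>_def[abs_def])
  have g\<psi>: "grad (\<psi> m) x = reg_power_deriv p \<delta> (\<phi> m x) *\<^sub>R grad (\<phi> m) x" for m x
    using grad_compose[OF d\<phi> reg_power_has_derivative[OF \<delta>]] by (simp add: \<psi>_def[abs_def])
  have g\<eta>: "grad (\<eta> m) x = reg_half_deriv p \<delta> (\<phi> m x) *\<^sub>R grad (\<phi> m) x" for m x
    using grad_compose[OF d\<phi> reg_half_has_derivative[OF \<delta>]] by (simp add: \<eta>_def[abs_def])
  have K0: "K \<ge> 0" using p by (simp add: K)
  define \<kappa> where "\<kappa> = S * K"
  have \<kappa>: "\<kappa> \<ge> 0" using S K0 by (simp add: \<kappa>_def)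

  define X where "X m = (\<integral>x. reg_power_deriv p \<delta> (\<phi> m x) * (norm (grad (\<phi> m) x))\<^sup>2 \<partial>M)" for m
  define Q where "Q m = (\<integral>x. reg \<delta> (\<phi> m x) powr (p / 2) \<partial>M)" for m
  define r where "r m = (\<integral>x. grad (\<phi> m) x \<bullet> grad (\<psi> m) x \<partial>M) - (\<integral>x. g x \<bullet> grad (\<psi> m) x \<partial>M)" for m
  define D where "D = \<delta> powr (p / 2) * measure M (space M)"
  have Xint: "reg_power_deriv p \<delta> (\<phi> m x) * (norm (grad (\<phi> m) x))\<^sup>2 = grad (\<phi> m) x \<bullet> grad (\<psi> m) x" for m x
    by (simp add: g\<psi> power2_norm_eq_inner)
  have iX: "integrable M (\<lambda>x. reg_power_deriv p \<delta> (\<phi> m x) * (norm (grad (\<phi> m) x))\<^sup>2)" for m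
    unfolding Xint by (intro square_integrable_inner square_integrable_grad_test \<phi> \<psi>)
  have iQ: "integrable M (\<lambda>x. reg \<delta> (\<phi> m x) powr (p / 2))" for m
  proof (rule integrable_bounded_continuous)
    show "continuous_on UNIV (\<lambda>x. reg \<delta> (\<phi> m x) powr (p / 2))"
      by (rule continuous_on_compose2[OF continuous_on_reg[OF \<delta>] c\<phi>]) auto
    show "\<bar>reg \<delta> (\<phi> m x) powr (p / 2)\<bar> \<le> (1 / \<delta> + \<delta>) powr (p / 2) + \<delta> powr (p / 2)" for x
      using reg_powr_le[OF \<delta>, of "\<phi> m x" "p / 2"] by simp
  qed
  have Q0: "Q m \<ge> 0" for m by (simp add: Q_def)

  \<comment> \<open>Boundedness of \<open>reg_power_deriv\<close> transfers the L2 bound on the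
    gradients of \<open>\<phi> m\<close> to those of \<open>\<psi> m\<close>, as needed for moving
    test functions.\<close>
  have r0: "r \<longlonglongrightarrow> 0"
  proof -
    obtain N B where B: "B > 0" "\<And>n. n \<ge> N \<Longrightarrow> (\<integral>x. (norm (grad (\<phi> n) x))\<^sup>2 \<partial>M) \<le> B"
      using approximates_energy_bound[OF ap] by blast
    obtain C where C: "C > 0" "\<And>s. \<bar>reg_power_deriv p \<delta> s\<bar> \<le> C"
      using reg_power_deriv_bounded[OF \<delta> p] by blast
    have "(\<integral>x. (norm (grad (\<psi> m) x))\<^sup>2 \<partial>M) \<le> C\<^sup>2 * B" if "m \<ge> N" for m
    proof -
      have "(\<integral>x. (norm (grad (\<psi> m) x))\<^sup>2 \<partial>M) \<le> (\<integral>x. C\<^sup>2 * (norm (grad (\<phi> m) x))\<^sup>2 \<partial>M)"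
      proof (rule integral_mono)
        show "(norm (grad (\<psi> m) x))\<^sup>2 \<le> C\<^sup>2 * (norm (grad (\<phi> m) x))\<^sup>2" for x
          using power_mono[OF C(2)[of "\<phi> m x"] abs_ge_zero, of 2]
          by (simp add: g\<psi> power_mult_distrib mult_right_mono)
      qed (use square_integrable_grad_test[OF \<psi>[of m]] square_integrable_grad_test[OF \<phi>[of m]]
           in \<open>auto simp: square_integrable_def\<close>)
      also have "\<dots> = C\<^sup>2 * (\<integral>x. (norm (grad (\<phi> m) x))\<^sup>2 \<partial>M)" by simp
      also have "\<dots> \<le> C\<^sup>2 * B" using B(2)[OF that] by (intro mult_left_mono) auto
      finally show ?thesis .
    qed
    moreover have "C\<^sup>2 * B > 0" using B C by simp
    ultimately show ?thesis
      unfolding r_def by (intro varying_test_function_limit[OF ap wg \<psi>, where N = N and B = "C\<^sup>2 * B"])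
  qed

  \<comment> \<open>The equation is tested with \<open>\<psi> m\<close>; its left side is
    \<open>X m\<close> up to the error \<open>r m\<close>. The hypothesis \<open>data\<close>
    returns half of \<open>X m\<close>, which is absorbed and doubles the rest.\<close>
  have X_le: "X m \<le> 2 * (l * Q m) + 2 * (\<integral>x. W x \<partial>M) + 2 * r m" for m
  proof -
    have i1: "integrable M (\<lambda>x. F x * \<psi> m x)"
      using square_integrable_inner[OF F square_integrable_test[OF \<psi>[of m]]] by simp
    have i2: "integrable M (\<lambda>x. f x \<bullet> grad (\<psi> m) x)"
      using square_integrable_inner[OF f square_integrable_grad_test[OF \<psi>[of m]]] .
    have "X m - r m = (\<integral>x. F x * \<psi> m x \<partial>M) - (\<integral>x. f x \<bullet> grad (\<psi> m) x \<partial>M)"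
      using eq[OF \<psi>[of m]] by (simp add: r_def X_def Xint)
    also have "\<dots> = (\<integral>x. F x * \<psi> m x - f x \<bullet> grad (\<psi> m) x \<partial>M)"
      using i1 i2 by simp
    also have "\<dots> \<le> (\<integral>x. reg_power_deriv p \<delta> (\<phi> m x) * (norm (grad (\<phi> m) x))\<^sup>2 / 2
        + l * reg \<delta> (\<phi> m x) powr (p / 2) + W x \<partial>M)"
    proof (rule integral_mono)
      show "F x * \<psi> m x - f x \<bullet> grad (\<psi> m) x \<le> reg_power_deriv p \<delta> (\<phi> m x) * (norm (grad (\<phi> m) x))\<^sup>2 / 2
        + l * reg \<delta> (\<phi> m x) powr (p / 2) + W x" for x
        using data[of x "\<phi> m x" "grad (\<phi> m) x"] by (simp add: \<psi>_def g\<psi> mult.commute)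
    qed (use i1 i2 W iX[of m] iQ[of m] in simp_all)
    also have "\<dots> = X m / 2 + l * Q m + (\<integral>x. W x \<partial>M)"
      using W iX[of m] iQ[of m] by (simp add: X_def Q_def)
    finally show ?thesis by simp
  qed

  \<comment> \<open>The Poincare inequality enters here, and only through \<open>\<eta> m\<close>:
    its square controls the regularised p-th power, its gradient is controlled by
    \<open>X m\<close>.\<close>
  have Q_le: "Q m \<le> 2 * (\<kappa> * X m) + 2 * D" for m
  proof -
    have sq: "integrable M (\<lambda>x. (\<eta> m x)\<^sup>2)"
      using square_integrable_test[OF \<eta>[of m]] by (simp add: square_integrable_def)
    have "Q m \<le> (\<integral>x. 2 * (\<eta> m x)\<^sup>2 + 2 * \<delta> powr (p / 2) \<partial>M)"
      unfolding Q_def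
    proof (rule integral_mono)
      show "reg \<delta> (\<phi> m x) powr (p / 2) \<le> 2 * (\<eta> m x)\<^sup>2 + 2 * \<delta> powr (p / 2)" for x
        using reg_powr_le_reg_half[OF \<delta>] by (simp add: \<eta>_def)
    qed (use iQ[of m] sq finite_measure.integrable_const[OF finite_measure_M] in
        \<open>auto intro!: Bochner_Integration.integrable_add\<close>)
    also have "\<dots> = 2 * (\<integral>x. (\<eta> m x)\<^sup>2 \<partial>M) + 2 * D"
      using sq finite_measure.integrable_const[OF finite_measure_M]
      by (subst Bochner_Integration.integral_add) (auto simp: D_def)
    also have "(\<integral>x. (\<eta> m x)\<^sup>2 \<partial>M) \<le> S * (\<integral>x. (norm (grad (\<eta> m) x))\<^sup>2 \<partial>M)"
      by (rule poincare[OF \<eta>])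
    also have "(\<integral>x. (norm (grad (\<eta> m) x))\<^sup>2 \<partial>M)
        \<le> (\<integral>x. K * (reg_power_deriv p \<delta> (\<phi> m x) * (norm (grad (\<phi> m) x))\<^sup>2) \<partial>M)"
    proof (rule integral_mono)
      show "(norm (grad (\<eta> m) x))\<^sup>2 \<le> K * (reg_power_deriv p \<delta> (\<phi> m x) * (norm (grad (\<phi> m) x))\<^sup>2)" for x
        using mult_right_mono[OF reg_half_deriv_square[OF \<delta> p, of "\<phi> m x"], of "(norm (grad (\<phi> m) x))\<^sup>2"]
        by (simp add: g\<eta> power_mult_distrib K mult.assoc)
    qed (use square_integrable_grad_test[OF \<eta>[of m]] iX[of m] in \<open>auto simp: square_integrable_def\<close>)
    also have "\<dots> = K * X m" by (simp add: X_def)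
    finally show ?thesis using S by (simp add: \<kappa>_def mult.assoc mult_left_mono)
  qed

  \<comment> \<open>Inserting \<open>X_le\<close> into \<open>Q_le\<close> gives at most
    \<open>Q m / 2\<close> on the right, because 4 \<kappa> l <= 1/2. It can be subtracted since
    \<open>Q m\<close> is a finite real number.\<close>
  have bound: "Q m \<le> 8 * \<kappa> * ((\<integral>x. W x \<partial>M) + r m) + 4 * D" for m
  proof -
    have "\<kappa> * X m \<le> \<kappa> * (2 * (l * Q m) + 2 * (\<integral>x. W x \<partial>M) + 2 * r m)"
      using X_le \<kappa> by (rule mult_left_mono)
    also have "\<dots> = (4 * \<kappa> * l) * Q m / 2 + 2 * (\<kappa> * ((\<integral>x. W x \<partial>M) + r m))"
      by (simp add: algebra_simps)
    also have "(4 * \<kappa> * l) * Q m \<le> 1 / 2 * Q m"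
      using l Q0[of m] by (intro mult_right_mono) (auto simp: \<kappa>_def)
    finally have "\<kappa> * X m \<le> Q m / 4 + 2 * (\<kappa> * ((\<integral>x. W x \<partial>M) + r m))" by simp
    then show ?thesis using Q_le[of m] by (simp add: mult.assoc)
  qed

  \<comment> \<open>L2 convergence gives pointwise convergence almost everywhere only along a
    subsequence, which is enough for Fatou's lemma.\<close>
  have "\<exists>s::nat\<Rightarrow>nat. strict_mono s \<and> (AE x in M. (\<lambda>n. (\<phi> (s n) x - u x)\<^sup>2) \<longlonglongrightarrow> 0)"
  proof (rule tendsto_L1_AE_subseq)
    show "integrable M (\<lambda>x. (\<phi> n x - u x)\<^sup>2)" for n
      using square_integrable_diff[OF square_integrable_test[OF \<phi>[of n]], of u] ap
      by (simp add: square_integrable_def approximates_def)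
    show "(\<lambda>n. \<integral>x. norm ((\<phi> n x - u x)\<^sup>2) \<partial>M) \<longlonglongrightarrow> 0"
      using ap by (simp add: approximates_def)
  qed
  then obtain s where s: "strict_mono s" "AE x in M. (\<lambda>n. (\<phi> (s n) x - u x)\<^sup>2) \<longlonglongrightarrow> 0"
    by blast
  have "(\<integral>\<^sup>+x. ennreal (reg \<delta> (u x) powr (p / 2)) \<partial>M) \<le> ennreal (8 * \<kappa> * ((\<integral>x. W x \<partial>M) + 0) + 4 * D)"
  proof (rule nn_integral_le_limit)
    show "(\<lambda>x. reg \<delta> (\<phi> (s n) x) powr (p / 2)) \<in> borel_measurable M" for n
      using iQ[of "s n"] by simp
    show "AE x in M. (\<lambda>n. reg \<delta> (\<phi> (s n) x) powr (p / 2)) \<longlonglongrightarrow> reg \<delta> (u x) powr (p / 2)"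
      using s(2)
    proof eventually_elim
      case (elim x)
      then have "(\<lambda>n. \<bar>\<phi> (s n) x - u x\<bar>) \<longlonglongrightarrow> 0"
        using tendsto_real_sqrt by fastforce
      then have "(\<lambda>n. \<phi> (s n) x) \<longlonglongrightarrow> u x"
        by (simp add: LIM_zero_iff tendsto_rabs_zero_iff)
      then show ?case
        using continuous_on_tendsto_compose[OF continuous_on_reg[OF \<delta>]] by simp
    qed
    show "(\<lambda>n. 8 * \<kappa> * ((\<integral>x. W x \<partial>M) + r (s n)) + 4 * D) \<longlonglongrightarrow> 8 * \<kappa> * ((\<integral>x. W x \<partial>M) + 0) + 4 * D"
      using LIMSEQ_subseq_LIMSEQ[OF r0 s(1)] by (intro tendsto_intros) (simp add: o_def)
    show "(\<integral>\<^sup>+x. ennreal (reg \<delta> (\<phi> (s n) x) powr (p / 2)) \<partial>M)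
        \<le> ennreal (8 * \<kappa> * ((\<integral>x. W x \<partial>M) + r (s n)) + 4 * D)" for n
      using bound[of "s n"] iQ[of "s n"]
      by (subst nn_integral_eq_integral) (auto simp: Q_def intro: ennreal_leI)
  qed
  then show ?thesis by (simp add: \<kappa>_def D_def mult.assoc)
qed

text \<open>The regularisation is removed along \<delta> = 1 / (n + 1). The hypothesis on the data
  is uniform in \<delta>, and the additive error vanishes because \<open>U\<close> has finite
  measure.\<close>

lemma energy_estimate:
  assumes p: "p > 1" and S: "S > 0"
    and "\<And>\<psi>. \<psi> \<in> test_functions U \<Longrightarrow>
      (\<integral>x. (\<psi> x)\<^sup>2 \<partial>M) \<le> S * (\<integral>x. (norm (grad \<psi> x))\<^sup>2 \<partial>M)"
    and sol: "weak_solution U F f u"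
    and "square_integrable M F" "square_integrable M f" "integrable M W"
    and "K = p\<^sup>2 / 4 / min 1 (p - 1)"
    and "4 * (S * K) * l \<le> 1 / 2"
    and "\<And>\<delta> x s v. \<delta> > 0 \<Longrightarrow> F x * reg_power p \<delta> s - (f x \<bullet> v) * reg_power_deriv p \<delta> s
      \<le> reg_power_deriv p \<delta> s * (norm v)\<^sup>2 / 2 + l * reg \<delta> s powr (p / 2) + W x"
  shows "(\<integral>\<^sup>+x. ennreal (norm (u x) powr p) \<partial>M) \<le> ennreal (8 * (S * K) * (\<integral>x. W x \<partial>M))"
proof -
  have u: "u \<in> borel_measurable M"
    using sol by (auto simp: weak_solution_def W012_def Lp_space_def)
  have "(\<integral>\<^sup>+x. ennreal (\<bar>u x\<bar> powr p) \<partial>M)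
      \<le> ennreal (8 * (S * K) * (\<integral>x. W x \<partial>M) + 4 * 0 * measure M (space M))"
  proof (rule nn_integral_le_limit)
    show "(\<lambda>x. reg (1 / real (Suc n)) (u x) powr (p / 2)) \<in> borel_measurable M" for n
      using measurable_compose[OF u borel_measurable_continuous_onI[OF continuous_on_reg]] by simp
    show "AE x in M. (\<lambda>n. reg (1 / real (Suc n)) (u x) powr (p / 2)) \<longlonglongrightarrow> \<bar>u x\<bar> powr p"
      using p by (intro AE_I2 reg_tendsto) simp
    show "(\<lambda>n. 8 * (S * K) * (\<integral>x. W x \<partial>M) + 4 * (1 / real (Suc n)) powr (p / 2) * measure M (space M))
      \<longlonglongrightarrow> 8 * (S * K) * (\<integral>x. W x \<partial>M) + 4 * 0 * measure M (space M)"
    proof -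
      have "(\<lambda>n. 1 / real (Suc n)) \<longlonglongrightarrow> 0"
        using LIMSEQ_inverse_real_of_nat by (simp add: inverse_eq_divide)
      then have "(\<lambda>n. (1 / real (Suc n)) powr (p / 2)) \<longlonglongrightarrow> 0 powr (p / 2)"
        using p by (intro tendsto_powr') (auto intro!: always_eventually)
      then show ?thesis by (intro tendsto_intros) simp
    qed
    show "(\<integral>\<^sup>+x. ennreal (reg (1 / real (Suc n)) (u x) powr (p / 2)) \<partial>M)
      \<le> ennreal (8 * (S * K) * (\<integral>x. W x \<partial>M) + 4 * (1 / real (Suc n)) powr (p / 2) * measure M (space M))" for n
      by (rule regularised_energy_estimate[OF p S _ assms(3-9)]) (use assms(10) in auto)
  qed
  then show ?thesis by simp
qed

lemma square_integrable_zero: "square_integrable M (\<lambda>_. 0)"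
  by (simp add: square_integrable_def)

text \<open>Young's inequality splits the term with f into half of the energy and half of |f|^2
  times \<open>reg_power_deriv\<close>. The latter is at most (p - 1)/2 times |f|^2
  \<open>reg powr (p / 2 - 1)\<close>, to which \<open>powr_Young\<close> applies with r = 2; its
  condition r <= p is the restriction p >= 2.\<close>

lemma C_const_le:
  assumes p: "p \<ge> 2" and S: "S > 0"
    and poincare: "\<And>\<psi>. \<psi> \<in> test_functions U \<Longrightarrow>
      (\<integral>x. (\<psi> x)\<^sup>2 \<partial>M) \<le> S * (\<integral>x. (norm (grad \<psi> x))\<^sup>2 \<partial>M)"
  shows "C_const p U \<le> ennreal (p * sqrt ((p - 1) * S))"
  unfolding C_const_def
proof (rule Sup_least, clarify)
  fix u :: "real^'n \<Rightarrow> real" and f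
  assume fp: "f \<in> Lp_space p U" and f2: "f \<in> Lp_space 2 U" and f1: "Lp_norm p U f = 1"
    and sol: "weak_solution U (\<lambda>_. 0) f u"
  \<comment> \<open>Chosen so that, with l = (p - 1) / (2 c^2), the smallness condition 4 S K l <=
    1/2 holds with equality. The same identity turns 8 S K (p - 1) / 2 into c^2, so the final bound
    is exactly \<open>c powr p\<close>.\<close>
  define c where "c = p * sqrt ((p - 1) * S)"
  have c: "c > 0" using p S by (simp add: c_def)
  have c2: "c\<^sup>2 = p\<^sup>2 * (p - 1) * S" using p S by (simp add: c_def power_mult_distrib)
  define K where "K = p\<^sup>2 / 4 / min 1 (p - 1)"
  have K: "K = p\<^sup>2 / 4" using p by (simp add: K_def)
  define W where "W x = (p - 1) / 2 * ((1 / c) powr (2 - p) * norm (f x) powr p)" for x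
  define l where "l = (p - 1) / 2 * (1 / c)\<^sup>2"
  have "(\<integral>\<^sup>+x. ennreal (norm (u x) powr p) \<partial>M) \<le> ennreal (8 * (S * K) * (\<integral>x. W x \<partial>M))"
  proof (rule energy_estimate[OF _ S poincare sol square_integrable_zero Lp_space_2[OF f2] _ K_def])
    show "p > 1" using p by simp
    show "integrable M W"
      unfolding W_def[abs_def] by (intro integrable_mult_right Lp_space_integrable[OF fp])
    show "4 * (S * K) * l \<le> 1 / 2"
      using c2 c p S by (simp add: K l_def power_divide field_simps)
    fix \<delta> x s v assume \<delta>: "\<delta> > (0::real)"
    let ?G = "reg_power_deriv p \<delta> s"
    have G0: "?G \<ge> 0" using reg_power_deriv_nonneg[OF \<delta>] p by simp
    have "- (f x \<bullet> v) \<le> (norm v)\<^sup>2 / 2 + (norm (f x))\<^sup>2 / 2"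
    proof -
      have "2 * (norm (f x) * norm v) \<le> (norm v)\<^sup>2 + (norm (f x))\<^sup>2"
        using sum_squares_bound[of "norm v" "norm (f x)"] by (simp add: mult.commute mult.left_commute)
      then show ?thesis using Cauchy_Schwarz_ineq2[of "f x" v] by linarith
    qed
    then have "- (f x \<bullet> v) * ?G \<le> ((norm v)\<^sup>2 / 2 + (norm (f x))\<^sup>2 / 2) * ?G"
      using G0 by (rule mult_right_mono)
    moreover have "((norm v)\<^sup>2 / 2 + (norm (f x))\<^sup>2 / 2) * ?G = ?G * (norm v)\<^sup>2 / 2 + ?G * (norm (f x))\<^sup>2 / 2"
      by (simp add: algebra_simps)
    moreover have "?G * (norm (f x))\<^sup>2 \<le> (p - 1) * (reg \<delta> s powr (p / 2 - 1) * (norm (f x))\<^sup>2)"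
      using mult_right_mono[OF reg_power_deriv_upper[OF \<delta>, of p s], of "(norm (f x))\<^sup>2"] p
      by (simp add: max_def mult.assoc)
    moreover have "reg \<delta> s powr (p / 2 - 1) * (norm (f x))\<^sup>2
        \<le> (1 / c)\<^sup>2 * reg \<delta> s powr (p / 2) + (1 / c) powr (2 - p) * norm (f x) powr p"
      using powr_Young[OF reg_pos[OF \<delta>, of s] norm_ge_zero[of "f x"], of "1 / c" 2 p] c p
      by (simp add: diff_divide_distrib)
    then have "(p - 1) * (reg \<delta> s powr (p / 2 - 1) * (norm (f x))\<^sup>2)
        \<le> (p - 1) * ((1 / c)\<^sup>2 * reg \<delta> s powr (p / 2) + (1 / c) powr (2 - p) * norm (f x) powr p)"
      using p by (intro mult_left_mono) auto
    ultimately have "- (f x \<bullet> v) * ?G \<le> ?G * (norm v)\<^sup>2 / 2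
        + (p - 1) * ((1 / c)\<^sup>2 * reg \<delta> s powr (p / 2) + (1 / c) powr (2 - p) * norm (f x) powr p) / 2"
      by linarith
    then show "0 * reg_power p \<delta> s - (f x \<bullet> v) * ?G
        \<le> ?G * (norm v)\<^sup>2 / 2 + l * reg \<delta> s powr (p / 2) + W x"
      by (simp add: l_def W_def distrib_left add_divide_distrib mult.assoc)
  qed
  also have "8 * (S * K) * (\<integral>x. W x \<partial>M) \<le> c powr p"
  proof -
    have "(\<integral>x. norm (f x) powr p \<partial>M) \<le> 1"
      using Lp_norm_le_integral[of p f 1] f1 fp p by simp
    then have "(1 / c) powr (2 - p) * (\<integral>x. norm (f x) powr p \<partial>M) \<le> (1 / c) powr (2 - p) * 1"
      by (intro mult_left_mono) auto
    then have "(\<integral>x. W x \<partial>M) \<le> (p - 1) / 2 * (1 / c) powr (2 - p)"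
      using p by (simp add: W_def mult_left_mono)
    moreover have "8 * (S * K) \<ge> 0" using S by (simp add: K)
    ultimately have "8 * (S * K) * (\<integral>x. W x \<partial>M) \<le> 8 * (S * K) * ((p - 1) / 2 * (1 / c) powr (2 - p))"
      by (rule mult_left_mono)
    also have "\<dots> = c\<^sup>2 * (1 / c) powr (2 - p)"
      by (simp add: K c2 field_simps)
    also have "\<dots> = c powr 2 * c powr (p - 2)"
      using c by (simp add: powr_divide flip: powr_minus_divide)
    also have "\<dots> = c powr p" using c powr_add[of c 2 "p - 2"] by simp
    finally show ?thesis .
  qed
  finally show "Lp_norm p U u \<le> ennreal c"
    using Lp_norm_le_iff[of p c U u] p c by (simp add: ennreal_leI)
qed

text \<open>\<open>reg_power\<close> has size at most \<open>reg powr ((p - 1) / 2)\<close>, so the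
  term with F falls under \<open>powr_Young\<close> with r = 1, which covers all p > 1. None of the
  energy is spent, and the bound is linear in S instead of involving its square root.\<close>

lemma D_const_le:
  assumes p: "p > 1" and S: "S > 0"
    and poincare: "\<And>\<psi>. \<psi> \<in> test_functions U \<Longrightarrow>
      (\<integral>x. (\<psi> x)\<^sup>2 \<partial>M) \<le> S * (\<integral>x. (norm (grad \<psi> x))\<^sup>2 \<partial>M)"
  shows "D_const p U \<le> ennreal (2 * p\<^sup>2 / min 1 (p - 1) * S)"
  unfolding D_const_def
proof (rule Sup_least, clarify)
  fix u F :: "real^'n \<Rightarrow> real"
  assume Fp: "F \<in> Lp_space p U" and F2: "F \<in> Lp_space 2 U" and F1: "Lp_norm p U F = 1"
    and sol: "weak_solution U F (\<lambda>_. 0) u"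
  define K where "K = p\<^sup>2 / 4 / min 1 (p - 1)"
  \<comment> \<open>With l = 1 / c the smallness condition is an equality, and the integral of
    \<open>W\<close> is at most \<open>c powr (p - 1)\<close>, so the product with c is
    \<open>c powr p\<close>.\<close>
  define c where "c = 8 * (S * K)"
  have c: "c > 0" using p S by (simp add: c_def K_def)
  define W where "W x = (1 / c) powr (1 - p) * norm (F x) powr p" for x
  have "(\<integral>\<^sup>+x. ennreal (norm (u x) powr p) \<partial>M) \<le> ennreal (8 * (S * K) * (\<integral>x. W x \<partial>M))"
  proof (rule energy_estimate[OF p S poincare sol Lp_space_2[OF F2] square_integrable_zero _ K_def])
    show "integrable M W"
      unfolding W_def[abs_def] by (intro integrable_mult_right Lp_space_integrable[OF Fp])
    show "4 * (S * K) * (1 / c) \<le> 1 / 2" using c by (simp add: c_def)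
    fix \<delta> x s and v :: "real^'n" assume \<delta>: "\<delta> > (0::real)"
    have "F x * reg_power p \<delta> s \<le> \<bar>reg_power p \<delta> s\<bar> * \<bar>F x\<bar>"
      by (metis abs_ge_self abs_mult mult.commute)
    also have "\<dots> \<le> reg \<delta> s powr ((p - 1) / 2) * norm (F x) powr 1"
      using reg_power_abs_le[OF \<delta>, of p s] by (simp add: mult_right_mono)
    also have "\<dots> \<le> (1 / c) powr 1 * reg \<delta> s powr (p / 2) + W x"
      unfolding W_def using p c by (intro powr_Young reg_pos \<delta>) auto
    also have "(1 / c) powr 1 = 1 / c" using c by simp
    finally have "F x * reg_power p \<delta> s \<le> 1 / c * reg \<delta> s powr (p / 2) + W x" .
    moreover have "0 \<le> reg_power_deriv p \<delta> s * (norm v)\<^sup>2 / 2"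
      using reg_power_deriv_nonneg[OF \<delta> p, of s] by simp
    ultimately show "F x * reg_power p \<delta> s - (0 \<bullet> v) * reg_power_deriv p \<delta> s
        \<le> reg_power_deriv p \<delta> s * (norm v)\<^sup>2 / 2 + 1 / c * reg \<delta> s powr (p / 2) + W x"
      by simp
  qed
  also have "8 * (S * K) * (\<integral>x. W x \<partial>M) \<le> c powr p"
  proof -
    have "(\<integral>x. norm (F x) powr p \<partial>M) \<le> 1"
      using Lp_norm_le_integral[of p F 1] F1 Fp p by simp
    then have "(1 / c) powr (1 - p) * (\<integral>x. norm (F x) powr p \<partial>M) \<le> (1 / c) powr (1 - p) * 1"
      by (intro mult_left_mono) auto
    then have "c * (\<integral>x. W x \<partial>M) \<le> c * (1 / c) powr (1 - p)"
      using c by (simp add: W_def)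
    also have "\<dots> = c powr 1 * c powr (p - 1)"
      using c by (simp add: powr_divide flip: powr_minus_divide)
    also have "\<dots> = c powr p" using c powr_add[of c 1 "p - 1"] by simp
    finally show ?thesis by (simp add: c_def)
  qed
  finally have "Lp_norm p U u \<le> ennreal c"
    using Lp_norm_le_iff[of p c U u] p c by (simp add: ennreal_leI)
  then show "Lp_norm p U u \<le> ennreal (2 * p\<^sup>2 / min 1 (p - 1) * S)"
    by (simp add: c_def K_def mult_ac)
qed

end

section \<open>The Poincare inequality on a perforated domain\<close>

lemma weighted_increment_bound:
  fixes f f' w :: "real \<Rightarrow> real"
  assumes ab: "a \<le> b" and f: "\<And>t. (f has_real_derivative f' t) (at t)"
    and cf: "continuous_on {a..b} f'" and cw: "continuous_on {a..b} w"
    and w: "\<And>t. t \<in> {a..b} \<Longrightarrow> w t > 0"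
    and \<Lambda>: "integral {a..b} (\<lambda>t. 1 / w t) \<le> \<Lambda>"
  shows "ennreal ((f b - f a)\<^sup>2)
    \<le> ennreal \<Lambda> * (\<integral>\<^sup>+t. ennreal (w t * (f' t)\<^sup>2) * indicator {a..b} t \<partial>lborel)"
proof -
  let ?A = "integral {a..b} (\<lambda>t. 1 / w t)" and ?B = "integral {a..b} (\<lambda>t. w t * (f' t)\<^sup>2)"
  have w0: "w t \<noteq> 0" if "t \<in> {a..b}" for t using w[OF that] by simp
  have iA: "(\<lambda>t. 1 / w t) integrable_on {a..b}"
    using w0 by (intro integrable_continuous_real continuous_intros cw) auto
  have iB: "(\<lambda>t. w t * (f' t)\<^sup>2) integrable_on {a..b}"
    by (intro integrable_continuous_real continuous_intros cw cf)
  have A0: "?A \<ge> 0" by (intro integral_nonneg iA) (simp add: less_imp_le[OF w])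
  have B0: "?B \<ge> 0" by (intro integral_nonneg iB) (simp add: less_imp_le[OF w])
  have "(f' has_integral f b - f a) {a..b}"
    using ab f by (intro fundamental_theorem_of_calculus)
      (auto simp: has_real_derivative_iff_has_vector_derivative[symmetric]
        intro: has_field_derivative_at_within)
  then have FTC: "f b - f a = integral {a..b} f'" by (simp add: integral_unique)
  have "(f b - f a)\<^sup>2 \<le> ?A * ?B"
  proof (rule square_le_of_Young[OF A0 B0])
    fix s :: real assume s: "s > 0"
    \<comment> \<open>The square of \<open>s - w t * \<bar>f' t\<bar>\<close>, divided by
      \<open>s * w t\<close>, is nonnegative. Integrated, it gives Cauchy-Schwarz for the product of
      1 / sqrt w and sqrt w times f'.\<close>
    have pw: "2 * \<bar>f' t\<bar> \<le> s * (1 / w t) + w t * (f' t)\<^sup>2 / s" if "t \<in> {a..b}" for t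
    proof -
      have "0 \<le> (s - w t * \<bar>f' t\<bar>)\<^sup>2 / (s * w t)" using s w[OF that] by simp
      also have "\<dots> = s * (1 / w t) + w t * (f' t)\<^sup>2 / s - 2 * \<bar>f' t\<bar>"
        using s w[OF that] by (simp add: field_simps power2_eq_square)
      finally show ?thesis by simp
    qed
    have "\<bar>2 * integral {a..b} f'\<bar> = norm (integral {a..b} (\<lambda>t. 2 * f' t))" by simp
    also have "\<dots> \<le> integral {a..b} (\<lambda>t. s * (1 / w t) + w t * (f' t)\<^sup>2 / s)"
    proof (rule integral_norm_bound_integral)
      show "(\<lambda>t. 2 * f' t) integrable_on {a..b}"
        by (intro integrable_continuous_real continuous_intros cf)
      show "(\<lambda>t. s * (1 / w t) + w t * (f' t)\<^sup>2 / s) integrable_on {a..b}"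
        using s w0 by (intro integrable_continuous_real continuous_intros cf cw) auto
    qed (use pw in \<open>auto simp: abs_mult\<close>)
    also have "\<dots> = s * ?A + ?B / s"
    proof -
      have "(\<lambda>t. s * (1 / w t)) integrable_on {a..b}"
        using integrable_on_cmult_left[OF iA, of s] by simp
      from integral_add[OF this integrable_on_divide[OF iB, of s]]
      show ?thesis by (simp only: integral_mult_right integral_divide)
    qed
    finally show "2 * \<bar>f b - f a\<bar> \<le> s * ?A + ?B / s" by (simp add: FTC abs_mult)
  qed
  also have "\<dots> \<le> \<Lambda> * ?B" using \<Lambda> B0 by (rule mult_right_mono)
  finally have "ennreal ((f b - f a)\<^sup>2) \<le> ennreal (\<Lambda> * ?B)" by (rule ennreal_leI)
  also have "\<dots> = ennreal \<Lambda> * ennreal ?B"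
    using A0 \<Lambda> B0 by (intro ennreal_mult) auto
  also have "ennreal ?B = (\<integral>\<^sup>+t. ennreal (w t * (f' t)\<^sup>2) * indicator {a..b} t \<partial>lborel)"
    using iB by (intro nn_integral_has_integral_lebesgue'[symmetric])
      (auto simp: less_imp_le[OF w])
  finally show ?thesis .
qed

lemma smooth_line_derivative:
  assumes "smooth \<phi>"
  shows "((\<lambda>t. \<phi> (x + t *\<^sub>R h)) has_real_derivative grad \<phi> (x + t *\<^sub>R h) \<bullet> h) (at t)"
proof -
  have "((\<lambda>t. x + t *\<^sub>R h) has_derivative (\<lambda>t. t *\<^sub>R h)) (at t)"
    by (auto intro!: derivative_eq_intros)
  from has_derivative_compose[OF this smooth_has_derivative[OF assms]]
  show ?thesis by (simp add: has_field_derivative_def mult_commute_abs)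
qed

lemma line_bound:
  assumes \<phi>: "smooth \<phi>" and "a \<le> b" "continuous_on {a..b} w" "\<And>t. t \<in> {a..b} \<Longrightarrow> w t > 0"
    and "integral {a..b} (\<lambda>t. 1 / w t) \<le> \<Lambda>"
  shows "ennreal ((\<phi> (x + b *\<^sub>R h) - \<phi> (x + a *\<^sub>R h))\<^sup>2) \<le> ennreal \<Lambda> *
    (\<integral>\<^sup>+t. ennreal (w t * ((norm h)\<^sup>2 * (norm (grad \<phi> (x + t *\<^sub>R h)))\<^sup>2)) * indicator {a..b} t \<partial>lborel)"
proof -
  have "continuous_on {a..b} (\<lambda>t. grad \<phi> (x + t *\<^sub>R h) \<bullet> h)"
    by (intro continuous_on_inner continuous_on_compose2[OF smooth_continuous_grad[OF \<phi>, of UNIV]]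
        continuous_intros) auto
  then have "ennreal ((\<phi> (x + b *\<^sub>R h) - \<phi> (x + a *\<^sub>R h))\<^sup>2) \<le> ennreal \<Lambda> *
    (\<integral>\<^sup>+t. ennreal (w t * (grad \<phi> (x + t *\<^sub>R h) \<bullet> h)\<^sup>2) * indicator {a..b} t \<partial>lborel)"
    using assms smooth_line_derivative[OF \<phi>] by (intro weighted_increment_bound) auto
  also have "\<dots> \<le> ennreal \<Lambda> *
    (\<integral>\<^sup>+t. ennreal (w t * ((norm h)\<^sup>2 * (norm (grad \<phi> (x + t *\<^sub>R h)))\<^sup>2)) * indicator {a..b} t \<partial>lborel)"
  proof (intro mult_left_mono nn_integral_mono)
    fix t
    have "(grad \<phi> (x + t *\<^sub>R h) \<bullet> h)\<^sup>2 \<le> (norm h)\<^sup>2 * (norm (grad \<phi> (x + t *\<^sub>R h)))\<^sup>2"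
      using Cauchy_Schwarz_ineq[of "grad \<phi> (x + t *\<^sub>R h)" h]
      by (simp add: power2_norm_eq_inner mult.commute)
    then show "ennreal (w t * (grad \<phi> (x + t *\<^sub>R h) \<bullet> h)\<^sup>2) * indicator {a..b} t
      \<le> ennreal (w t * ((norm h)\<^sup>2 * (norm (grad \<phi> (x + t *\<^sub>R h)))\<^sup>2)) * indicator {a..b} t"
      using assms(4)[of t]
      by (cases "t \<in> {a..b}") (auto intro!: ennreal_leI mult_left_mono)
  qed simp
  finally show ?thesis .
qed

lemma measurable_grad_square:
  "smooth \<phi> \<Longrightarrow> (\<lambda>x. ennreal ((norm (grad \<phi> x))\<^sup>2)) \<in> borel_measurable borel"
  using borel_measurable_continuous_onI[OF smooth_continuous_grad] by measurable

lemma measurable_smooth: "smooth \<phi> \<Longrightarrow> \<phi> \<in> borel_measurable borel"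
  by (intro borel_measurable_continuous_onI smooth_continuous)

lemma nn_integral_translate:
  fixes f :: "'a::euclidean_space \<Rightarrow> ennreal"
  assumes "f \<in> borel_measurable borel"
  shows "(\<integral>\<^sup>+x. f (v + x) \<partial>lborel) = (\<integral>\<^sup>+x. f x \<partial>lborel)"
proof -
  have "(\<integral>\<^sup>+x. f x \<partial>lborel) = (\<integral>\<^sup>+x. f x \<partial>distr lborel borel ((+) v))"
    by (simp add: lborel_distr_plus)
  also have "\<dots> = (\<integral>\<^sup>+x. f (v + x) \<partial>lborel)"
    using assms by (intro nn_integral_distr) auto
  finally show ?thesis by simp
qed

lemma nn_integral_scale:
  fixes f :: "'a::euclidean_space \<Rightarrow> ennreal"
  assumes "f \<in> borel_measurable borel" "c > 0"
  shows "(\<integral>\<^sup>+x. f x \<partial>lborel) = ennreal (c ^ DIM('a)) * (\<integral>\<^sup>+x. f (c *\<^sub>R x) \<partial>lborel)"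
  using assms
  by (subst lborel_affine[of c 0]) (simp_all add: nn_integral_density nn_integral_distr nn_integral_cmult)

text \<open>The increment along each segment is estimated with weight 1; Tonelli and translation
  invariance then make every slice t contribute the same integral. Wherever the translated point
  falls outside the support this is a Poincare inequality with constant the squared length of the
  shift.\<close>

lemma translation_bound:
  fixes \<phi> :: "real^'n \<Rightarrow> real"
  assumes \<phi>: "smooth \<phi>"
  shows "(\<integral>\<^sup>+x. ennreal ((\<phi> (x + h) - \<phi> x)\<^sup>2) \<partial>lborel)
    \<le> ennreal ((norm h)\<^sup>2) * (\<integral>\<^sup>+x. ennreal ((norm (grad \<phi> x))\<^sup>2) \<partial>lborel)"
proof -
  define g where "g x = ennreal ((norm (grad \<phi> x))\<^sup>2)" for x
  have g [measurable]: "g \<in> borel_measurable borel"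
    unfolding g_def[abs_def] using \<phi> by (rule measurable_grad_square)
  have "(\<integral>\<^sup>+x. ennreal ((\<phi> (x + h) - \<phi> x)\<^sup>2) \<partial>lborel)
      \<le> (\<integral>\<^sup>+x. (\<integral>\<^sup>+t. ennreal ((norm h)\<^sup>2) * (g (t *\<^sub>R h + x) * indicator {0..1} t) \<partial>lborel) \<partial>lborel)"
  proof (rule nn_integral_mono)
    fix x
    show "ennreal ((\<phi> (x + h) - \<phi> x)\<^sup>2) \<le> (\<integral>\<^sup>+t. ennreal ((norm h)\<^sup>2) * (g (t *\<^sub>R h + x) * indicator {0..1} t) \<partial>lborel)"
      using line_bound[OF \<phi>, of 0 1 "\<lambda>_. 1" 1 x h]
      by (simp add: g_def add.commute ennreal_mult mult.assoc)
  qed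
  also have "\<dots> = (\<integral>\<^sup>+t. (\<integral>\<^sup>+x. ennreal ((norm h)\<^sup>2) * (g (t *\<^sub>R h + x) * indicator {0..1} t) \<partial>lborel) \<partial>lborel)"
    by (rule lborel_pair.Fubini'[symmetric]) measurable
  also have "\<dots> = (\<integral>\<^sup>+t. ennreal ((norm h)\<^sup>2) * ((\<integral>\<^sup>+x. g x \<partial>lborel) * indicator {0..1::real} t) \<partial>lborel)"
    by (simp add: nn_integral_cmult nn_integral_multc nn_integral_translate)
  also have "\<dots> = ennreal ((norm h)\<^sup>2) * (\<integral>\<^sup>+x. g x \<partial>lborel)"
    by (simp add: nn_integral_cmult nn_integral_cmult_indicator)
  finally show ?thesis by (simp add: g_def)
qed

section \<open>One cell: integration along rays from the hole\<close>

lemma nn_integral_inverse_cube: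
  assumes "a > 0"
  shows "(\<integral>\<^sup>+t. ennreal (1 / t ^ 3) * indicator {a..} t \<partial>lborel) = ennreal (1 / (2 * a\<^sup>2))"
proof -
  have "(\<integral>\<^sup>+t. ennreal (1 / t ^ 3) * indicator {a..} t \<partial>lborel) = ennreal (0 - (- 1 / (2 * a\<^sup>2)))"
  proof (rule nn_integral_FTC_atLeast)
    show "((\<lambda>t::real. - 1 / (2 * t\<^sup>2)) has_real_derivative 1 / t ^ 3) (at t)" if "a \<le> t" for t
      using that assms
      by (auto intro!: derivative_eq_intros simp: divide_simps power2_eq_square power3_eq_cube)
    show "((\<lambda>t::real. - 1 / (2 * t\<^sup>2)) \<longlongrightarrow> 0) at_top"
    proof -
      have "((\<lambda>t::real. (- 1 / 2) * inverse (t\<^sup>2)) \<longlongrightarrow> (- 1 / 2) * 0) at_top"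
        by (intro tendsto_intros tendsto_inverse_0_at_top filterlim_pow_at_top filterlim_ident) simp
      then show ?thesis by (simp add: field_simps)
    qed
  qed (use assms in auto)
  then show ?thesis by simp
qed

text \<open>Half-open, unlike \<open>unit_cell\<close>, so that the lattice translates partition the
  space and no point is counted twice.\<close>

definition cube :: "real \<Rightarrow> (real^'n) set" where
  "cube s = {y. \<forall>i. - s / 2 \<le> y $ i \<and> y $ i < s / 2}"

lemma cube_borel [measurable]: "(cube s :: (real^'n) set) \<in> sets borel"
proof -
  have "cube s = (\<Inter>i. {y::real^'n. - s / 2 \<le> y \<bullet> axis i 1} \<inter> {y. y \<bullet> axis i 1 < s / 2})"
    by (auto simp: cube_def inner_axis)
  also have "\<dots> \<in> sets borel"
    by (intro sets.countable_INT'' sets.Int) (auto intro: countable_finite)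
  finally show ?thesis .
qed

lemma cube_norm_le:
  fixes y :: "real^'n"
  assumes "y \<in> cube s"
  shows "norm y \<le> real CARD('n) * s / 2"
proof -
  have "norm y \<le> (\<Sum>i\<in>UNIV. \<bar>y $ i\<bar>)" by (rule norm_le_l1_cart)
  also have "\<dots> \<le> (\<Sum>i::'n\<in>UNIV. s / 2)"
  proof (rule sum_mono)
    fix i
    have "- s / 2 \<le> y $ i" "y $ i < s / 2" using assms by (auto simp: cube_def)
    then show "\<bar>y $ i\<bar> \<le> s / 2" by simp
  qed
  finally show ?thesis by simp
qed

lemma cube_star:
  assumes "(1 / t) *\<^sub>R w \<in> cube s" "0 < t" "t \<le> 1" "s > 0"
  shows "w \<in> cube s"
  unfolding cube_def
proof safe
  fix i
  have "- s / 2 \<le> w $ i / t" "w $ i / t < s / 2" using assms(1) by (auto simp: cube_def)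
  then have "t * (- s / 2) \<le> w $ i" "w $ i < t * (s / 2)"
    using assms(2) by (auto simp: field_simps)
  moreover have "t * (s / 2) \<le> s / 2" using assms by (intro mult_left_le_one_le) auto
  ultimately show "- s / 2 \<le> w $ i" "w $ i < s / 2" by auto
qed

text \<open>The weight \<open>t ^ (d - 1)\<close> imitates polar coordinates. A plain Minkowski inequality along
  the rays would lose a factor of a logarithm in dimension two.\<close>

lemma cell_bound:
  fixes \<phi> :: "real^'n \<Rightarrow> real"
  assumes \<phi>: "smooth \<phi>" and s: "s > 0" and \<tau>: "0 < \<tau>" "\<tau> \<le> 1"
    and hole: "\<And>y. norm y < \<rho> \<Longrightarrow> \<phi> (z + y) = 0"
    and small: "\<tau> * (real CARD('n) * s / 2) < \<rho>"
    and \<Lambda>: "integral {\<tau>..1} (\<lambda>t. 1 / t ^ (CARD('n) - 1)) \<le> \<Lambda>"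
  shows "(\<integral>\<^sup>+y. ennreal ((\<phi> (z + y))\<^sup>2) * indicator (cube s) y \<partial>lborel)
    \<le> ennreal \<Lambda> * (ennreal ((real CARD('n) * s)\<^sup>2 / 8) *
        (\<integral>\<^sup>+y. ennreal ((norm (grad \<phi> (z + y)))\<^sup>2) * indicator (cube s) y \<partial>lborel))"
proof -
  define g where "g y = ennreal ((norm (grad \<phi> (z + y)))\<^sup>2)" for y
  let ?n = "CARD('n)"
  define Q where "Q = (cube s :: (real^'n) set)"
  have Q [measurable]: "Q \<in> sets borel" by (simp add: Q_def)
  have [measurable]: "(\<lambda>x. ennreal ((norm (grad \<phi> x))\<^sup>2)) \<in> borel_measurable borel"
    using \<phi> by (rule measurable_grad_square)
  have g [measurable]: "g \<in> borel_measurable borel"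
    unfolding g_def[abs_def] by measurable
  \<comment> \<open>The integrand in the variable w = t y. For fixed w, the indicator records which
    t can have produced w from a point of the cell.\<close>
  define k where "k t w = indicator Q ((1 / t) *\<^sub>R w) * (ennreal ((norm w)\<^sup>2) * g w)"
    for t :: real and w
  have k [measurable]: "k t \<in> borel_measurable borel" for t
    unfolding k_def[abs_def] by measurable
  have n: "?n \<ge> 1" using zero_less_card_finite[where 'a='n] by linarith

  have "(\<integral>\<^sup>+y. ennreal ((\<phi> (z + y))\<^sup>2) * indicator Q y \<partial>lborel)
      \<le> (\<integral>\<^sup>+y. ennreal \<Lambda> * (\<integral>\<^sup>+t. ennreal (t ^ (?n - 1)) * ((ennreal ((norm y)\<^sup>2) * g (t *\<^sub>R y))
            * indicator Q y) * indicator {\<tau>..1} t \<partial>lborel) \<partial>lborel)"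
  proof (rule nn_integral_mono)
    fix y
    show "ennreal ((\<phi> (z + y))\<^sup>2) * indicator Q y
      \<le> ennreal \<Lambda> * (\<integral>\<^sup>+t. ennreal (t ^ (?n - 1)) * ((ennreal ((norm y)\<^sup>2) * g (t *\<^sub>R y))
            * indicator Q y) * indicator {\<tau>..1} t \<partial>lborel)"
    proof (cases "y \<in> Q")
      case True
      have "\<tau> * norm y \<le> \<tau> * (real ?n * s / 2)"
        using cube_norm_le[of y s] True \<tau> by (intro mult_left_mono) (auto simp: Q_def)
      then have "\<tau> * norm y < \<rho>" using small by linarith
      then have z: "\<phi> (z + \<tau> *\<^sub>R y) = 0" using \<tau> by (intro hole) simp
      have "ennreal ((\<phi> (z + 1 *\<^sub>R y) - \<phi> (z + \<tau> *\<^sub>R y))\<^sup>2) \<le> ennreal \<Lambda> *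
        (\<integral>\<^sup>+t. ennreal (t ^ (?n - 1) * ((norm y)\<^sup>2 * (norm (grad \<phi> (z + t *\<^sub>R y)))\<^sup>2))
          * indicator {\<tau>..1} t \<partial>lborel)"
        using \<tau> \<Lambda> by (intro line_bound \<phi> continuous_intros) auto
      also have "\<dots> = ennreal \<Lambda> * (\<integral>\<^sup>+t. ennreal (t ^ (?n - 1)) * ((ennreal ((norm y)\<^sup>2) * g (t *\<^sub>R y))
            * indicator Q y) * indicator {\<tau>..1} t \<partial>lborel)"
      proof (intro arg_cong[where f = "\<lambda>a. ennreal \<Lambda> * a"] nn_integral_cong)
        fix t
        show "ennreal (t ^ (?n - 1) * ((norm y)\<^sup>2 * (norm (grad \<phi> (z + t *\<^sub>R y)))\<^sup>2)) * indicator {\<tau>..1} t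
          = ennreal (t ^ (?n - 1)) * ((ennreal ((norm y)\<^sup>2) * g (t *\<^sub>R y)) * indicator Q y) * indicator {\<tau>..1} t"
          using True \<tau> by (cases "t \<in> {\<tau>..1}") (simp_all add: g_def ennreal_mult)
      qed
      finally show ?thesis using True z by simp
    qed simp
  qed
  also have "\<dots> = ennreal \<Lambda> * (\<integral>\<^sup>+y. (\<integral>\<^sup>+t. ennreal (t ^ (?n - 1)) * ((ennreal ((norm y)\<^sup>2) * g (t *\<^sub>R y))
            * indicator Q y) * indicator {\<tau>..1} t \<partial>lborel) \<partial>lborel)"
    by (rule nn_integral_cmult) measurable
  also have "(\<integral>\<^sup>+y. (\<integral>\<^sup>+t. ennreal (t ^ (?n - 1)) * ((ennreal ((norm y)\<^sup>2) * g (t *\<^sub>R y))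
            * indicator Q y) * indicator {\<tau>..1} t \<partial>lborel) \<partial>lborel)
      = (\<integral>\<^sup>+t. (\<integral>\<^sup>+y. ennreal (t ^ (?n - 1)) * ((ennreal ((norm y)\<^sup>2) * g (t *\<^sub>R y))
            * indicator Q y) * indicator {\<tau>..1} t \<partial>lborel) \<partial>lborel)"
    by (rule lborel_pair.Fubini'[symmetric]) measurable
  \<comment> \<open>Substituting w = t y gives t^(-d) from the volume element and t^(-2) from the
    squared norm of y. Together with the weight t^(d-1) this leaves t^(-3) in every
    dimension.\<close>
  also have "\<dots> = (\<integral>\<^sup>+t. (\<integral>\<^sup>+w. ennreal (1 / t ^ 3) * indicator {\<tau>..1} t * k t w \<partial>lborel) \<partial>lborel)"
  proof (rule nn_integral_cong)
    fix t :: real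
    show "(\<integral>\<^sup>+y. ennreal (t ^ (?n - 1)) * ((ennreal ((norm y)\<^sup>2) * g (t *\<^sub>R y)) * indicator Q y)
        * indicator {\<tau>..1} t \<partial>lborel)
      = (\<integral>\<^sup>+w. ennreal (1 / t ^ 3) * indicator {\<tau>..1} t * k t w \<partial>lborel)"
    proof (cases "t \<in> {\<tau>..1}")
      case True
      then have t: "t > 0" using \<tau> by auto
      have e: "ennreal (t ^ (?n - 1)) * ((ennreal ((norm y)\<^sup>2) * g (t *\<^sub>R y)) * indicator Q y)
          = ennreal (1 / t ^ 3) * (ennreal (t ^ ?n) * k t (t *\<^sub>R y))" for y
      proof -
        have "t ^ (?n - 1) * t = t ^ ?n"
          using n by (metis Suc_diff_1 less_le_trans power_Suc2 zero_less_one)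
        then have "t ^ (?n - 1) * (norm y)\<^sup>2 = 1 / t ^ 3 * (t ^ ?n * (norm (t *\<^sub>R y))\<^sup>2)"
          using t by (simp add: power_mult_distrib field_simps power3_eq_cube power2_eq_square)
        then have "ennreal (t ^ (?n - 1)) * ennreal ((norm y)\<^sup>2)
            = ennreal (1 / t ^ 3) * (ennreal (t ^ ?n) * ennreal ((norm (t *\<^sub>R y))\<^sup>2))"
          using t by (simp flip: ennreal_mult)
        then show ?thesis using t by (simp add: k_def mult_ac)
      qed
      have "(\<integral>\<^sup>+y. ennreal (t ^ (?n - 1)) * ((ennreal ((norm y)\<^sup>2) * g (t *\<^sub>R y)) * indicator Q y) \<partial>lborel)
          = ennreal (1 / t ^ 3) * (ennreal (t ^ ?n) * (\<integral>\<^sup>+y. k t (t *\<^sub>R y) \<partial>lborel))"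
        unfolding e by (simp add: nn_integral_cmult)
      also have "ennreal (t ^ ?n) * (\<integral>\<^sup>+y. k t (t *\<^sub>R y) \<partial>lborel) = (\<integral>\<^sup>+w. k t w \<partial>lborel)"
        using nn_integral_scale[OF k t, of t] by simp
      also have "ennreal (1 / t ^ 3) * (\<integral>\<^sup>+w. k t w \<partial>lborel) = (\<integral>\<^sup>+w. ennreal (1 / t ^ 3) * k t w \<partial>lborel)"
        by (simp add: nn_integral_cmult)
      finally show ?thesis using True by simp
    qed simp
  qed
  also have "\<dots> = (\<integral>\<^sup>+w. (\<integral>\<^sup>+t. ennreal (1 / t ^ 3) * indicator {\<tau>..1} t * k t w \<partial>lborel) \<partial>lborel)"
    unfolding k_def by (rule lborel_pair.Fubini'[symmetric]) measurable
  also have "\<dots> \<le> (\<integral>\<^sup>+w. ennreal ((real ?n * s)\<^sup>2 / 8) * (g w * indicator Q w) \<partial>lborel)"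
  proof (rule nn_integral_mono)
    fix w :: "real^'n"
    show "(\<integral>\<^sup>+t. ennreal (1 / t ^ 3) * indicator {\<tau>..1} t * k t w \<partial>lborel)
      \<le> ennreal ((real ?n * s)\<^sup>2 / 8) * (g w * indicator Q w)"
    proof (cases "w = 0")
      case True
      then show ?thesis by (simp add: k_def)
    next
      case False
      \<comment> \<open>If w / t lies in the cube, its norm is at most n s / 2, hence t >= a. The
        integral of t^(-3) from a on is 1 / (2 a^2), whose singularity in w is cancelled by the
        squared norm of w; the constant (n s)^2 / 8 remains.\<close>
      define a where "a = 2 * norm w / (real ?n * s)"
      have a: "a > 0" using False s n by (simp add: a_def)
      have "(\<integral>\<^sup>+t. ennreal (1 / t ^ 3) * indicator {\<tau>..1} t * k t w \<partial>lborel)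
          \<le> (\<integral>\<^sup>+t. ennreal (1 / t ^ 3) * indicator {a..} t * (ennreal ((norm w)\<^sup>2) * (g w * indicator Q w)) \<partial>lborel)"
      proof (rule nn_integral_mono)
        fix t
        show "ennreal (1 / t ^ 3) * indicator {\<tau>..1} t * k t w
          \<le> ennreal (1 / t ^ 3) * indicator {a..} t * (ennreal ((norm w)\<^sup>2) * (g w * indicator Q w))"
        proof (cases "t \<in> {\<tau>..1} \<and> (1 / t) *\<^sub>R w \<in> Q")
          case True
          then have t: "0 < t" "t \<le> 1" using \<tau> by auto
          have "w \<in> Q" using cube_star[of t w s] True t s by (simp add: Q_def)
          moreover have "norm ((1 / t) *\<^sub>R w) \<le> real ?n * s / 2"
            using True by (intro cube_norm_le) (simp add: Q_def)
          then have "a \<le> t" using t s n by (simp add: a_def field_simps)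
          ultimately show ?thesis using True by (simp add: k_def mult_ac)
        next
          case False
          then show ?thesis by (auto simp: k_def)
        qed
      qed
      also have "\<dots> = (\<integral>\<^sup>+t. ennreal (1 / t ^ 3) * indicator {a..} t \<partial>lborel) * (ennreal ((norm w)\<^sup>2) * (g w * indicator Q w))"
        by (rule nn_integral_multc) measurable
      also have "\<dots> = ennreal (1 / (2 * a\<^sup>2)) * ennreal ((norm w)\<^sup>2) * (g w * indicator Q w)"
        by (simp add: nn_integral_inverse_cube[OF a] mult.assoc)
      also have "ennreal (1 / (2 * a\<^sup>2)) * ennreal ((norm w)\<^sup>2) = ennreal ((real ?n * s)\<^sup>2 / 8)"
        using False s n by (simp add: a_def field_simps power_mult_distrib flip: ennreal_mult)
      finally show ?thesis .
    qed
  qed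
  also have "\<dots> = ennreal ((real ?n * s)\<^sup>2 / 8) * (\<integral>\<^sup>+w. g w * indicator Q w \<partial>lborel)"
    by (rule nn_integral_cmult) measurable
  finally show ?thesis by (simp add: g_def Q_def mult_left_mono)
qed

section \<open>Leaving the domain near its boundary\<close>

lemma graph_direction:
  fixes \<Omega> :: "(real^'n) set"
  assumes "local_graph \<Omega> x0 r \<psi>" and G: "\<And>y. GDERIV \<psi> y :> G y" "\<And>y. norm (G y) \<le> B"
  shows "\<exists>e. norm e = 1 \<and> (\<forall>x y s. y \<in> frontier \<Omega> \<and> y \<in> ball x0 r \<and> dist x y \<le> s \<and>
      x - ((B + 1) * s) *\<^sub>R e \<in> ball x0 r \<longrightarrow> x - ((B + 1) * s) *\<^sub>R e \<notin> \<Omega>)"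
proof -
  obtain Q a j where Q: "orthogonal_transformation Q"
    and inv: "\<And>y t. \<psi> (y + t *\<^sub>R axis j 1) = \<psi> y"
    and gr: "ball x0 r \<inter> \<Omega> = ball x0 r \<inter> {z. Q (z - a) $ j > \<psi> (Q (z - a))}"
    and fr: "ball x0 r \<inter> frontier \<Omega> = ball x0 r \<inter> {z. Q (z - a) $ j = \<psi> (Q (z - a))}"
    using assms(1) unfolding local_graph_def by blast
  have lin: "linear Q" using Q by (simp add: orthogonal_transformation_def)
  obtain e where e: "Q e = axis j 1"
    using orthogonal_transformation_surj[OF Q] by (metis surjD)
  have ne: "norm e = 1"
    using orthogonal_transformation_norm[OF Q, of e] by (simp add: e norm_axis_1)
  have B: "B \<ge> 0" using G(2)[of 0] norm_ge_zero order_trans by blast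
  have lip: "\<bar>\<psi> y - \<psi> z\<bar> \<le> B * norm (y - z)" for y z
  proof -
    have "norm (\<psi> y - \<psi> z) \<le> B * norm (y - z)"
    proof (rule differentiable_bound[of UNIV])
      fix v
      show "(\<psi> has_derivative (\<lambda>h. h \<bullet> G v)) (at v within UNIV)"
        using G(1)[of v] by (simp add: gderiv_def)
      show "onorm (\<lambda>h. h \<bullet> G v) \<le> B"
      proof (rule onorm_bound[OF B])
        show "norm (h \<bullet> G v) \<le> B * norm h" for h
          using Cauchy_Schwarz_ineq2[of h "G v"] mult_right_mono[OF G(2)[of v] norm_ge_zero[of h]]
          by (simp add: mult.commute)
      qed
    qed auto
    then show ?thesis by simp
  qed
  have "x - ((B + 1) * s) *\<^sub>R e \<notin> \<Omega>"
    if y: "y \<in> frontier \<Omega>" "y \<in> ball x0 r" and d: "dist x y \<le> s"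
      and w: "x - ((B + 1) * s) *\<^sub>R e \<in> ball x0 r" for x y s
  proof
    let ?w = "x - ((B + 1) * s) *\<^sub>R e"
    assume "?w \<in> \<Omega>"
    then have 1: "Q (?w - a) $ j > \<psi> (Q (?w - a))" using gr w by blast
    have "?w - a = (x - a) + (- ((B + 1) * s)) *\<^sub>R e" by simp
    then have Qw: "Q (?w - a) = Q (x - a) + (- ((B + 1) * s)) *\<^sub>R axis j 1"
      by (simp only: linear_add[OF lin] linear_cmul[OF lin] e)
    have 2: "Q (x - a) $ j - (B + 1) * s > \<psi> (Q (x - a))"
      using 1 unfolding Qw inv by (simp add: axis_def)
    have 3: "Q (y - a) $ j = \<psi> (Q (y - a))" using fr y by blast
    have "Q (x - a) - Q (y - a) = Q (x - y)"
      using linear_diff[OF lin, of "x - a" "y - a"] by simp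
    then have n: "norm (Q (x - a) - Q (y - a)) \<le> s"
      using d orthogonal_transformation_norm[OF Q] by (simp add: dist_norm)
    have "\<bar>Q (x - a) $ j - Q (y - a) $ j\<bar> \<le> s"
      using component_le_norm_cart[of "Q (x - a) - Q (y - a)" j] n by simp
    moreover have "\<bar>\<psi> (Q (x - a)) - \<psi> (Q (y - a))\<bar> \<le> B * s"
      using lip[of "Q (x - a)" "Q (y - a)"] mult_left_mono[OF n B] by linarith
    \<comment> \<open>Since y lies on the graph, the height of x above the graph is at most s from
      the vertical distance plus B s from the variation of \<open>\<psi>\<close>. A descent by (B +
      1) s therefore ends on or below the graph, whereas points of the domain lie strictly above
      it.\<close>
    ultimately show False using 2 3 by (simp add: algebra_simps)
  qed
  then show ?thesis using ne by blast
qed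

text \<open>The directions are the vertical axes of the finitely many graphs that describe the
  boundary; moving down by \<open>B + 1\<close> times the distance to the graph passes below it.\<close>

lemma exit_directions:
  fixes \<Omega> :: "(real^'n) set"
  assumes "bounded_C1_domain \<Omega>"
  obtains E L s0 where "finite E" "\<And>e. e \<in> E \<Longrightarrow> norm e = 1" "s0 > 0"
    "\<And>s x y. \<lbrakk>0 < s; s \<le> s0; x \<in> \<Omega>; y \<notin> \<Omega>; dist x y \<le> s\<rbrakk> \<Longrightarrow> \<exists>e\<in>E. x - (L * s) *\<^sub>R e \<notin> \<Omega>"
proof -
  obtain N :: nat and B r0 :: real and xs :: "nat \<Rightarrow> real^'n" where B: "B > 0" and r0: "r0 > 0"
    and cover: "frontier \<Omega> \<subseteq> (\<Union>i<N. ball (xs i) r0)"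
    and graphs: "\<forall>i<N. \<exists>\<psi> G. local_graph \<Omega> (xs i) (10 * r0) \<psi> \<and> (\<forall>y. GDERIV \<psi> y :> G y) \<and>
      (\<forall>y. norm (G y) \<le> B)"
    using assms unfolding bounded_C1_domain_def uniform_C1_boundaries_def by meson
  have "\<forall>i\<in>{..<N}. \<exists>e. norm e = 1 \<and> (\<forall>x y s. y \<in> frontier \<Omega> \<and> y \<in> ball (xs i) (10 * r0) \<and>
      dist x y \<le> s \<and> x - ((B + 1) * s) *\<^sub>R e \<in> ball (xs i) (10 * r0) \<longrightarrow> x - ((B + 1) * s) *\<^sub>R e \<notin> \<Omega>)"
  proof
    fix i assume "i \<in> {..<N}"
    then obtain \<psi> G where "local_graph \<Omega> (xs i) (10 * r0) \<psi>" "\<And>y. GDERIV \<psi> y :> G y" "\<And>y. norm (G y) \<le> B"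
      using graphs by blast
    then show "\<exists>e. norm e = 1 \<and> (\<forall>x y s. y \<in> frontier \<Omega> \<and> y \<in> ball (xs i) (10 * r0) \<and>
      dist x y \<le> s \<and> x - ((B + 1) * s) *\<^sub>R e \<in> ball (xs i) (10 * r0) \<longrightarrow> x - ((B + 1) * s) *\<^sub>R e \<notin> \<Omega>)"
      by (rule graph_direction)
  qed
  from bchoice[OF this] obtain e where e: "\<forall>i\<in>{..<N}. norm (e i) = 1 \<and>
      (\<forall>x y s. y \<in> frontier \<Omega> \<and> y \<in> ball (xs i) (10 * r0) \<and> dist x y \<le> s \<and>
        x - ((B + 1) * s) *\<^sub>R e i \<in> ball (xs i) (10 * r0) \<longrightarrow> x - ((B + 1) * s) *\<^sub>R e i \<notin> \<Omega>)"
    by blast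
  then have e1: "norm (e i) = 1" if "i < N" for i using that by blast
  have e2: "x - ((B + 1) * s) *\<^sub>R e i \<notin> \<Omega>"
    if "i < N" "y \<in> frontier \<Omega>" "y \<in> ball (xs i) (10 * r0)" "dist x y \<le> s"
      "x - ((B + 1) * s) *\<^sub>R e i \<in> ball (xs i) (10 * r0)" for i x y s
    using e that by blast
  have "\<exists>v\<in>e ` {..<N}. x - ((B + 1) * s) *\<^sub>R v \<notin> \<Omega>"
    if s: "0 < s" "s \<le> r0 / (B + 2)" and x: "x \<in> \<Omega>" and y: "y \<notin> \<Omega>" and d: "dist x y \<le> s" for s x y
  proof -
    \<comment> \<open>The given y need not lie on the boundary, but the segment from x to y crosses
      it at a point no farther from x than y is.\<close>
    have "closed_segment x y \<inter> frontier \<Omega> \<noteq> {}"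
      using x y by (intro connected_Int_frontier) auto
    then obtain q where q: "q \<in> closed_segment x y" "q \<in> frontier \<Omega>" by blast
    have xq: "dist x q \<le> s"
      using segment_bound(1)[OF q(1)] d by (simp add: dist_norm norm_minus_commute)
    obtain i where i: "i < N" "q \<in> ball (xs i) r0" using cover q(2) by blast
    \<comment> \<open>The threshold \<open>r0 / (B + 2)\<close> accounts for the distance s from q
      to x and the shift (B + 1) s: the shifted point stays within 2 r0 of the centre, well inside
      the ball of radius 10 r0 where the graph describes the domain.\<close>
    have Bs: "(B + 2) * s \<le> r0" using s B by (simp add: field_simps)
    have "dist (xs i) (x - ((B + 1) * s) *\<^sub>R e i) \<le> dist (xs i) q + dist q x + (B + 1) * s"
    proof -
      have "dist x (x - ((B + 1) * s) *\<^sub>R e i) = (B + 1) * s"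
        using e1[OF i(1)] B s by (simp add: dist_norm)
      then show ?thesis
        using dist_triangle[of "xs i" "x - ((B + 1) * s) *\<^sub>R e i" x] dist_triangle[of "xs i" x q]
        by linarith
    qed
    also have "\<dots> < r0 + s + (B + 1) * s" using i(2) xq by (simp add: dist_commute)
    also have "\<dots> \<le> 10 * r0" using Bs r0 by (simp add: algebra_simps)
    finally have "x - ((B + 1) * s) *\<^sub>R e i \<in> ball (xs i) (10 * r0)" by simp
    moreover have "q \<in> ball (xs i) (10 * r0)" using i(2) r0 by simp
    ultimately have "x - ((B + 1) * s) *\<^sub>R e i \<notin> \<Omega>"
      using e2[OF i(1) q(2) _ xq] by blast
    then show ?thesis using i(1) by blast
  qed
  moreover have "r0 / (B + 2) > 0" using r0 B by simp
  moreover have "\<And>v. v \<in> e ` {..<N} \<Longrightarrow> norm v = 1" using e1 by auto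
  ultimately show ?thesis using that[of "e ` {..<N}" "r0 / (B + 2)" "B + 1"] by blast
qed

section \<open>Lattice cells and the perforated domain\<close>

definition interior_cells :: "(real^'n) set \<Rightarrow> real \<Rightarrow> (int^'n) set" where
  "interior_cells \<Omega> \<epsilon> = {k. (\<lambda>y. \<epsilon> *\<^sub>R (lattice_point k + y)) ` unit_cell \<subseteq> \<Omega>}"

text \<open>Finiteness makes the union of the closed holes closed, hence the perforated domain open,
  and lets the estimates on the cells be summed.\<close>

lemma finite_interior_cells:
  fixes \<Omega> :: "(real^'n) set"
  assumes "bounded \<Omega>" "\<epsilon> > 0"
  shows "finite (interior_cells \<Omega> \<epsilon>)"
proof -
  obtain R where R: "\<And>x. x \<in> \<Omega> \<Longrightarrow> norm x \<le> R" using assms(1) unfolding bounded_iff by blast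
  define m where "m = \<lceil>R / \<epsilon>\<rceil>"
  have "interior_cells \<Omega> \<epsilon> \<subseteq> vec_lambda ` (UNIV \<rightarrow>\<^sub>E {- m..m})"
  proof
    fix k assume k: "k \<in> interior_cells \<Omega> \<epsilon>"
    have "(0 :: real^'n) \<in> unit_cell" by (simp add: unit_cell_def)
    then have "\<epsilon> *\<^sub>R (lattice_point k + 0) \<in> \<Omega>" using k unfolding interior_cells_def by blast
    then have n: "norm (\<epsilon> *\<^sub>R lattice_point k) \<le> R" using R by fastforce
    have "\<bar>k $ i\<bar> \<le> m" for i
    proof -
      have "\<bar>(\<epsilon> *\<^sub>R lattice_point k) $ i\<bar> \<le> R"
        using component_le_norm_cart n by (rule order_trans)
      then have "\<epsilon> * \<bar>real_of_int (k $ i)\<bar> \<le> R"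
        using assms(2) by (simp add: lattice_point_def abs_mult)
      then have "\<bar>real_of_int (k $ i)\<bar> \<le> R / \<epsilon>" using assms(2) by (simp add: field_simps)
      then show ?thesis unfolding m_def by linarith
    qed
    then have "vec_nth k \<in> UNIV \<rightarrow>\<^sub>E {- m..m}" by (auto simp: abs_le_iff minus_le_iff)
    then show "k \<in> vec_lambda ` (UNIV \<rightarrow>\<^sub>E {- m..m})"
      by (metis image_eqI vec_nth_inverse)
  qed
  moreover have "finite (UNIV \<rightarrow>\<^sub>E {- m..m} :: ('n \<Rightarrow> int) set)" by (intro finite_PiE) auto
  ultimately show ?thesis by (meson finite_imageI finite_subset)
qed

lemma perforated_alt:
  "perforated \<Omega> T \<epsilon> \<eta> =
    \<Omega> - (\<Union>k\<in>interior_cells \<Omega> \<epsilon>. (\<lambda>y. \<epsilon> *\<^sub>R (lattice_point k + \<eta> *\<^sub>R y)) ` T k)"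
  by (simp add: perforated_def interior_cells_def)

lemma bounded_unit_cell: "bounded (unit_cell :: (real^'n) set)"
proof -
  have "norm x \<le> real CARD('n) / 2" if "x \<in> unit_cell" for x :: "real^'n"
  proof -
    have "norm x \<le> (\<Sum>i\<in>UNIV. \<bar>x $ i\<bar>)" by (rule norm_le_l1_cart)
    also have "\<dots> \<le> (\<Sum>i::'n\<in>UNIV. 1 / 2)"
      using that by (intro sum_mono) (simp add: unit_cell_def)
    finally show ?thesis by simp
  qed
  then show ?thesis unfolding bounded_iff by blast
qed

lemma bounded_open_set_perforated:
  fixes \<Omega> :: "(real^'n) set"
  assumes "open \<Omega>" "bounded \<Omega>" "\<epsilon> > 0" "admissible_holes c0 T"
  shows "bounded_open_set (perforated \<Omega> T \<epsilon> \<eta>)"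
proof
  have "closed ((\<lambda>y. \<epsilon> *\<^sub>R (lattice_point k + \<eta> *\<^sub>R y)) ` T k)" for k
  proof -
    have "closed (T k)" "T k \<subseteq> unit_cell" using assms(4) by (auto simp: admissible_holes_def)
    then have "compact (T k)"
      using bounded_unit_cell bounded_subset compact_eq_bounded_closed by blast
    then show ?thesis by (intro compact_imp_closed compact_continuous_image continuous_intros)
  qed
  then show "open (perforated \<Omega> T \<epsilon> \<eta>)"
    unfolding perforated_alt using assms finite_interior_cells
    by (intro open_Diff closed_UN) auto
  show "bounded (perforated \<Omega> T \<epsilon> \<eta>)"
    using assms(2) by (rule bounded_subset) (auto simp: perforated_alt)
qed

text \<open>Coordinatewise rounding of x / \<epsilon> to the nearest integer, with ties rounded up
  to match the half-open \<open>cube\<close>.\<close>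

definition cell_index :: "real \<Rightarrow> real^'n \<Rightarrow> int^'n" where
  "cell_index \<epsilon> x = (\<chi> i. \<lfloor>x $ i / \<epsilon> + 1 / 2\<rfloor>)"

lemma cell_index_iff:
  assumes "\<epsilon> > 0"
  shows "x - \<epsilon> *\<^sub>R lattice_point k \<in> cube \<epsilon> \<longleftrightarrow> k = cell_index \<epsilon> x"
proof -
  have "- \<epsilon> / 2 \<le> x $ i - \<epsilon> * real_of_int (k $ i) \<and> x $ i - \<epsilon> * real_of_int (k $ i) < \<epsilon> / 2
      \<longleftrightarrow> k $ i = \<lfloor>x $ i / \<epsilon> + 1 / 2\<rfloor>" for i
  proof -
    have "- \<epsilon> / 2 \<le> x $ i - \<epsilon> * real_of_int (k $ i) \<longleftrightarrow> real_of_int (k $ i) \<le> x $ i / \<epsilon> + 1 / 2"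
      "x $ i - \<epsilon> * real_of_int (k $ i) < \<epsilon> / 2 \<longleftrightarrow> x $ i / \<epsilon> + 1 / 2 < real_of_int (k $ i) + 1"
      using assms by (auto simp: field_simps)
    then show ?thesis using floor_eq_iff[of "x $ i / \<epsilon> + 1 / 2" "k $ i"] by auto
  qed
  then show ?thesis by (simp add: cube_def lattice_point_def cell_index_def vec_eq_iff)
qed

text \<open>At each point the square of \<open>\<phi>\<close> is dominated either by its value on
  the interior cell of the point or by the squared increment in one exit direction. Summing over all
  directions instead of selecting one costs the factor \<open>card E\<close> but needs no measurable
  choice.\<close>

lemma perforated_poincare_nn:
  fixes \<Omega> :: "(real^'n) set" and E :: "(real^'n) set"
  assumes \<phi>: "\<phi> \<in> test_functions (perforated \<Omega> T \<epsilon> \<eta>)"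
    and \<Omega>: "bounded \<Omega>" and \<epsilon>: "0 < \<epsilon>" and \<eta>: "0 < \<eta>" "\<eta> \<le> 1"
    and n: "n = real CARD('n)" "n \<ge> 2"
    and E: "finite E" "\<And>e. e \<in> E \<Longrightarrow> norm e = 1"
    and exit: "\<And>x y. \<lbrakk>x \<in> \<Omega>; y \<notin> \<Omega>; dist x y \<le> n * \<epsilon>\<rbrakk> \<Longrightarrow> \<exists>e\<in>E. x - (L * (n * \<epsilon>)) *\<^sub>R e \<notin> \<Omega>"
    and c: "0 < c" "c \<le> 1" and T: "\<And>k. ball 0 c \<subseteq> T k"
    and \<Lambda>: "integral {\<eta> * c / n..1} (\<lambda>t. 1 / t ^ (CARD('n) - 1)) \<le> \<Lambda>"
  shows "(\<integral>\<^sup>+x. ennreal ((\<phi> x)\<^sup>2) \<partial>lborel) \<le>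
    ennreal (real (card E) * (L * (n * \<epsilon>))\<^sup>2 + \<Lambda> * ((n * \<epsilon>)\<^sup>2 / 8)) *
      (\<integral>\<^sup>+x. ennreal ((norm (grad \<phi> x))\<^sup>2) \<partial>lborel)"
proof -
  have sm: "smooth \<phi>" using \<phi> test_functions_smooth by blast
  define z :: "int^'n \<Rightarrow> real^'n" where "z k = \<epsilon> *\<^sub>R lattice_point k" for k
  define K where "K = interior_cells \<Omega> \<epsilon>"
  have K: "finite K" using finite_interior_cells[OF \<Omega> \<epsilon>] by (simp add: K_def)
  define G where "G = (\<integral>\<^sup>+x. ennreal ((norm (grad \<phi> x))\<^sup>2) \<partial>lborel)"
  have [measurable]: "\<phi> \<in> borel_measurable borel" using sm by (rule measurable_smooth)
  have [measurable]: "(\<lambda>x. ennreal ((norm (grad \<phi> x))\<^sup>2)) \<in> borel_measurable borel"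
    using sm by (rule measurable_grad_square)
  let ?s = "L * (n * \<epsilon>)"
  have \<tau>: "0 < \<eta> * c / n" using \<eta> c n by simp
  have "\<eta> * c \<le> 1 * 1" using \<eta> c by (intro mult_mono) auto
  then have \<tau>1: "\<eta> * c / n \<le> 1" using n by (simp add: field_simps)
  have \<Lambda>0: "\<Lambda> \<ge> 0"
  proof -
    have "(\<lambda>t. 1 / t ^ (CARD('n) - 1)) integrable_on {\<eta> * c / n..1}"
      using \<tau> by (intro integrable_continuous_real continuous_intros) auto
    then have "integral {\<eta> * c / n..1} (\<lambda>t. 1 / t ^ (CARD('n) - 1)) \<ge> 0"
      using \<tau> by (intro integral_nonneg) auto
    then show ?thesis using \<Lambda> by linarith
  qed

  have pw: "ennreal ((\<phi> x)\<^sup>2) \<le> (\<Sum>e\<in>E. ennreal ((\<phi> (x + - ?s *\<^sub>R e) - \<phi> x)\<^sup>2)) +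
      (\<Sum>k\<in>K. ennreal ((\<phi> x)\<^sup>2) * indicator (cube \<epsilon>) (x - z k))" for x
  proof (cases "x \<in> perforated \<Omega> T \<epsilon> \<eta>")
    case False
    then show ?thesis using test_functions_outside(1)[OF \<phi>] by simp
  next
    case True
    then have x: "x \<in> \<Omega>" by (simp add: perforated_alt)
    define k where "k = cell_index \<epsilon> x"
    have xk: "x - z k \<in> cube \<epsilon>" using cell_index_iff[OF \<epsilon>, of x "cell_index \<epsilon> x"] by (simp add: k_def z_def)
    show ?thesis
    proof (cases "k \<in> K")
      case True
      have "ennreal ((\<phi> x)\<^sup>2) = ennreal ((\<phi> x)\<^sup>2) * indicator (cube \<epsilon>) (x - z k)" using xk by simp
      also have "\<dots> \<le> (\<Sum>k\<in>K. ennreal ((\<phi> x)\<^sup>2) * indicator (cube \<epsilon>) (x - z k))"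
        using True K by (intro member_le_sum) auto
      finally show ?thesis by (rule order_trans) simp
    next
      case False
      \<comment> \<open>A cell outside \<open>K\<close> contains a point off \<Omega>. Each
        coordinate of its difference from x is at most \<epsilon>, so the distance is at most n
        \<epsilon>, the scale at which \<open>exit\<close> is available.\<close>
      then obtain y where y: "y \<in> unit_cell" "\<epsilon> *\<^sub>R (lattice_point k + y) \<notin> \<Omega>"
        by (auto simp: K_def interior_cells_def)
      have "norm (x - \<epsilon> *\<^sub>R (lattice_point k + y)) \<le> (\<Sum>i\<in>UNIV. \<bar>(x - \<epsilon> *\<^sub>R (lattice_point k + y)) $ i\<bar>)"
        by (rule norm_le_l1_cart)
      also have "\<dots> \<le> (\<Sum>i::'n\<in>UNIV. \<epsilon>)"
      proof (rule sum_mono)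
        fix i
        have 1: "- \<epsilon> / 2 \<le> (x - z k) $ i" "(x - z k) $ i < \<epsilon> / 2" using xk by (auto simp: cube_def)
        have "\<bar>\<epsilon> * y $ i\<bar> \<le> \<epsilon> * (1 / 2)"
          using y(1) \<epsilon> unfolding abs_mult by (intro mult_mono) (auto simp: unit_cell_def)
        then show "\<bar>(x - \<epsilon> *\<^sub>R (lattice_point k + y)) $ i\<bar> \<le> \<epsilon>"
          using 1 by (simp add: z_def distrib_left)
      qed
      finally have "dist x (\<epsilon> *\<^sub>R (lattice_point k + y)) \<le> n * \<epsilon>" by (simp add: dist_norm n)
      then obtain e where e: "e \<in> E" "x - ?s *\<^sub>R e \<notin> \<Omega>" using exit[OF x y(2)] by blast
      have "x - ?s *\<^sub>R e \<notin> perforated \<Omega> T \<epsilon> \<eta>" using e(2) by (simp add: perforated_alt)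
      then have "\<phi> (x + - ?s *\<^sub>R e) = 0" using test_functions_outside(1)[OF \<phi>] by simp
      then have "ennreal ((\<phi> x)\<^sup>2) = ennreal ((\<phi> (x + - ?s *\<^sub>R e) - \<phi> x)\<^sup>2)" by simp
      also have "\<dots> \<le> (\<Sum>e\<in>E. ennreal ((\<phi> (x + - ?s *\<^sub>R e) - \<phi> x)\<^sup>2))"
        using e(1) E(1) by (intro member_le_sum) auto
      finally show ?thesis by (rule order_trans) simp
    qed
  qed

  have edge: "(\<integral>\<^sup>+x. ennreal ((\<phi> (x + - ?s *\<^sub>R e) - \<phi> x)\<^sup>2) \<partial>lborel) \<le> ennreal (?s\<^sup>2) * G" if "e \<in> E" for e
    using translation_bound[OF sm, of "- ?s *\<^sub>R e"] E(2)[OF that] by (simp add: G_def)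
  have cell: "(\<integral>\<^sup>+x. ennreal ((\<phi> x)\<^sup>2) * indicator (cube \<epsilon>) (x - z k) \<partial>lborel)
      \<le> ennreal (\<Lambda> * ((n * \<epsilon>)\<^sup>2 / 8)) *
        (\<integral>\<^sup>+x. ennreal ((norm (grad \<phi> x))\<^sup>2) * indicator (cube \<epsilon>) (x - z k) \<partial>lborel)" if k: "k \<in> K" for k
  proof -
    have tr: "(\<integral>\<^sup>+x. f x * indicator (cube \<epsilon>) (x - z k) \<partial>lborel) = (\<integral>\<^sup>+y. f (z k + y) * indicator (cube \<epsilon>) y \<partial>lborel)"
      if [measurable]: "f \<in> borel_measurable borel" for f :: "real^'n \<Rightarrow> ennreal"
      using nn_integral_translate[of "\<lambda>x. f x * indicator (cube \<epsilon>) (x - z k)" "z k"] by simp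
    have "\<phi> (z k + y) = 0" if "norm y < \<epsilon> * \<eta> * c" for y
    proof (rule test_functions_outside(1)[OF \<phi>])
      have "norm ((1 / (\<epsilon> * \<eta>)) *\<^sub>R y) < c" using that \<epsilon> \<eta> by (simp add: field_simps)
      then have "(1 / (\<epsilon> * \<eta>)) *\<^sub>R y \<in> T k" using T[of k] by (auto simp: subset_iff)
      moreover have "z k + y = \<epsilon> *\<^sub>R (lattice_point k + \<eta> *\<^sub>R ((1 / (\<epsilon> * \<eta>)) *\<^sub>R y))"
        using \<epsilon> \<eta> by (simp add: z_def scaleR_add_right)
      ultimately show "z k + y \<notin> perforated \<Omega> T \<epsilon> \<eta>"
        using k unfolding perforated_alt K_def by blast
    qed
    \<comment> \<open>Shrinking the cell by \<eta> c / n puts it inside the ball of radius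
      \<epsilon> \<eta> c / 2, hence strictly inside the hole: rays may start there with value
      zero.\<close>
    moreover have "\<eta> * c / n * (real CARD('n) * \<epsilon> / 2) < \<epsilon> * \<eta> * c"
      using n \<epsilon> \<eta> c by simp
    ultimately have "(\<integral>\<^sup>+y. ennreal ((\<phi> (z k + y))\<^sup>2) * indicator (cube \<epsilon>) y \<partial>lborel)
      \<le> ennreal \<Lambda> * (ennreal ((real CARD('n) * \<epsilon>)\<^sup>2 / 8) *
        (\<integral>\<^sup>+y. ennreal ((norm (grad \<phi> (z k + y)))\<^sup>2) * indicator (cube \<epsilon>) y \<partial>lborel))"
      using sm \<epsilon> \<tau> \<tau>1 \<Lambda> by (intro cell_bound) auto
    also have "\<dots> = ennreal (\<Lambda> * ((n * \<epsilon>)\<^sup>2 / 8)) *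
        (\<integral>\<^sup>+y. ennreal ((norm (grad \<phi> (z k + y)))\<^sup>2) * indicator (cube \<epsilon>) y \<partial>lborel)"
      using ennreal_mult[OF \<Lambda>0, of "(n * \<epsilon>)\<^sup>2 / 8"] by (simp add: mult.assoc flip: n(1))
    finally have *: "(\<integral>\<^sup>+y. ennreal ((\<phi> (z k + y))\<^sup>2) * indicator (cube \<epsilon>) y \<partial>lborel)
      \<le> ennreal (\<Lambda> * ((n * \<epsilon>)\<^sup>2 / 8)) *
        (\<integral>\<^sup>+y. ennreal ((norm (grad \<phi> (z k + y)))\<^sup>2) * indicator (cube \<epsilon>) y \<partial>lborel)" .
    have m: "(\<lambda>x. ennreal ((\<phi> x)\<^sup>2)) \<in> borel_measurable borel"
      "(\<lambda>x. ennreal ((norm (grad \<phi> x))\<^sup>2)) \<in> borel_measurable borel"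
      by measurable
    show ?thesis unfolding tr[OF m(1)] tr[OF m(2)] by (rule *)
  qed
  \<comment> \<open>Each point lies in exactly one half-open cube, so the sum over k has at most one
    nonzero term and the constant does not grow with the number of cells.\<close>
  have disjoint: "(\<Sum>k\<in>K. \<integral>\<^sup>+x. ennreal ((norm (grad \<phi> x))\<^sup>2) * indicator (cube \<epsilon>) (x - z k) \<partial>lborel) \<le> G"
  proof -
    have "(\<Sum>k\<in>K. \<integral>\<^sup>+x. ennreal ((norm (grad \<phi> x))\<^sup>2) * indicator (cube \<epsilon>) (x - z k) \<partial>lborel)
        = (\<integral>\<^sup>+x. (\<Sum>k\<in>K. ennreal ((norm (grad \<phi> x))\<^sup>2) * indicator (cube \<epsilon>) (x - z k)) \<partial>lborel)"
      by (rule nn_integral_sum[symmetric]) measurable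
    also have "\<dots> \<le> G"
      unfolding G_def
    proof (rule nn_integral_mono)
      fix x
      have "(\<Sum>k\<in>K. ennreal ((norm (grad \<phi> x))\<^sup>2) * indicator (cube \<epsilon>) (x - z k))
          = (\<Sum>k\<in>K. if k = cell_index \<epsilon> x then ennreal ((norm (grad \<phi> x))\<^sup>2) else 0)"
        using cell_index_iff[OF \<epsilon>, of x] by (intro sum.cong) (auto simp: z_def indicator_def)
      also have "\<dots> \<le> ennreal ((norm (grad \<phi> x))\<^sup>2)" using K by simp
      finally show "(\<Sum>k\<in>K. ennreal ((norm (grad \<phi> x))\<^sup>2) * indicator (cube \<epsilon>) (x - z k))
        \<le> ennreal ((norm (grad \<phi> x))\<^sup>2)" .
    qed
    finally show ?thesis .
  qed

  have "(\<integral>\<^sup>+x. ennreal ((\<phi> x)\<^sup>2) \<partial>lborel) \<le> (\<integral>\<^sup>+x. (\<Sum>e\<in>E. ennreal ((\<phi> (x + - ?s *\<^sub>R e) - \<phi> x)\<^sup>2)) +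
      (\<Sum>k\<in>K. ennreal ((\<phi> x)\<^sup>2) * indicator (cube \<epsilon>) (x - z k)) \<partial>lborel)"
    using pw by (rule nn_integral_mono)
  also have "\<dots> = (\<integral>\<^sup>+x. (\<Sum>e\<in>E. ennreal ((\<phi> (x + - ?s *\<^sub>R e) - \<phi> x)\<^sup>2)) \<partial>lborel) +
      (\<integral>\<^sup>+x. (\<Sum>k\<in>K. ennreal ((\<phi> x)\<^sup>2) * indicator (cube \<epsilon>) (x - z k)) \<partial>lborel)"
    by (rule nn_integral_add) measurable
  also have "(\<integral>\<^sup>+x. (\<Sum>e\<in>E. ennreal ((\<phi> (x + - ?s *\<^sub>R e) - \<phi> x)\<^sup>2)) \<partial>lborel)
      = (\<Sum>e\<in>E. \<integral>\<^sup>+x. ennreal ((\<phi> (x + - ?s *\<^sub>R e) - \<phi> x)\<^sup>2) \<partial>lborel)"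
    by (rule nn_integral_sum) measurable
  also have "(\<integral>\<^sup>+x. (\<Sum>k\<in>K. ennreal ((\<phi> x)\<^sup>2) * indicator (cube \<epsilon>) (x - z k)) \<partial>lborel)
      = (\<Sum>k\<in>K. \<integral>\<^sup>+x. ennreal ((\<phi> x)\<^sup>2) * indicator (cube \<epsilon>) (x - z k) \<partial>lborel)"
    by (rule nn_integral_sum) measurable
  also have "(\<Sum>e\<in>E. \<integral>\<^sup>+x. ennreal ((\<phi> (x + - ?s *\<^sub>R e) - \<phi> x)\<^sup>2) \<partial>lborel) +
      (\<Sum>k\<in>K. \<integral>\<^sup>+x. ennreal ((\<phi> x)\<^sup>2) * indicator (cube \<epsilon>) (x - z k) \<partial>lborel)
    \<le> (\<Sum>e\<in>E. ennreal (?s\<^sup>2) * G) + (\<Sum>k\<in>K. ennreal (\<Lambda> * ((n * \<epsilon>)\<^sup>2 / 8)) *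
        (\<integral>\<^sup>+x. ennreal ((norm (grad \<phi> x))\<^sup>2) * indicator (cube \<epsilon>) (x - z k) \<partial>lborel))"
    using edge cell by (intro add_mono sum_mono) auto
  also have "\<dots> \<le> ennreal (real (card E) * ?s\<^sup>2) * G + ennreal (\<Lambda> * ((n * \<epsilon>)\<^sup>2 / 8)) * G"
    using disjoint
    by (intro add_mono) (auto simp: ennreal_mult ennreal_of_nat_eq_real_of_nat mult.assoc mult_left_mono
        simp flip: sum_distrib_left)
  also have "\<dots> = ennreal (real (card E) * ?s\<^sup>2 + \<Lambda> * ((n * \<epsilon>)\<^sup>2 / 8)) * G"
    using \<Lambda>0 by (simp add: ennreal_plus distrib_right)
  finally show ?thesis by (simp add: G_def)
qed

section \<open>The weight integral as a function of the hole size\<close>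

lemma weight_integral_le:
  assumes "m \<ge> 2" "0 < \<tau>" "\<tau> \<le> 1"
  shows "integral {\<tau>..1} (\<lambda>t. 1 / t ^ (m - 1)) \<le> (if m \<ge> 3 then \<tau> powr (2 - real m) else - ln \<tau>)"
proof (cases "m \<ge> 3")
  case True
  have "((\<lambda>t. 1 / t ^ (m - 1)) has_integral (1 powr (2 - real m) / (2 - real m) - \<tau> powr (2 - real m) / (2 - real m))) {\<tau>..1}"
  proof (rule fundamental_theorem_of_calculus)
    fix t assume "t \<in> {\<tau>..1}"
    then have t: "t > 0" using assms by simp
    have "((\<lambda>t. t powr (2 - real m) / (2 - real m)) has_real_derivative
        ((2 - real m) * t powr (2 - real m - 1)) / (2 - real m)) (at t)"
      by (intro DERIV_cdivide has_real_derivative_powr t)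
    moreover have "((2 - real m) * t powr (2 - real m - 1)) / (2 - real m) = 1 / t ^ (m - 1)"
    proof -
      have "2 - real m - 1 = - real (m - 1)" using True by simp
      then have "t powr (2 - real m - 1) = 1 / t ^ (m - 1)"
        by (simp only: powr_minus_divide powr_realpow[OF t])
      then show ?thesis using True by simp
    qed
    ultimately show "((\<lambda>t. t powr (2 - real m) / (2 - real m)) has_vector_derivative 1 / t ^ (m - 1)) (at t within {\<tau>..1})"
      by (simp add: has_real_derivative_iff_has_vector_derivative[symmetric] has_field_derivative_at_within)
  qed (use assms in simp)
  then have "integral {\<tau>..1} (\<lambda>t. 1 / t ^ (m - 1)) = (\<tau> powr (2 - real m) - 1) / (real m - 2)"
    using True by (subst integral_unique) (auto simp: field_simps)
  also have "\<dots> \<le> (\<tau> powr (2 - real m) - 1) / 1"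
  proof (rule divide_left_mono)
    have "1 powr (2 - real m) \<le> \<tau> powr (2 - real m)"
      using assms True by (intro powr_mono2') auto
    then show "0 \<le> \<tau> powr (2 - real m) - 1" by simp
  qed (use True in auto)
  finally show ?thesis using True by simp
next
  case False
  then have m: "m = 2" using assms by simp
  have "((\<lambda>t. 1 / t) has_integral (ln 1 - ln \<tau>)) {\<tau>..1}"
  proof (rule fundamental_theorem_of_calculus)
    fix t assume "t \<in> {\<tau>..1}"
    then have "t > 0" using assms by simp
    then show "(ln has_vector_derivative 1 / t) (at t within {\<tau>..1})"
      using DERIV_ln_divide[of t]
      by (simp add: has_real_derivative_iff_has_vector_derivative[symmetric] has_field_derivative_at_within)
  qed (use assms in simp)
  then have "integral {\<tau>..1} (\<lambda>t. 1 / t) = - ln \<tau>" by (simp add: integral_unique)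
  then show ?thesis by (simp add: m)
qed

text \<open>Up to constants, the inverse capacity of a hole of size \<eta> in a unit cell. In
  dimension two the quotient \<eta> / 2 keeps the logarithm away from zero at \<eta> = 1.\<close>

definition hole_factor :: "nat \<Rightarrow> real \<Rightarrow> real" where
  "hole_factor m \<eta> = (if m \<ge> 3 then \<eta> powr (2 - real m) else \<bar>ln (\<eta> / 2)\<bar>)"

text \<open>A positive lower bound independent of \<eta> lets any quantity of order \<epsilon>^2, or
  any constant, be absorbed at the cost of a factor 1 / ln 2.\<close>

lemma hole_factor_ge:
  assumes "m \<ge> 2" "0 < \<eta>" "\<eta> \<le> 1"
  shows "hole_factor m \<eta> \<ge> ln 2"
proof (cases "m \<ge> 3")
  case True
  have "1 powr (2 - real m) \<le> \<eta> powr (2 - real m)"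
    using assms True by (intro powr_mono2') auto
  then show ?thesis using True ln_le_minus_one[of 2] by (simp add: hole_factor_def)
next
  case False
  have "ln (\<eta> / 2) \<le> ln (1 / 2)" using assms by (subst ln_le_cancel_iff) auto
  also have "\<dots> = - ln 2" by (simp add: ln_div)
  finally show ?thesis using False by (simp add: hole_factor_def)
qed

lemma weight_integral_hole_factor:
  assumes m: "m \<ge> 2" and c: "0 < c" "c \<le> 1"
  shows "\<exists>a\<ge>0. \<forall>\<eta>. 0 < \<eta> \<and> \<eta> \<le> 1 \<longrightarrow>
    integral {\<eta> * c / real m..1} (\<lambda>t. 1 / t ^ (m - 1)) \<le> a * hole_factor m \<eta>"
proof -
  \<comment> \<open>The factor c / m between \<eta> and the lower limit separates multiplicatively
    from a power. In a logarithm it splits off additively: m = 2 produces the quotient \<eta> / 2,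
    and the remaining \<open>ln c\<close> is absorbed by the lower bound ln 2 on
    \<open>hole_factor\<close>.\<close>
  define a where "a = (if m \<ge> 3 then (c / real m) powr (2 - real m) else 1 + \<bar>ln c\<bar> / ln 2)"
  have "integral {\<eta> * c / real m..1} (\<lambda>t. 1 / t ^ (m - 1)) \<le> a * hole_factor m \<eta>"
    if \<eta>: "0 < \<eta>" "\<eta> \<le> 1" for \<eta>
  proof -
    let ?\<tau> = "\<eta> * c / real m"
    have "\<eta> * c \<le> 1 * 1" using \<eta> c by (intro mult_mono) auto
    then have "?\<tau> \<le> 1" using m by (simp add: field_simps)
    then have "integral {?\<tau>..1} (\<lambda>t. 1 / t ^ (m - 1)) \<le> (if m \<ge> 3 then ?\<tau> powr (2 - real m) else - ln ?\<tau>)"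
      using m \<eta> c by (intro weight_integral_le) auto
    also have "\<dots> \<le> a * hole_factor m \<eta>"
    proof (cases "m \<ge> 3")
      case True
      have "?\<tau> powr (2 - real m) = (c / real m) powr (2 - real m) * \<eta> powr (2 - real m)"
        using \<eta> c m powr_mult[of \<eta> "c / real m" "2 - real m"] by (simp add: mult.commute)
      then show ?thesis using True by (simp add: a_def hole_factor_def)
    next
      case False
      then have m2: "real m = 2" using m by simp
      have "- ln ?\<tau> = - ln (\<eta> / 2 * c)" by (simp add: m2 field_simps)
      also have "\<dots> = - ln (\<eta> / 2) - ln c" using \<eta> c by (subst ln_mult) auto
      also have "\<dots> \<le> hole_factor m \<eta> + \<bar>ln c\<bar>" using False by (simp add: hole_factor_def)
      also have "\<bar>ln c\<bar> \<le> \<bar>ln c\<bar> / ln 2 * hole_factor m \<eta>"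
        using hole_factor_ge[OF m \<eta>] mult_left_mono[of "ln 2" "hole_factor m \<eta>" "\<bar>ln c\<bar> / ln 2"] by simp
      finally show ?thesis using False by (simp add: a_def distrib_right)
    qed
    finally show ?thesis .
  qed
  moreover have "a \<ge> 0" by (simp add: a_def)
  ultimately show ?thesis by blast
qed

section \<open>The Poincare inequality with constants uniform in the holes\<close>

lemma bounded_poincare_nn:
  fixes U :: "(real^'n) set"
  assumes \<phi>: "\<phi> \<in> test_functions U" and R: "\<And>x. x \<in> U \<Longrightarrow> norm x \<le> R" "R > 0"
  shows "(\<integral>\<^sup>+x. ennreal ((\<phi> x)\<^sup>2) \<partial>lborel) \<le> ennreal ((3 * R)\<^sup>2) *
    (\<integral>\<^sup>+x. ennreal ((norm (grad \<phi> x))\<^sup>2) \<partial>lborel)"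
proof -
  obtain e :: "real^'n" where e: "norm e = 1" using norm_axis_1 by blast
  have "(\<integral>\<^sup>+x. ennreal ((\<phi> x)\<^sup>2) \<partial>lborel) \<le> (\<integral>\<^sup>+x. ennreal ((\<phi> (x + (3 * R) *\<^sub>R e) - \<phi> x)\<^sup>2) \<partial>lborel)"
  proof (intro nn_integral_mono)
    fix x
    show "ennreal ((\<phi> x)\<^sup>2) \<le> ennreal ((\<phi> (x + (3 * R) *\<^sub>R e) - \<phi> x)\<^sup>2)"
    proof (cases "x \<in> U")
      case True
      \<comment> \<open>A shift by 3 R from a point of norm at most R ends at norm at least 2 R,
        hence off \<open>U\<close>.\<close>
      have "norm ((3 * R) *\<^sub>R e) \<le> norm (x + (3 * R) *\<^sub>R e) + norm x"
        using norm_triangle_ineq4[of "x + (3 * R) *\<^sub>R e" x] by simp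
      then have "norm (x + (3 * R) *\<^sub>R e) > R" using R(1)[OF True] R(2) e by simp
      then have "\<phi> (x + (3 * R) *\<^sub>R e) = 0"
        using R(1) by (intro test_functions_outside(1)[OF \<phi>]) fastforce
      then show ?thesis by simp
    qed (simp add: test_functions_outside(1)[OF \<phi>])
  qed
  also have "\<dots> \<le> ennreal ((norm ((3 * R) *\<^sub>R e))\<^sup>2) * (\<integral>\<^sup>+x. ennreal ((norm (grad \<phi> x))\<^sup>2) \<partial>lborel)"
    using \<phi> by (intro translation_bound test_functions_smooth)
  finally show ?thesis using e R(2) by simp
qed

text \<open>Two inequalities hold at once: the one of the bounded set \<Omega>, and one of order
  \<epsilon>^2 \<open>hole_factor\<close>; the minimum takes the better. \<open>C\<close> is fixed
  before the holes, \<epsilon> and \<eta>, so it depends only on the dimension, c0 and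
  \<Omega>.\<close>

lemma perforated_poincare_lborel:
  fixes \<Omega> :: "(real^'n) set"
  assumes n2: "CARD('n) \<ge> 2" and \<Omega>: "bounded_C1_domain \<Omega>" and c0: "c0 > 0"
  shows "\<exists>C>0. \<forall>(T :: int^'n \<Rightarrow> (real^'n) set) \<epsilon> \<eta> \<phi>.
    admissible_holes c0 T \<and> 0 < \<epsilon> \<and> 0 < \<eta> \<and> \<eta> \<le> 1 \<and> \<phi> \<in> test_functions (perforated \<Omega> T \<epsilon> \<eta>) \<longrightarrow>
    (\<integral>\<^sup>+x. ennreal ((\<phi> x)\<^sup>2) \<partial>lborel) \<le> ennreal (C * min 1 (\<epsilon>\<^sup>2 * hole_factor CARD('n) \<eta>)) *
      (\<integral>\<^sup>+x. ennreal ((norm (grad \<phi> x))\<^sup>2) \<partial>lborel)"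
proof -
  obtain E :: "(real^'n) set" and L s0 where E: "finite E" "\<And>e. e \<in> E \<Longrightarrow> norm e = 1" and s0: "s0 > 0"
    and exit: "\<And>s x y. \<lbrakk>0 < s; s \<le> s0; x \<in> \<Omega>; y \<notin> \<Omega>; dist x y \<le> s\<rbrakk> \<Longrightarrow> \<exists>e\<in>E. x - (L * s) *\<^sub>R e \<notin> \<Omega>"
  proof (rule exit_directions[OF \<Omega>])
    fix E :: "(real^'n) set" and L s0
    assume a: "finite E" "\<And>e. e \<in> E \<Longrightarrow> norm e = 1" "s0 > 0"
      "\<And>s x y. \<lbrakk>0 < s; s \<le> s0; x \<in> \<Omega>; y \<notin> \<Omega>; dist x y \<le> s\<rbrakk> \<Longrightarrow> \<exists>e\<in>E. x - (L * s) *\<^sub>R e \<notin> \<Omega>"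
    show thesis by (rule that[OF a])
  qed
  have b\<Omega>: "bounded \<Omega>"
    using \<Omega> by (simp add: bounded_C1_domain_def uniform_C1_boundaries_def bounded_domain_def)
  then obtain R where R: "R > 0" "\<forall>x\<in>\<Omega>. norm x \<le> R" unfolding bounded_pos by blast
  \<comment> \<open>The cap at 1 keeps the lower limit \<eta> c / n of the weight integral below its
    upper limit 1.\<close>
  define c where "c = min c0 1"
  have c: "0 < c" "c \<le> 1" using c0 by (auto simp: c_def)
  define n where "n = real CARD('n)"
  have n: "n \<ge> 2" using n2 by (simp add: n_def)
  obtain a where a0: "a \<ge> 0" and a: "\<forall>\<eta>. 0 < \<eta> \<and> \<eta> \<le> 1 \<longrightarrow>
      integral {\<eta> * c / n..1} (\<lambda>t. 1 / t ^ (CARD('n) - 1)) \<le> a * hole_factor CARD('n) \<eta>"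
    using weight_integral_hole_factor[OF n2 c] unfolding n_def by blast
  \<comment> \<open>\<open>A\<close> is the global constant, \<open>B1\<close> belongs to the exit
    directions, \<open>B2\<close> to the interior cells, and \<open>B3\<close> to values of
    \<epsilon> too large for the exit directions. Division by ln 2 converts bounds that lack
    \<open>hole_factor\<close>.\<close>
  define A where "A = (3 * R)\<^sup>2"
  define B1 where "B1 = real (card E) * (L * n)\<^sup>2 / ln 2"
  define B2 where "B2 = a * (n\<^sup>2 / 8)"
  define B3 where "B3 = A * (n / s0)\<^sup>2 / ln 2"
  have pos: "A > 0" "B1 \<ge> 0" "B2 \<ge> 0" "B3 \<ge> 0"
    using R a0 by (auto simp: A_def B1_def B2_def B3_def)
  define C where "C = A + B1 + B2 + B3"
  have "(\<integral>\<^sup>+x. ennreal ((\<phi> x)\<^sup>2) \<partial>lborel) \<le> ennreal (C * min 1 (\<epsilon>\<^sup>2 * hole_factor CARD('n) \<eta>)) *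
      (\<integral>\<^sup>+x. ennreal ((norm (grad \<phi> x))\<^sup>2) \<partial>lborel)" (is "?I \<le> _ * ?G")
    if T: "admissible_holes c0 T" and \<epsilon>: "0 < \<epsilon>" and \<eta>: "0 < \<eta>" "\<eta> \<le> 1"
      and \<phi>: "\<phi> \<in> test_functions (perforated \<Omega> T \<epsilon> \<eta>)" for T :: "int^'n \<Rightarrow> (real^'n) set" and \<epsilon> \<eta> \<phi>
  proof -
    define h where "h = hole_factor CARD('n) \<eta>"
    have h: "ln 2 \<le> h" using hole_factor_ge[OF n2 \<eta>] by (simp add: h_def)
    have h0: "h > 0" using h ln_gt_zero[of "2::real"] by linarith
    have h1: "1 \<le> h / ln 2" using h by simp
    have global: "?I \<le> ennreal A * ?G"
      unfolding A_def using R \<phi> by (intro bounded_poincare_nn) (auto simp: perforated_alt)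
    have local: "\<exists>S. S \<le> C * (\<epsilon>\<^sup>2 * h) \<and> ?I \<le> ennreal S * ?G"
    proof (cases "n * \<epsilon> \<le> s0")
      case True
      let ?S = "real (card E) * (L * (n * \<epsilon>))\<^sup>2 + (a * h) * ((n * \<epsilon>)\<^sup>2 / 8)"
      have "?I \<le> ennreal ?S * ?G"
      proof (rule perforated_poincare_nn[OF \<phi> b\<Omega> \<epsilon> \<eta> n_def n E])
        show "\<exists>e\<in>E. x - (L * (n * \<epsilon>)) *\<^sub>R e \<notin> \<Omega>" if "x \<in> \<Omega>" "y \<notin> \<Omega>" "dist x y \<le> n * \<epsilon>" for x y
          using exit[of "n * \<epsilon>" x y] that True n \<epsilon> by simp
        show "ball 0 c \<subseteq> T k" for k
        proof -
          have "ball 0 c \<subseteq> ball (0::real^'n) c0" by (intro subset_ball) (simp add: c_def)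
          then show ?thesis using T unfolding admissible_holes_def by blast
        qed
        show "integral {\<eta> * c / n..1} (\<lambda>t. 1 / t ^ (CARD('n) - 1)) \<le> a * h"
          using a \<eta> by (simp add: h_def)
      qed (use c in auto)
      moreover have "?S \<le> C * (\<epsilon>\<^sup>2 * h)"
      proof -
        have "real (card E) * (L * (n * \<epsilon>))\<^sup>2 * 1 \<le> real (card E) * (L * (n * \<epsilon>))\<^sup>2 * (h / ln 2)"
          using h1 by (intro mult_left_mono) auto
        then have "?S \<le> (B1 + B2) * (\<epsilon>\<^sup>2 * h)"
          by (simp add: B1_def B2_def power_mult_distrib algebra_simps)
        also have "\<dots> \<le> C * (\<epsilon>\<^sup>2 * h)"
          using pos h0 by (intro mult_right_mono) (auto simp: C_def)
        finally show ?thesis .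
      qed
      ultimately show ?thesis by blast
    next
      case False
      then have "1 \<le> n * \<epsilon> / s0" using s0 by simp
      then have "1 \<le> (n * \<epsilon> / s0)\<^sup>2" by (simp add: one_le_power)
      then have "1 * 1 \<le> (n * \<epsilon> / s0)\<^sup>2 * (h / ln 2)" using h1 by (intro mult_mono) auto
      then have "A * 1 \<le> A * ((n * \<epsilon> / s0)\<^sup>2 * (h / ln 2))" using pos by (intro mult_left_mono) auto
      also have "\<dots> = B3 * (\<epsilon>\<^sup>2 * h)" by (simp add: B3_def power_mult_distrib power_divide)
      also have "\<dots> \<le> C * (\<epsilon>\<^sup>2 * h)"
        using pos h0 by (intro mult_right_mono) (auto simp: C_def)
      finally show ?thesis using global by auto
    qed
    show ?thesis
    proof (cases "1 \<le> \<epsilon>\<^sup>2 * h")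
      case True
      have "ennreal A * ?G \<le> ennreal C * ?G"
        using pos by (intro mult_right_mono ennreal_leI) (auto simp: C_def)
      with global have "?I \<le> ennreal C * ?G" by (rule order_trans)
      then show ?thesis using True by (simp add: h_def)
    next
      case False
      obtain S where S: "S \<le> C * (\<epsilon>\<^sup>2 * h)" "?I \<le> ennreal S * ?G" using local by blast
      have "ennreal S * ?G \<le> ennreal (C * (\<epsilon>\<^sup>2 * h)) * ?G"
        using S(1) by (intro mult_right_mono ennreal_leI) auto
      with S(2) have "?I \<le> ennreal (C * (\<epsilon>\<^sup>2 * h)) * ?G" by (rule order_trans)
      then show ?thesis using False by (simp add: h_def min_absorb2)
    qed
  qed
  moreover have "C > 0" using pos by (simp add: C_def)
  ultimately show ?thesis by blast
qed

text \<open>Translations and scalings act on the whole space, whereas the weak formulation lives on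
  \<open>U\<close>. A test function and its gradient vanish off \<open>U\<close>, so the integrals
  agree; both are finite, which allows the return to real numbers.\<close>

lemma (in bounded_open_set) poincare_from_lborel:
  assumes \<phi>: "\<phi> \<in> test_functions U" and S: "S \<ge> 0"
    and le: "(\<integral>\<^sup>+x. ennreal ((\<phi> x)\<^sup>2) \<partial>lborel) \<le> ennreal S * (\<integral>\<^sup>+x. ennreal ((norm (grad \<phi> x))\<^sup>2) \<partial>lborel)"
  shows "(\<integral>x. (\<phi> x)\<^sup>2 \<partial>M) \<le> S * (\<integral>x. (norm (grad \<phi> x))\<^sup>2 \<partial>M)"
proof -
  have conv: "(\<integral>\<^sup>+x. ennreal (f x) \<partial>lborel) = ennreal (\<integral>x. f x \<partial>M)"
    if "integrable M f" "\<And>x. f x \<ge> 0" "\<And>x. x \<notin> U \<Longrightarrow> f x = 0" for f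
  proof -
    have "ennreal (\<integral>x. f x \<partial>M) = (\<integral>\<^sup>+x. ennreal (f x) \<partial>M)"
      using that(1,2) by (intro nn_integral_eq_integral[symmetric]) auto
    also have "\<dots> = (\<integral>\<^sup>+x. ennreal (f x) * indicator U x \<partial>lebesgue)"
      using sets_U by (intro nn_integral_restrict_space) simp
    also have "\<dots> = (\<integral>\<^sup>+x. ennreal (f x) \<partial>lebesgue)"
      using that(3) by (intro nn_integral_cong) (auto simp: indicator_def)
    finally show ?thesis by (simp add: nn_integral_completion)
  qed
  have "ennreal (\<integral>x. (\<phi> x)\<^sup>2 \<partial>M) \<le> ennreal S * ennreal (\<integral>x. (norm (grad \<phi> x))\<^sup>2 \<partial>M)"
    using le square_integrable_test[OF \<phi>] square_integrable_grad_test[OF \<phi>] test_functions_outside[OF \<phi>]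
    by (simp add: conv square_integrable_def)
  then show ?thesis using S by (simp flip: ennreal_mult)
qed

lemma perforated_poincare:
  fixes \<Omega> :: "(real^'n) set"
  assumes "CARD('n) \<ge> 2" and \<Omega>: "bounded_C1_domain \<Omega>" and "c0 > 0"
  shows "\<exists>C>0. \<forall>(T :: int^'n \<Rightarrow> (real^'n) set) \<epsilon> \<eta>.
    admissible_holes c0 T \<and> 0 < \<epsilon> \<and> 0 < \<eta> \<and> \<eta> \<le> 1 \<longrightarrow>
      bounded_open_set (perforated \<Omega> T \<epsilon> \<eta>) \<and>
      (\<forall>\<phi>\<in>test_functions (perforated \<Omega> T \<epsilon> \<eta>).
        (\<integral>x. (\<phi> x)\<^sup>2 \<partial>lebesgue_on (perforated \<Omega> T \<epsilon> \<eta>))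
          \<le> C * min 1 (\<epsilon>\<^sup>2 * hole_factor CARD('n) \<eta>) *
            (\<integral>x. (norm (grad \<phi> x))\<^sup>2 \<partial>lebesgue_on (perforated \<Omega> T \<epsilon> \<eta>)))"
proof -
  obtain C where C: "C > 0" "\<forall>(T :: int^'n \<Rightarrow> (real^'n) set) \<epsilon> \<eta> \<phi>.
    admissible_holes c0 T \<and> 0 < \<epsilon> \<and> 0 < \<eta> \<and> \<eta> \<le> 1 \<and> \<phi> \<in> test_functions (perforated \<Omega> T \<epsilon> \<eta>) \<longrightarrow>
    (\<integral>\<^sup>+x. ennreal ((\<phi> x)\<^sup>2) \<partial>lborel) \<le> ennreal (C * min 1 (\<epsilon>\<^sup>2 * hole_factor CARD('n) \<eta>)) *
      (\<integral>\<^sup>+x. ennreal ((norm (grad \<phi> x))\<^sup>2) \<partial>lborel)"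
    using perforated_poincare_lborel[OF assms] by blast
  have o\<Omega>: "open \<Omega>" "bounded \<Omega>"
    using \<Omega> by (simp_all add: bounded_C1_domain_def uniform_C1_boundaries_def bounded_domain_def)
  show ?thesis
  proof (intro exI[of _ C] conjI allI impI ballI C(1); elim conjE)
    fix T :: "int^'n \<Rightarrow> (real^'n) set" and \<epsilon> \<eta> :: real
    assume H: "admissible_holes c0 T" "0 < \<epsilon>" "0 < \<eta>" "\<eta> \<le> 1"
    show *: "bounded_open_set (perforated \<Omega> T \<epsilon> \<eta>)"
      using o\<Omega> H by (intro bounded_open_set_perforated)
    have "hole_factor CARD('n) \<eta> \<ge> 0" by (simp add: hole_factor_def)
    then show "(\<integral>x. (\<phi> x)\<^sup>2 \<partial>lebesgue_on (perforated \<Omega> T \<epsilon> \<eta>))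
          \<le> C * min 1 (\<epsilon>\<^sup>2 * hole_factor CARD('n) \<eta>) *
            (\<integral>x. (norm (grad \<phi> x))\<^sup>2 \<partial>lebesgue_on (perforated \<Omega> T \<epsilon> \<eta>))"
      if "\<phi> \<in> test_functions (perforated \<Omega> T \<epsilon> \<eta>)" for \<phi>
      using C H that by (intro bounded_open_set.poincare_from_lborel[OF *]) auto
  qed
qed

lemma sqrt_min_one: "sqrt (min 1 x) = min 1 (sqrt x)"
  by (auto simp: min_def)

theorem theorem6p3:
  fixes \<Omega> :: "(real^'n) set" and c0 :: real
  assumes "CARD('n) \<ge> 2"
    and "bounded_C1_domain \<Omega>"
    and "c0 > 0"
  shows "(\<forall>p\<ge>2. \<exists>C>0. \<forall>(T :: int^'n \<Rightarrow> (real^'n) set) (D :: int^'n \<Rightarrow> (real^'n) set).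
            admissible_holes c0 T \<and> (\<forall>k. T k = closure (D k) \<and> D k \<subseteq> unit_cell) \<and>
            uniform_C1_boundaries D \<longrightarrow>
            (\<forall>\<epsilon>\<in>{0<..1}. \<forall>\<eta>\<in>{0<..1}.
               C_const p (perforated \<Omega> T \<epsilon> \<eta>) \<le> ennreal (
                 if CARD('n) \<ge> 3 then C * min 1 (\<epsilon> * \<eta> powr ((2 - real CARD('n)) / 2))
                 else C * min 1 (\<epsilon> * \<bar>ln (\<eta> / 2)\<bar> powr (1 / 2)))))
       \<and>
         (\<forall>p>1. \<exists>C>0. \<forall>(T :: int^'n \<Rightarrow> (real^'n) set) (D :: int^'n \<Rightarrow> (real^'n) set).
            admissible_holes c0 T \<and> (\<forall>k. T k = closure (D k) \<and> D k \<subseteq> unit_cell) \<and>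
            uniform_C1_boundaries D \<longrightarrow>
            (\<forall>\<epsilon>\<in>{0<..1}. \<forall>\<eta>\<in>{0<..1}.
               D_const p (perforated \<Omega> T \<epsilon> \<eta>) \<le> ennreal (
                 if CARD('n) \<ge> 3 then C * min 1 (\<epsilon>\<^sup>2 * \<eta> powr (2 - real CARD('n)))
                 else C * min 1 (\<epsilon>\<^sup>2 * \<bar>ln (\<eta> / 2)\<bar>))))"
proof -
  obtain C where C: "C > 0" and P: "\<forall>(T :: int^'n \<Rightarrow> (real^'n) set) \<epsilon> \<eta>.
    admissible_holes c0 T \<and> 0 < \<epsilon> \<and> 0 < \<eta> \<and> \<eta> \<le> 1 \<longrightarrow>
      bounded_open_set (perforated \<Omega> T \<epsilon> \<eta>) \<and>
      (\<forall>\<phi>\<in>test_functions (perforated \<Omega> T \<epsilon> \<eta>).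
        (\<integral>x. (\<phi> x)\<^sup>2 \<partial>lebesgue_on (perforated \<Omega> T \<epsilon> \<eta>))
          \<le> C * min 1 (\<epsilon>\<^sup>2 * hole_factor CARD('n) \<eta>) *
            (\<integral>x. (norm (grad \<phi> x))\<^sup>2 \<partial>lebesgue_on (perforated \<Omega> T \<epsilon> \<eta>)))"
    using perforated_poincare[OF assms] by blast
  let ?h = "hole_factor CARD('n)"
  have h: "?h \<eta> > 0" if "0 < \<eta>" "\<eta> \<le> 1" for \<eta>
    using hole_factor_ge[OF assms(1) that] ln_gt_zero[of "2::real"] by linarith
  have S: "C * min 1 (\<epsilon>\<^sup>2 * ?h \<eta>) > 0" if "0 < \<epsilon>" "0 < \<eta>" "\<eta> \<le> 1" for \<epsilon> \<eta>
    using C that h by simp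
  have "C_const p (perforated \<Omega> T \<epsilon> \<eta>) \<le> ennreal (
      if CARD('n) \<ge> 3 then p * sqrt ((p - 1) * C) * min 1 (\<epsilon> * \<eta> powr ((2 - real CARD('n)) / 2))
      else p * sqrt ((p - 1) * C) * min 1 (\<epsilon> * \<bar>ln (\<eta> / 2)\<bar> powr (1 / 2)))"
    if p: "p \<ge> 2" and T: "admissible_holes c0 T" and \<epsilon>: "0 < \<epsilon>" and \<eta>: "0 < \<eta>" "\<eta> \<le> 1"
    for p \<epsilon> \<eta> and T :: "int^'n \<Rightarrow> (real^'n) set"
  proof -
    \<comment> \<open>The square root of S passes through the minimum and turns \<epsilon>^2
      \<open>hole_factor\<close> into \<epsilon> times its square root. The remaining factor depends
      on p and on the Poincare constant only, and serves as the witness.\<close>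
    have "C_const p (perforated \<Omega> T \<epsilon> \<eta>) \<le> ennreal (p * sqrt ((p - 1) * (C * min 1 (\<epsilon>\<^sup>2 * ?h \<eta>))))"
      using P T \<epsilon> \<eta> S[OF \<epsilon> \<eta>] p by (intro bounded_open_set.C_const_le) auto
    also have "p * sqrt ((p - 1) * (C * min 1 (\<epsilon>\<^sup>2 * ?h \<eta>)))
        = p * sqrt ((p - 1) * C) * min 1 (\<epsilon> * sqrt (?h \<eta>))"
      using \<epsilon> by (simp add: real_sqrt_mult sqrt_min_one)
    also have "sqrt (?h \<eta>) =
        (if CARD('n) \<ge> 3 then \<eta> powr ((2 - real CARD('n)) / 2) else \<bar>ln (\<eta> / 2)\<bar> powr (1 / 2))"
      by (simp add: hole_factor_def powr_powr flip: powr_half_sqrt)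
    finally show ?thesis by (simp split: if_splits)
  qed
  moreover have "D_const p (perforated \<Omega> T \<epsilon> \<eta>) \<le> ennreal (
      if CARD('n) \<ge> 3 then 2 * p\<^sup>2 / min 1 (p - 1) * C * min 1 (\<epsilon>\<^sup>2 * \<eta> powr (2 - real CARD('n)))
      else 2 * p\<^sup>2 / min 1 (p - 1) * C * min 1 (\<epsilon>\<^sup>2 * \<bar>ln (\<eta> / 2)\<bar>))"
    if p: "p > 1" and T: "admissible_holes c0 T" and \<epsilon>: "0 < \<epsilon>" and \<eta>: "0 < \<eta>" "\<eta> \<le> 1"
    for p \<epsilon> \<eta> and T :: "int^'n \<Rightarrow> (real^'n) set"
  proof -
    have "D_const p (perforated \<Omega> T \<epsilon> \<eta>) \<le> ennreal (2 * p\<^sup>2 / min 1 (p - 1) * (C * min 1 (\<epsilon>\<^sup>2 * ?h \<eta>)))"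
      using P T \<epsilon> \<eta> S[OF \<epsilon> \<eta>] p by (intro bounded_open_set.D_const_le) auto
    then show ?thesis by (simp add: hole_factor_def mult.assoc split: if_splits)
  qed
  moreover have "p * sqrt ((p - 1) * C) > 0" if "p \<ge> 2" for p using C that by simp
  moreover have "2 * p\<^sup>2 / min 1 (p - 1) * C > 0" if "p > 1" for p using C that by simp
  ultimately show ?thesis by (intro conjI allI impI) (metis greaterThanAtMost_iff)+
qed

end
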